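(* Let $d\ge1$ and let $\sigma\in S_d$ be a $d$-cycle. Let $\ell$ be a prime with $\ell\equiv1\pmod d$ and let $\alpha>1$ be such that $$|P'_{\alpha,\ell}(x)|\ge(\log x)^{\alpha-o(1)}\quad\text{as }x\to\infty.$$ Then $$\sum_{n<x}L_d^\sigma(n)\ge x^{2-\alpha^{-1}-o(1)}\quad\text{as }x\to\infty,$$ where the sum is over odd composite integers $n<x$.
   Context: $M(x)$ denotes the least common multiple of all positive integers up to $\frac{\log x}{\log\log x}$, and $P'_{\alpha,\ell}(x)$ is the set of primes $p<(\log x)^\alpha$ such that $p\equiv1\pmod\ell$ and $(p-1)\mid M(x)$. The notation $o(1)$ stands for a function of $x$ tending to $0$ as $x\to\infty$. For monic polynomials $g_1,g_2$ over $\mathbb{Z}/n\mathbb{Z}$, $\operatorname{gcmd}_n(g_1,g_2)$ is the monic polynomial generating the ideal $(g_1,g_2)$ of $(\mathbb{Z}/n\mathbb{Z})[x]$, if it exists. Let $n>1$ be odd and $f$ monic of degree $d$ over $\mathbb{Z}/n\mathbb{Z}$ with $\gcd(n,f(0)\Delta_f)=1$ ($\Delta_f$ the discriminant). Factorization step: put $f_0=f$, and for $i\ge1$ let $F_i=\operatorname{gcmd}_n(x^{n^i}-x,f_{i-1})$, $f_i=f_{i-1}/F_i$; the pair $(f,n)$ passes if all these gcmd's exist and $f_d=1$. Then the cycle structure of $(f,n)$ is $(\deg F_1/1,\ldots,\deg F_d/d)$, identified with the conjugacy class in $S_d$ having $\deg F_i/i$ cycles of length $i$. Frobenius step: $F_i(x^n)\equiv0\pmod{(n,F_i(x))}$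 for $2\le i\le d$. Jacobi step: $(-1)^S=\left(\frac{\Delta_f}{n}\right)$ with $S=\sum_{2\mid i}\deg(F_i)/i$. $(f,n)$ is a Frobenius pseudoprime if it passes all three steps. $L_d^\sigma(n)$ is the number of monic polynomials $f$ modulo $n$ of degree $d$ such that $(f,n)$ is a Frobenius pseudoprime with cycle structure that of $\sigma$. *)

theory Defs
  imports
    "HOL-Analysis.Analysis"
    "HOL-Number_Theory.Number_Theory"
    "HOL-Combinatorics.Permutations"
    "HOL-Combinatorics.Orbits"
    "Subresultants.Resultant_Prelim"
    "Berlekamp_Zassenhaus.Poly_Mod"
begin

section \<open>Polynomials over the integers modulo n\<close>

text \<open>
  Elements of (Z/nZ)[x] are represented by integer polynomials up to the library congruence
  \<^const>\<open>poly_mod.eq_m\<close>; \<^term>\<open>poly_mod.Mp n f = f\<close> says that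
  \<^term>\<open>f\<close> is the canonical representative, with all coefficients in the range from 0 to n - 1.
  For n > 1 the canonical representative of a monic polynomial is monic of the same degree.
\<close>

definition monic_mod :: "int \<Rightarrow> int poly \<Rightarrow> bool" where
  "monic_mod n f \<longleftrightarrow> monic f \<and> poly_mod.Mp n f = f"

definition ideal_mod :: "int \<Rightarrow> int poly \<Rightarrow> int poly \<Rightarrow> int poly set" where
  "ideal_mod n g1 g2 = {q. \<exists>a b. poly_mod.eq_m n q (a * g1 + b * g2)}"

definition principal_ideal_mod :: "int \<Rightarrow> int poly \<Rightarrow> int poly set" where
  "principal_ideal_mod n h = {q. poly_mod.dvdm n h q}"

text \<open>
  A relation rather than a function, because gcmd need not exist. For n > 1 there is at most one
  such \<^term>\<open>h\<close>, since monic associates are equal.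
\<close>

definition is_gcmd :: "int \<Rightarrow> int poly \<Rightarrow> int poly \<Rightarrow> int poly \<Rightarrow> bool" where
  "is_gcmd n g1 g2 h \<longleftrightarrow> monic_mod n h \<and> principal_ideal_mod n h = ideal_mod n g1 g2"

text \<open>
  The sign is the usual normalisation for monic polynomials. The value is computed for an integer
  representative, so the degree of the derivative does not drop when n and the degree share a
  factor; modulo n it depends only on the residue class of the (monic) polynomial.
\<close>

definition discriminant :: "int poly \<Rightarrow> int" where
  "discriminant f = (-1) ^ (degree f * (degree f - 1) div 2) * resultant f (pderiv f)"

definition jacobi_symbol :: "int \<Rightarrow> nat \<Rightarrow> int" where
  "jacobi_symbol a n = (\<Prod>p\<in>#prime_factorization n. Legendre a (int p))"

section \<open>Frobenius pseudoprimes\<close>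

text \<open>
  \<^term>\<open>F i\<close> is only meaningful for i from 1 to the degree of f, where it is uniquely determined.
  The sequence \<^term>\<open>r\<close> is the sequence of successive quotients: as the divisor is monic, the
  quotient is the unique polynomial modulo n satisfying the product equation.
\<close>

definition factorization_step :: "nat \<Rightarrow> int poly \<Rightarrow> (nat \<Rightarrow> int poly) \<Rightarrow> bool" where
  "factorization_step n f F \<longleftrightarrow>
     (\<exists>r :: nat \<Rightarrow> int poly.
        r 0 = f \<and>
        (\<forall>i\<in>{1..degree f}.
           is_gcmd (int n) ([:0, 1:] ^ (n ^ i) - [:0, 1:]) (r (i - 1)) (F i) \<and>
           poly_mod.eq_m (int n) (r (i - 1)) (F i * r i)) \<and>
        poly_mod.eq_m (int n) (r (degree f)) 1)"

definition frobenius_step :: "nat \<Rightarrow> int poly \<Rightarrow> (nat \<Rightarrow> int poly) \<Rightarrow> bool" where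
  "frobenius_step n f F \<longleftrightarrow>
     (\<forall>i\<in>{2..degree f}. poly_mod.dvdm (int n) (F i) (pcompose (F i) ([:0, 1:] ^ n)))"

text \<open>
  The division by \<^term>\<open>i\<close> is exact once the two preceding steps are passed: modulo a prime
  factor of n, raising to the n-th power permutes the roots of \<^term>\<open>F i\<close> in cycles of length i.
\<close>

definition jacobi_step :: "nat \<Rightarrow> int poly \<Rightarrow> (nat \<Rightarrow> int poly) \<Rightarrow> bool" where
  "jacobi_step n f F \<longleftrightarrow>
     (-1) ^ (\<Sum>i\<in>{i\<in>{1..degree f}. even i}. degree (F i) div i) = jacobi_symbol (discriminant f) n"

definition frobenius_pseudoprime_via :: "int poly \<Rightarrow> nat \<Rightarrow> (nat \<Rightarrow> int poly) \<Rightarrow> bool" where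
  "frobenius_pseudoprime_via f n F \<longleftrightarrow>
     n > 1 \<and> odd n \<and> monic_mod (int n) f \<and> coprime (int n) (poly f 0 * discriminant f) \<and>
     factorization_step n f F \<and> frobenius_step n f F \<and> jacobi_step n f F"

text \<open>Fixed points form orbits of size 1 and are counted as cycles of length 1.\<close>

definition cycle_count :: "nat \<Rightarrow> (nat \<Rightarrow> nat) \<Rightarrow> nat \<Rightarrow> nat" where
  "cycle_count d \<sigma> i = card {C. \<exists>a\<in>{1..d}. C = orbit \<sigma> a \<and> card C = i}"

text \<open>
  The witness \<^term>\<open>F\<close> is unique on the relevant indices, so the pseudoprime test and the cycle
  structure refer to the same factorization.
\<close>

definition frobenius_count :: "nat \<Rightarrow> (nat \<Rightarrow> nat) \<Rightarrow> nat \<Rightarrow> nat" where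
  "frobenius_count d \<sigma> n = card {f :: int poly. monic_mod (int n) f \<and> degree f = d \<and>
     (\<exists>F. frobenius_pseudoprime_via f n F \<and>
          (\<forall>i\<in>{1..d}. real (degree (F i)) / real i = real (cycle_count d \<sigma> i)))}"

section \<open>The primes used in the construction\<close>

definition lcm_bound :: "real \<Rightarrow> nat" where
  "lcm_bound x = Lcm {k :: nat. k > 0 \<and> real k \<le> ln x / ln (ln x)}"

definition P_set :: "real \<Rightarrow> nat \<Rightarrow> real \<Rightarrow> nat set" where
  "P_set \<alpha> l x = {p :: nat. prime p \<and> real p < ln x powr \<alpha> \<and> [p = 1] (mod l) \<and> (p - 1) dvd lcm_bound x}"

end

theory Submission
  imports Defs "HOL-Real_Asymp.Real_Asymp"
begin

text \<open>
  Every pseudoprime counted has the form \<open>n = s * m\<close>, where \<open>s\<close> is a product of about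
  \<open>ln x / (\<alpha> * ln (ln x))\<close> primes of the set \<open>P_set\<close> and the cofactor \<open>m\<close> is
  of size \<open>x powr o(1)\<close>. Let \<open>b\<close> be an element of order \<open>d\<close> modulo \<open>l\<close> and
  \<open>M = lcm_bound x\<close>. The cofactor is chosen such that \<open>n ^ d = 1\<close> modulo \<open>M\<close> and
  \<open>n = b\<close> modulo \<open>l\<close>. Then \<open>n ^ d = 1\<close> modulo \<open>p - 1\<close> for each
  prime \<open>p\<close> dividing \<open>s\<close>. As \<open>n\<close> has order \<open>d\<close> modulo \<open>l\<close>,
  raising to the power \<open>n\<close> moves the residues \<open>a\<close> with \<open>a ^ ((p - 1) div l) \<noteq> 1\<close>
  modulo \<open>p\<close>, of which there are at least \<open>(p - 1) / 2\<close>, in cycles of length \<open>d\<close>.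
  By the Chinese remainder theorem at least the product
  of the \<open>(p - 1) / (2 * d)\<close> polynomials pass the test for \<open>n\<close>, and choosing \<open>s\<close> and these
  polynomials independently gives the bound.

  Instead of a prime in an arithmetic progression, which would require Linnik's theorem, the cofactor
  is a product of two explicit numbers. The first is the norm of an element of the subfield of degree
  \<open>(l - 1) / d\<close> of the field of \<open>l\<close>-th roots of unity, whose Galois group over the
  subfield is generated by \<open>b\<close>. A norm is \<open>b\<close> modulo \<open>l\<close> for a suitable element,
  and the minimal polynomial of a root of unity over the subfield, reduced modulo that element, has
  integer coefficients and a single Frobenius cycle. The second is a product of three values of the
  form \<open>(u ^ l - v ^ l) / (u - v)\<close>, all of whose prime factors are \<open>1\<close> modulo
  \<open>l\<close>; by a theorem of Redei on the directions determined by a function these values meet the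
  residue class modulo \<open>M\<close> that the second factor must lie in.
\<close>

hide_const (open) up_ring.monom up_ring.coeff module.smult

section \<open>The discriminant of a product of linear factors\<close>

text \<open>The exponent is a count. With L = ln x, about L / (\<alpha> * ln L) primes of size
  nearly L^\<alpha> give x^(1 - 1/\<alpha> - o(1)) products s close to x, and each carries x^(1 -
  o(1)) polynomials. A cofactor bound x^o(1) is lost in the error, so crude estimates for it
  suffice, even though several s may lead to the same n. Two obstacles force the nonsplit part of
  the cofactor. All primes of s are 1 modulo l, so s alone cannot have order d > 1 modulo l; and the
  discriminant modulo the split part is a square, so for even d the Jacobi step needs another factor
  with symbol -1. The factorization of the norm is not known. Its polynomial is therefore built from
  roots in a quotient ring that contains Z/N, and discriminants, gcmd's and symbols are all read off
  from congruences modulo an ideal J. The bound on directions is empty for primes up to 6 * l. There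
  the class to be met is arranged to be 1, by taking s = 1 modulo fact (6 * l).\<close>

lemma sylvester_mat_sub_coeff:
  fixes p q :: "'a :: comm_ring_1 poly"
  assumes "degree p \<le> m" "degree q \<le> n" "i < m + n" "j < m + n"
  shows "sylvester_mat_sub m n p q $$ (i, j) =
    (if i < n then coeff (monom 1 (n - 1 - i) * p) (m + n - 1 - j)
     else coeff (monom 1 (m + n - 1 - i) * q) (m + n - 1 - j))"
proof (cases "i < n")
  case True
  have "m + n - 1 - j \<ge> n - 1 - i \<Longrightarrow> m + n - 1 - j - (n - 1 - i) = m + i - j"
    using True assms by linarith
  moreover have "coeff p (m + i - j) = 0" if "i > j" using that assms by (intro coeff_eq_0) auto
  ultimately show ?thesis using True assms
    by (auto simp: sylvester_mat_sub_index coeff_monom_mult)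
next
  case False
  have "m + n - 1 - j \<ge> m + n - 1 - i \<Longrightarrow> m + n - 1 - j - (m + n - 1 - i) = i - j"
    using False assms by linarith
  moreover have "coeff q (i - j) = 0" if "i - n > j" using that assms by (intro coeff_eq_0) auto
  ultimately show ?thesis using False assms
    by (auto simp: sylvester_mat_sub_index coeff_monom_mult)
qed

text \<open>Subtracting \<^term>\<open>a\<close> times the next row from each row of multiples of \<^term>\<open>g\<close> makes
  every row but the last divisible by the linear factor; dividing it out is a unipotent column
  operation that leaves a single nonzero entry in the last column.\<close>

lemma resultant_sub_linear_factor:
  fixes a :: "'a :: comm_ring_1"
  assumes h: "degree h \<le> m" and g: "degree g \<le> n"
  shows "resultant_sub (Suc m) n ([:-a, 1:] * h) g = poly g a * resultant_sub m n h g"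
proof -
  define p where "p = [:-a, 1:] * h"
  define K where "K = m + n"
  define A where "A = sylvester_mat_sub (Suc m) n p g"
  define L where "L = mat (Suc K) (Suc K)
    (\<lambda>(i, t). if t = i then 1 else if t = Suc i \<and> n \<le> i then - a else 0)"
  define E where "E = mat (Suc K) (Suc K)
    (\<lambda>(t, j). if t = j then 1 else if j = Suc t then - a else 0)"
  \<comment> \<open>Read as a polynomial, row i of \<open>L * A\<close> is the linear factor times
    \<open>Q i\<close>, plus the remainder \<open>poly g a\<close> in the last row. \<open>E\<close>
    is multiplication by the linear factor; \<open>B\<close> keeps the quotients and, in its extra
    last column, the remainder.\<close>
  define Q where "Q = (\<lambda>i. if i < n then monom 1 (n - 1 - i) * h
     else if i < K then monom 1 (K - 1 - i) * g else synthetic_div g a)"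
  define B where "B = mat (Suc K) (Suc K)
    (\<lambda>(i, j). if j = K then (if i = K then poly g a else 0) else coeff (Q i) (K - 1 - j))"
  have degp: "degree p \<le> Suc m"
    using degree_mult_le[of "[:-a, 1:]" h] h unfolding p_def by (auto split: if_splits)
  have A: "A \<in> carrier_mat (Suc K) (Suc K)" and L: "L \<in> carrier_mat (Suc K) (Suc K)"
    and E: "E \<in> carrier_mat (Suc K) (Suc K)" and B: "B \<in> carrier_mat (Suc K) (Suc K)"
    by (auto simp: A_def L_def E_def B_def K_def)
  have degh: "degree (monom 1 (n - 1 - i) * h) < K" if "i < n" for i
    using that h degree_mult_le[of "monom 1 (n - 1 - i)" h] degree_monom_le[of "1::'a" "n - 1 - i"]
    by (simp add: K_def)
  have degg: "degree (monom 1 (K - 1 - i) * g) < K" if "n \<le> i" "i < K" for i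
    using that g degree_mult_le[of "monom 1 (K - 1 - i)" g] degree_monom_le[of "1::'a" "K - 1 - i"]
    by (simp add: K_def)
  have degs: "coeff (synthetic_div g a) K = 0" if "K \<ge> n"
  proof (cases "degree g = 0")
    case True thus ?thesis by (simp add: synthetic_div_eq_0_iff[THEN iffD2])
  next
    case False
    thus ?thesis using that g by (intro coeff_eq_0) (simp add: degree_synthetic_div)
  qed
  have degQ: "coeff (Q i) K = 0" if "i \<le> K" for i
    using that degh[of i] degg[of i] degs by (auto simp: Q_def K_def intro!: coeff_eq_0)
  have entry: "A $$ (i, j) = (if i < n then coeff (monom 1 (n - 1 - i) * p) (K - j)
     else coeff (monom 1 (K - i) * g) (K - j))" if "i \<le> K" "j \<le> K" for i j
    using sylvester_mat_sub_coeff[OF degp g, of i j] that by (simp add: A_def K_def)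
  have LA: "(L * A) $$ (i, j) = A $$ (i, j) - (if n \<le> i \<and> i < K then a * A $$ (Suc i, j) else 0)"
    if ij: "i \<le> K" "j \<le> K" for i j
  proof -
    have "(L * A) $$ (i, j) = (\<Sum>t = 0..<Suc K. L $$ (i, t) * A $$ (t, j))"
      using ij L A by (simp add: scalar_prod_def del: sum.op_ivl_Suc)
    also have "\<dots> = (\<Sum>t = 0..<Suc K. (if t = i then A $$ (i, j) else 0) +
        (if t = Suc i then (if n \<le> i then - a * A $$ (Suc i, j) else 0) else 0))"
      using ij by (intro sum.cong) (auto simp: L_def)
    also have "\<dots> = A $$ (i, j) - (if n \<le> i \<and> i < K then a * A $$ (Suc i, j) else 0)"
      using ij by (subst sum.distrib) (auto simp del: sum.op_ivl_Suc)
    finally show ?thesis .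
  qed
  have BE: "(B * E) $$ (i, j) = B $$ (i, j) - (if j > 0 then a * B $$ (i, j - 1) else 0)"
    if ij: "i \<le> K" "j \<le> K" for i j
  proof -
    have "(B * E) $$ (i, j) = (\<Sum>t = 0..<Suc K. B $$ (i, t) * E $$ (t, j))"
      using ij B E by (simp add: scalar_prod_def del: sum.op_ivl_Suc)
    also have "\<dots> = (\<Sum>t = 0..<Suc K. (if t = j then B $$ (i, j) else 0) +
        (if t = j - 1 then (if j > 0 then - a * B $$ (i, j - 1) else 0) else 0))"
      using ij by (intro sum.cong) (auto simp: E_def)
    also have "\<dots> = B $$ (i, j) - (if j > 0 then a * B $$ (i, j - 1) else 0)"
      using ij by (subst sum.distrib) (auto simp del: sum.op_ivl_Suc)
    finally show ?thesis .
  qed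
  have BE': "(B * E) $$ (i, j) = coeff ([:-a, 1:] * Q i + (if i = K then [:poly g a:] else 0)) (K - j)"
    if ij: "i \<le> K" "j \<le> K" for i j
  proof -
    have 1: "coeff ([:-a, 1:] * Q i) (K - j) = (if j < K then coeff (Q i) (K - 1 - j) else 0) - a * coeff (Q i) (K - j)"
    proof (cases "K - j")
      case (Suc r)
      hence "K - 1 - j = r" "j < K" by arith+
      thus ?thesis by (simp add: Suc)
    qed (use ij in auto)
    have 2: "coeff (if i = K then [:poly g a:] else 0) (K - j) = (if i = K \<and> j = K then poly g a else 0)"
      using ij by (auto simp: coeff_pCons split: nat.split)
    have 3: "B $$ (i, j) = (if j = K then (if i = K then poly g a else 0) else coeff (Q i) (K - 1 - j))"
      using ij by (simp add: B_def)
    have 4: "j > 0 \<Longrightarrow> B $$ (i, j - 1) = coeff (Q i) (K - j)"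
      using ij by (auto simp add: B_def)
    show ?thesis
      unfolding BE[OF ij] coeff_add 1 2 3 using 4 ij degQ[of i] by auto
  qed
  have "L * A = B * E"
  proof (rule eq_matI)
    fix i j assume "i < dim_row (B * E)" "j < dim_col (B * E)"
    hence ij: "i \<le> K" "j \<le> K" using B E by auto
    consider "i < n" | "n \<le> i" "i < K" | "n \<le> i" "i = K" using ij by linarith
    thus "(L * A) $$ (i, j) = (B * E) $$ (i, j)"
    proof cases
      case 1
      have "[:-a, 1:] * Q i = monom 1 (n - 1 - i) * p"
        using 1 by (simp only: Q_def p_def if_True mult.left_commute)
      moreover have "i \<noteq> K" using 1 by (simp add: K_def)
      ultimately show ?thesis
        unfolding LA[OF ij] BE'[OF ij] entry[OF ij] using 1 by simp
    next
      case 2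
      have "monom 1 (K - i) = monom (1::'a) (Suc (K - 1 - i))" using 2 by (metis Suc_diff_Suc diff_Suc_eq_diff_pred)
      hence "[:-a, 1:] * Q i = monom 1 (K - i) * g - smult a (monom 1 (K - Suc i) * g)"
        using 2 by (simp add: Q_def monom_Suc)
      thus ?thesis
        unfolding LA[OF ij] BE'[OF ij] using entry[of i j] entry[of "Suc i" j] 2 ij by simp
    next
      case 3
      have "[:-a, 1:] * synthetic_div g a + [:poly g a:] = g"
        using synthetic_div_correct'[of a g] by simp
      thus ?thesis using 3
        unfolding LA[OF ij] BE'[OF ij] using entry[of i j] ij by (simp add: Q_def)
    qed
  qed (use A B L E in auto)
  hence "det L * det A = det B * det E"
    using det_mult[OF L A] det_mult[OF B E] by simp
  moreover have "det L = 1"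
    using det_upper_triangular[OF _ L] L
    by (auto simp: upper_triangular_def L_def diag_mat_def intro!: prod_list_neutral)
  moreover have "det E = 1"
    using det_upper_triangular[OF _ E] E
    by (auto simp: upper_triangular_def E_def diag_mat_def intro!: prod_list_neutral)
  moreover have "det B = poly g a * det (sylvester_mat_sub m n h g)"
  proof -
    have "mat_delete B K K = sylvester_mat_sub m n h g"
    proof (rule eq_matI)
      fix i j assume "i < dim_row (sylvester_mat_sub m n h g)" "j < dim_col (sylvester_mat_sub m n h g)"
      hence ij: "i < K" "j < K" by (auto simp: K_def)
      have "mat_delete B K K $$ (i, j) = B $$ (i, j)"
        using ij B by (simp add: mat_delete_def)
      also have "\<dots> = coeff (Q i) (K - 1 - j)" using ij by (simp add: B_def)
      also have "\<dots> = sylvester_mat_sub m n h g $$ (i, j)"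
        using ij sylvester_mat_sub_coeff[OF h g, of i j] by (simp add: Q_def K_def)
      finally show "mat_delete B K K $$ (i, j) = sylvester_mat_sub m n h g $$ (i, j)" .
    qed (use B in \<open>auto simp: K_def mat_delete_def\<close>)
    moreover have "det B = (\<Sum>i<Suc K. B $$ (i, K) * cofactor B i K)"
      using laplace_expansion_column[OF B, of K] by simp
    moreover have "\<dots> = (\<Sum>i<Suc K. if i = K then poly g a * cofactor B K K else 0)"
      by (intro sum.cong) (auto simp: B_def)
    ultimately show ?thesis by (simp add: cofactor_def)
  qed
  ultimately show ?thesis by (simp add: resultant_sub_def A_def p_def)
qed


lemma degree_prod_linear_le: "degree (\<Prod>j<d. [:- a j, 1:]) \<le> (d :: nat)"
  for a :: "nat \<Rightarrow> 'a :: comm_ring_1"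
proof (induction d)
  case (Suc d)
  show ?case using degree_mult_le[of "\<Prod>j<d. [:- a j, 1:]" "[:- a d, 1:]"] Suc
    by (auto simp: mult.commute split: if_splits)
qed simp

lemma monic_prod_linear:
  fixes a :: "nat \<Rightarrow> 'a :: comm_ring_1"
  shows "coeff (\<Prod>j<d. [:- a j, 1:]) d = 1"
proof (induction d)
  case (Suc d)
  have "coeff (\<Prod>j<d. [:- a j, 1:]) (Suc d) = 0"
    using degree_prod_linear_le[of a d] by (intro coeff_eq_0) simp
  thus ?case using Suc by (simp add: mult.commute)
qed simp

text \<open>The formal degree n of g stays fixed during the induction, so the formula survives a
  drop of the actual degree, as happens to derivatives in positive characteristic.\<close>

lemma resultant_sub_prod_linear:
  fixes a :: "nat \<Rightarrow> 'a :: comm_ring_1"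
  assumes "degree g \<le> n"
  shows "resultant_sub d n (\<Prod>j<d. [:- a j, 1:]) g = (\<Prod>j<d. poly g (a j))"
proof (induction d)
  case 0
  have "sylvester_mat_sub 0 n 1 g = 1\<^sub>m n"
    by (rule eq_matI) (auto simp: sylvester_mat_sub_index)
  thus ?case by (simp add: resultant_sub_def)
next
  case (Suc d)
  show ?case
    using resultant_sub_linear_factor[OF degree_prod_linear_le[of a d] assms, of "a d"] Suc
    by (simp add: mult.commute)
qed

lemma poly_pderiv_prod_linear:
  fixes a :: "nat \<Rightarrow> 'a :: idom"
  assumes "i < d"
  shows "poly (pderiv (\<Prod>j<d. [:- a j, 1:])) (a i) = (\<Prod>j\<in>{..<d} - {i}. a i - a j)"
proof -
  have "(\<Prod>j<d. [:- a j, 1:]) = [:- a i, 1:] * (\<Prod>j\<in>{..<d} - {i}. [:- a j, 1:])"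
    using assms by (intro prod.remove) auto
  thus ?thesis
    by (simp add: pderiv_mult poly_prod pderiv_pCons del: mult_pCons_left)
qed

text \<open>The factors for (i, j) and (j, i) multiply to minus a square, and
  \<open>d * (d - 1) div 2\<close> counts these pairs. The discriminant thus becomes a visible
  square in the ring of the roots, which later decides Jacobi symbols.\<close>

lemma prod_root_differences:
  fixes a :: "nat \<Rightarrow> 'a :: idom"
  shows "(-1) ^ (d * (d - 1) div 2) * (\<Prod>i<d. \<Prod>j\<in>{..<d} - {i}. a i - a j)
    = (\<Prod>j<d. \<Prod>i<j. (a i - a j)\<^sup>2)"
proof (induction d)
  case (Suc d)
  have e: "Suc d * (Suc d - 1) div 2 = d * (d - 1) div 2 + d"
  proof -
    have "Suc d * (Suc d - 1) = d * (d - 1) + d * 2" by (cases d) auto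
    thus ?thesis by simp
  qed
  have "(\<Prod>i<d. \<Prod>j\<in>{..<Suc d} - {i}. a i - a j)
      = (\<Prod>i<d. (\<Prod>j\<in>{..<d} - {i}. a i - a j) * (a i - a d))"
  proof (intro prod.cong refl)
    fix i assume "i \<in> {..<d}"
    hence "{..<Suc d} - {i} = insert d ({..<d} - {i})" by auto
    thus "(\<Prod>j\<in>{..<Suc d} - {i}. a i - a j) = (\<Prod>j\<in>{..<d} - {i}. a i - a j) * (a i - a d)"
      by (simp add: mult.commute)
  qed
  moreover have "{..<Suc d} - {d} = {..<d}" by auto
  ultimately have "(\<Prod>i<Suc d. \<Prod>j\<in>{..<Suc d} - {i}. a i - a j) =
     (\<Prod>i<d. \<Prod>j\<in>{..<d} - {i}. a i - a j) * ((\<Prod>i<d. a i - a d) * (\<Prod>i<d. a d - a i))"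
    by (simp add: prod.distrib mult_ac)
  also have "(\<Prod>i<d. a i - a d) * (\<Prod>i<d. a d - a i) = (\<Prod>i<d. (-1) * (a i - a d)\<^sup>2)"
    unfolding prod.distrib[symmetric] by (intro prod.cong) (auto simp: power2_eq_square algebra_simps)
  also have "\<dots> = (-1) ^ d * (\<Prod>i<d. (a i - a d)\<^sup>2)" by (subst prod.distrib) simp
  finally have *: "(\<Prod>i<Suc d. \<Prod>j\<in>{..<Suc d} - {i}. a i - a j) =
     (\<Prod>i<d. \<Prod>j\<in>{..<d} - {i}. a i - a j) * ((-1) ^ d * (\<Prod>i<d. (a i - a d)\<^sup>2))"
    by (simp only:)
  have "(-1) ^ (Suc d * (Suc d - 1) div 2) * (\<Prod>i<Suc d. \<Prod>j\<in>{..<Suc d} - {i}. a i - a j) =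
    ((-1) ^ (d * (d - 1) div 2) * (\<Prod>i<d. \<Prod>j\<in>{..<d} - {i}. a i - a j)) *
      (\<Prod>i<d. (a i - a d)\<^sup>2) * ((-1) ^ d * (-1) ^ d)"
    unfolding e power_add * by (simp only: mult_ac)
  also have "(-1) ^ d * (-1) ^ d = (1 :: 'a)" by (simp flip: power_mult_distrib)
  also have "(-1) ^ (d * (d - 1) div 2) * (\<Prod>i<d. \<Prod>j\<in>{..<d} - {i}. a i - a j) *
    (\<Prod>i<d. (a i - a d)\<^sup>2) * 1 = (\<Prod>j<Suc d. \<Prod>i<j. (a i - a j)\<^sup>2)"
    unfolding Suc by simp
  finally show ?case .
qed simp

section \<open>Congruences modulo an ideal\<close>

definition ring_ideal :: "'a :: comm_ring_1 set \<Rightarrow> bool" where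
  "ring_ideal J \<longleftrightarrow> 0 \<in> J \<and> (\<forall>x\<in>J. \<forall>y\<in>J. x + y \<in> J) \<and> (\<forall>x\<in>J. \<forall>r. r * x \<in> J)"

lemma ring_idealD:
  assumes "ring_ideal J"
  shows "0 \<in> J" "x \<in> J \<Longrightarrow> y \<in> J \<Longrightarrow> x + y \<in> J" "x \<in> J \<Longrightarrow> r * x \<in> J" "x \<in> J \<Longrightarrow> x * r \<in> J"
    "x \<in> J \<Longrightarrow> - x \<in> J" "x \<in> J \<Longrightarrow> y \<in> J \<Longrightarrow> x - y \<in> J"
proof -
  show 1: "0 \<in> J" "x \<in> J \<Longrightarrow> y \<in> J \<Longrightarrow> x + y \<in> J" "x \<in> J \<Longrightarrow> r * x \<in> J" for x y r
    using assms by (auto simp: ring_ideal_def)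
  show "x \<in> J \<Longrightarrow> x * r \<in> J" using 1(3)[of x r] by (simp add: mult.commute)
  show 2: "x \<in> J \<Longrightarrow> - x \<in> J" for x using 1(3)[of x "-1"] by simp
  show "x \<in> J \<Longrightarrow> y \<in> J \<Longrightarrow> x - y \<in> J" using 1(2)[of x "-y"] 2[of y] by simp
qed

lemma ring_ideal_sum:
  assumes "ring_ideal J" "\<And>i. i \<in> A \<Longrightarrow> f i \<in> J"
  shows "sum f A \<in> J"
  using assms(2) by (induction A rule: infinite_finite_induct) (auto intro: ring_idealD[OF assms(1)])

lemma ring_ideal_prod_diff:
  assumes J: "ring_ideal J" and "\<And>i. i \<in> A \<Longrightarrow> f i - g i \<in> J"
  shows "prod f A - prod g A \<in> J"
  using assms(2)
proof (induction A rule: infinite_finite_induct)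
  case (insert x A)
  have "f x * prod f A - g x * prod g A = f x * (prod f A - prod g A) + (f x - g x) * prod g A"
    by (simp add: algebra_simps)
  thus ?case using insert
    by (simp add: ring_idealD(2)[OF J] ring_idealD(3)[OF J] ring_idealD(4)[OF J])
qed (auto intro: ring_idealD[OF J])

lemma ring_ideal_det_diff:
  assumes J: "ring_ideal J" and A: "A \<in> carrier_mat n n" and B: "B \<in> carrier_mat n n"
    and AB: "\<And>i j. i < n \<Longrightarrow> j < n \<Longrightarrow> A $$ (i, j) - B $$ (i, j) \<in> J"
  shows "Determinant.det A - Determinant.det B \<in> J"
  unfolding det_def'[OF A] det_def'[OF B] sum_subtractf[symmetric]
proof (intro ring_ideal_sum[OF J])
  fix p assume "p \<in> {p. p permutes {0..<n}}"
  hence p: "p i < n" if "i < n" for i using that by (auto simp: permutes_in_image)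
  show "signof p * (\<Prod>i = 0..<n. A $$ (i, p i)) - signof p * (\<Prod>i = 0..<n. B $$ (i, p i)) \<in> J"
    unfolding right_diff_distrib[symmetric]
    by (intro ring_idealD(3)[OF J] ring_ideal_prod_diff[OF J]) (auto intro: AB p)
qed

text \<open>A determinant is a polynomial in its entries, so agreement of the coefficients modulo J
  passes to the Sylvester determinants, provided that both are taken with the same formal degrees d
  and d - 1.\<close>

lemma discriminant_cong:
  fixes \<rho> :: "nat \<Rightarrow> 'a :: idom"
  assumes J: "ring_ideal J" and f: "degree f = d"
    and coeff: "\<And>k. of_int (coeff f k) - coeff (\<Prod>j<d. [:- \<rho> j, 1:]) k \<in> J"
  shows "of_int (discriminant f) - (\<Prod>j<d. \<Prod>i<j. (\<rho> i - \<rho> j)\<^sup>2) \<in> J"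
proof -
  define F where "F = (\<Prod>j<d. [:- \<rho> j, 1:])"
  have degF: "degree (pderiv F) \<le> d - 1"
    using degree_prod_linear_le[of \<rho> d] by (intro degree_le) (auto simp: F_def coeff_pderiv intro!: coeff_eq_0)
  have "of_int (resultant f (pderiv f)) =
      Determinant.det (map_mat of_int (sylvester_mat_sub d (d - 1) f (pderiv f)) :: 'a mat)"
    by (simp add: of_int_hom.hom_det resultant_def sylvester_mat_def f degree_pderiv)
  also have "map_mat of_int (sylvester_mat_sub d (d - 1) f (pderiv f)) =
      (sylvester_mat_sub d (d - 1) (map_poly of_int f) (map_poly of_int (pderiv f)) :: 'a mat)"
    by (rule sylvester_mat_sub_map) simp
  finally have 1: "of_int (resultant f (pderiv f)) = Determinant.det \<dots>" .
  have "Determinant.det (sylvester_mat_sub d (d - 1) (map_poly of_int f) (map_poly of_int (pderiv f))) -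
      Determinant.det (sylvester_mat_sub d (d - 1) F (pderiv F)) \<in> J"
  proof (rule ring_ideal_det_diff[OF J])
    fix i j assume ij: "i < d + (d - 1)" "j < d + (d - 1)"
    have "of_int (coeff (pderiv f) k) - coeff (pderiv F) k \<in> J" for k
      using ring_idealD(3)[OF J coeff[of "Suc k"], of "of_nat (Suc k)"]
      by (simp add: coeff_pderiv F_def algebra_simps)
    thus "sylvester_mat_sub d (d - 1) (map_poly of_int f) (map_poly of_int (pderiv f)) $$ (i, j) -
        sylvester_mat_sub d (d - 1) F (pderiv F) $$ (i, j) \<in> J"
      using coeff ring_idealD(1)[OF J]
      unfolding sylvester_mat_sub_index[OF ij] F_def by simp
  qed auto
  also have "Determinant.det (sylvester_mat_sub d (d - 1) F (pderiv F)) = (\<Prod>i<d. \<Prod>j\<in>{..<d} - {i}. \<rho> i - \<rho> j)"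
    using resultant_sub_prod_linear[OF degF, of d \<rho>] unfolding resultant_sub_def F_def
    by (rule trans) (intro prod.cong refl poly_pderiv_prod_linear, simp)
  finally have "of_int (resultant f (pderiv f)) - (\<Prod>i<d. \<Prod>j\<in>{..<d} - {i}. \<rho> i - \<rho> j) \<in> J"
    by (simp add: 1)
  from ring_idealD(3)[OF J this, of "(-1) ^ (d * (d - 1) div 2)"] show ?thesis
    unfolding right_diff_distrib prod_root_differences by (simp add: discriminant_def f)
qed

section \<open>Polynomials whose roots form one Frobenius cycle\<close>

definition poly_ideal :: "int \<Rightarrow> int poly \<Rightarrow> int poly set" where
  "poly_ideal N f = {p. \<exists>q r. p = f * q + smult N r}"

lemma ring_ideal_poly_ideal: "ring_ideal (poly_ideal N f)"
proof -
  have "0 = f * 0 + smult N 0" by simp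
  moreover have "(f * q + smult N r) + (f * q' + smult N r') = f * (q + q') + smult N (r + r')" for q r q' r'
    by (simp add: algebra_simps smult_add_right)
  moreover have "s * (f * q + smult N r) = f * (s * q) + smult N (s * r)" for s q r
    by (simp add: algebra_simps)
  ultimately show ?thesis
    unfolding ring_ideal_def poly_ideal_def mem_Collect_eq by blast
qed

text \<open>The conditions say that \<open>x \<mapsto> x ^ n\<close> permutes the roots of \<open>f\<close> modulo \<open>N\<close> in
  one cycle of length \<open>d\<close>. The existence of \<open>u\<close> expresses that \<open>f\<close> and
  \<open>x ^ (n ^ i) - x\<close> generate the unit ideal, so that the first \<open>d - 1\<close> gcmd's are \<open>1\<close>.
  The exponent \<open>n\<close> stays fixed when \<open>N\<close> runs over the coprime factors of \<open>n\<close>.\<close>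

definition cyclic_mod :: "nat \<Rightarrow> nat \<Rightarrow> int \<Rightarrow> int poly \<Rightarrow> bool" where
  "cyclic_mod n d N f \<longleftrightarrow> monic f \<and> degree f = d \<and>
     [:0, 1:] ^ (n ^ d) - [:0, 1:] \<in> poly_ideal N f \<and>
     (\<forall>i\<in>{1..<d}. \<exists>u. u * ([:0, 1:] ^ (n ^ i) - [:0, 1:]) - 1 \<in> poly_ideal N f) \<and>
     pcompose f ([:0, 1:] ^ n) \<in> poly_ideal N f \<and>
     Rings.coprime (poly f 0 * discriminant f) N"

lemma monic_division:
  fixes f p :: "'a :: idom poly"
  assumes "monic f"
  obtains q r where "p = f * q + r" "r = 0 \<or> degree r < degree f"
proof -
  obtain q r where qr: "pseudo_divmod p f = (q, r)" by force
  have "f \<noteq> 0" using assms by auto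
  from pseudo_divmod[OF this qr] assms show ?thesis by (intro that[of q r]) auto
qed

lemma power_unit_mod:
  fixes x :: "'a :: comm_ring_1"
  assumes J: "ring_ideal J" and "x * v - 1 \<in> J"
  shows "\<exists>v. x ^ e * v - 1 \<in> J"
proof
  have "(\<Prod>i<e. x * v) - (\<Prod>i<e. 1) \<in> J"
    using assms(2) by (intro ring_ideal_prod_diff[OF J])
  thus "x ^ e * v ^ e - 1 \<in> J" by (simp add: power_mult_distrib)
qed

lemma prod_unit_mod:
  fixes x :: "'b \<Rightarrow> 'a :: comm_ring_1"
  assumes J: "ring_ideal J" and "\<And>i. i \<in> A \<Longrightarrow> \<exists>v. x i * v - 1 \<in> J"
  shows "\<exists>v. prod x A * v - 1 \<in> J"
proof -
  obtain v where v: "x i * v i - 1 \<in> J" if "i \<in> A" for i using assms(2) by metis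
  have "(\<Prod>i\<in>A. x i * v i) - (\<Prod>i\<in>A. 1) \<in> J" by (intro ring_ideal_prod_diff[OF J] v)
  thus ?thesis by (auto simp: prod.distrib)
qed

lemma unit_cancel:
  fixes x :: "'a :: comm_ring_1"
  assumes J: "ring_ideal J" and v: "x * v - 1 \<in> J" and "x * y \<in> J"
  shows "y \<in> J"
proof -
  have "v * (x * y) - y * (x * v - 1) \<in> J"
    by (intro ring_idealD(6)[OF J] ring_idealD(3)[OF J] assms)
  thus ?thesis by (simp add: algebra_simps)
qed

lemma ring_ideal_poly_diff:
  fixes x y :: "'a :: comm_ring_1"
  assumes J: "ring_ideal J" and "x - y \<in> J"
  shows "poly p x - poly p y \<in> J"
  unfolding poly_altdef sum_subtractf[symmetric] right_diff_distrib[symmetric]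
proof (intro ring_ideal_sum[OF J] ring_idealD(3)[OF J])
  fix i :: nat
  have "(\<Prod>j<i. x) - (\<Prod>j<i. y) \<in> J" by (intro ring_ideal_prod_diff[OF J] assms)
  thus "x ^ i - y ^ i \<in> J" by simp
qed

lemma ring_ideal_poly_coeff_diff:
  assumes J: "ring_ideal J" and "\<And>k. coeff p k - coeff q k \<in> J"
  shows "poly p x - poly q x \<in> J"
proof -
  have "poly (p - q) x \<in> J"
    unfolding poly_altdef by (intro ring_ideal_sum[OF J] ring_idealD(4)[OF J]) (simp add: assms)
  thus ?thesis by simp
qed

text \<open>Synthetic division peels off one root at a time.\<close>

lemma coeffs_in_ideal_if_vanishing:
  fixes r :: "'a :: comm_ring_1 poly"
  assumes J: "ring_ideal J"
    and "\<And>i j. i < j \<Longrightarrow> j < d \<Longrightarrow> \<exists>v. (\<rho> i - \<rho> j) * v - 1 \<in> J"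
    and "\<And>k. k \<ge> d \<Longrightarrow> coeff r k = 0"
    and "\<And>j. j < d \<Longrightarrow> poly r (\<rho> j) \<in> J"
  shows "coeff r k \<in> J"
  using assms(2-4)
proof (induction d arbitrary: r k)
  case 0
  thus ?case by (simp add: ring_idealD[OF J])
next
  case (Suc d)
  define s where "s = synthetic_div r (\<rho> d)"
  have r: "r = [:- \<rho> d, 1:] * s + [:poly r (\<rho> d):]"
    unfolding s_def using synthetic_div_correct'[of "\<rho> d" r] by simp
  have degr: "degree r \<le> d" using Suc.prems(2) by (intro degree_le) auto
  have s: "coeff s k \<in> J" for k
  proof (rule Suc.IH)
    show "coeff s k = 0" if "k \<ge> d" for k
    proof (cases "degree r = 0")
      case True
      thus ?thesis by (simp add: s_def synthetic_div_eq_0_iff[THEN iffD2])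
    next
      case False
      thus ?thesis using that degr by (intro coeff_eq_0) (simp add: s_def degree_synthetic_div)
    qed
  next
    fix j assume j: "j < d"
    obtain v where v: "(\<rho> j - \<rho> d) * v - 1 \<in> J" using Suc.prems(1)[of j d] j by auto
    have "poly r (\<rho> j) = (\<rho> j - \<rho> d) * poly s (\<rho> j) + poly r (\<rho> d)"
      by (subst (1) r) (simp add: algebra_simps)
    hence "(\<rho> j - \<rho> d) * poly s (\<rho> j) = poly r (\<rho> j) - poly r (\<rho> d)" by simp
    also have "\<dots> \<in> J" using j by (intro ring_idealD(6)[OF J] Suc.prems) auto
    finally show "poly s (\<rho> j) \<in> J" by (rule unit_cancel[OF J v])
  qed (use Suc.prems in auto)
  have "coeff r k = (if k = 0 then poly r (\<rho> d) else coeff s (k - 1)) - \<rho> d * coeff s k"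
    by (subst r) (auto simp: coeff_pCons split: nat.split)
  thus ?case using s Suc.prems(3)[of d]
    by (auto intro!: ring_idealD(6)[OF J] ring_idealD(3)[OF J])
qed

text \<open>Residue classes modulo a monic polynomial and N have finitely many representatives. This
  drives the pigeonhole argument for inverses and makes the set behind
  \<open>frobenius_count\<close> finite.\<close>

lemma finite_bounded_int_polys:
  "finite {r :: int poly. degree r \<le> d \<and> (\<forall>k. coeff r k \<in> {0..<N})}"
proof (rule finite_subset)
  show "{r :: int poly. degree r \<le> d \<and> (\<forall>k. coeff r k \<in> {0..<N})} \<subseteq>
    Poly ` {xs. set xs \<subseteq> {0..<N} \<and> length xs \<le> Suc d}"
  proof
    fix r :: "int poly" assume r: "r \<in> {r. degree r \<le> d \<and> (\<forall>k. coeff r k \<in> {0..<N})}"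
    have "set (coeffs r) \<subseteq> {0..<N}" using r by (auto simp: coeffs_def split: if_splits)
    moreover have "length (coeffs r) \<le> Suc d" using r by (auto simp: coeffs_def)
    moreover have "r = Poly (coeffs r)" by simp
    ultimately show "r \<in> Poly ` {xs. set xs \<subseteq> {0..<N} \<and> length xs \<le> Suc d}" by blast
  qed
  show "finite (Poly ` {xs. set xs \<subseteq> {0..<N} \<and> length xs \<le> Suc d})"
    by (intro finite_imageI finite_lists_length_le) simp
qed

text \<open>The ideal \<open>J\<close> makes \<^typ>\<open>'a\<close> modulo \<open>J\<close> an extension of the ring of integers
  modulo \<open>N\<close>; it contains roots \<open>\<rho> j\<close> that the power map \<open>n\<close> permutes cyclically.\<close>

locale frobenius_roots =
  fixes J :: "'a :: idom set" and N :: int and n d :: nat and \<rho> :: "nat \<Rightarrow> 'a"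
  assumes ideal: "ring_ideal J"
    and of_int_mem: "\<And>a. of_int a \<in> J \<longleftrightarrow> N dvd a"
    and N_pos: "N > 0"
    and d_pos: "d \<ge> 1"
    and root_power: "\<And>j. \<rho> j ^ n - \<rho> (Suc j) \<in> J"
    and root_period: "\<And>j. \<rho> (j + d) - \<rho> j \<in> J"
    and root_diff_unit: "\<And>i j. i < d \<Longrightarrow> j < d \<Longrightarrow> i \<noteq> j \<Longrightarrow> \<exists>v. (\<rho> i - \<rho> j) * v - 1 \<in> J"
    and root_unit: "\<And>j. j < d \<Longrightarrow> \<exists>v. \<rho> j * v - 1 \<in> J"
    and prod_coeff: "\<And>k. \<exists>a. of_int a - coeff (\<Prod>j<d. [:- \<rho> j, 1:]) k \<in> J"
begin

lemma trans_mem: "x - y \<in> J \<Longrightarrow> y - z \<in> J \<Longrightarrow> x - z \<in> J"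
  using ring_idealD(2)[OF ideal, of "x - y" "y - z"] by simp

lemma power_diff_mem: "x - y \<in> J \<Longrightarrow> x ^ e - y ^ e \<in> J"
  using ring_ideal_prod_diff[OF ideal, of "{..<e}" "\<lambda>_. x" "\<lambda>_. y"] by simp

lemma root_power_iter: "\<rho> j ^ (n ^ i) - \<rho> (j + i) \<in> J"
proof (induction i)
  case 0
  show ?case by (simp add: ring_idealD[OF ideal])
next
  case (Suc i)
  have "(\<rho> j ^ (n ^ i)) ^ n - \<rho> (j + i) ^ n \<in> J" by (rule power_diff_mem[OF Suc])
  from trans_mem[OF this root_power[of "j + i"]] show ?case
    by (simp add: power_mult mult.commute flip: power_mult)
qed

lemma root_mod: "\<rho> j - \<rho> (j mod d) \<in> J"
proof -
  have "\<rho> (i + k * d) - \<rho> i \<in> J" for i k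
  proof (induction k)
    case (Suc k)
    show ?case using trans_mem[OF root_period[of "i + k * d"] Suc] by (simp add: algebra_simps)
  qed (simp add: ring_idealD[OF ideal])
  from this[of "j mod d" "j div d"] show ?thesis by (simp add: add.commute)
qed

lemma root_diff_unit_mod:
  assumes "i mod d \<noteq> j mod d"
  shows "\<exists>v. (\<rho> i - \<rho> j) * v - 1 \<in> J"
proof -
  obtain v where v: "(\<rho> (i mod d) - \<rho> (j mod d)) * v - 1 \<in> J"
    using root_diff_unit[of "i mod d" "j mod d"] assms d_pos by auto
  have "(\<rho> i - \<rho> j) - (\<rho> (i mod d) - \<rho> (j mod d)) \<in> J"
    using ring_idealD(6)[OF ideal root_mod[of i] root_mod[of j]] by (simp add: algebra_simps)
  from ring_idealD(4)[OF ideal this, of v] v have "(\<rho> i - \<rho> j) * v - 1 \<in> J"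
    by (auto simp: left_diff_distrib intro: trans_mem)
  thus ?thesis by blast
qed

text \<open>Invertibility modulo J descends to Z/N: if \<open>g = gcd a N\<close> and
  \<open>N = g * k\<close>, then N divides a * k, and cancelling the unit gives
  \<open>N dvd k\<close>, which forces g to be 1.\<close>

lemma int_unit_coprime:
  assumes "of_int a * v - 1 \<in> J"
  shows "Rings.coprime a N"
proof -
  define g where "g = gcd a N"
  obtain k where k: "N = g * k" unfolding g_def by (meson dvdE gcd_dvd2)
  obtain b where b: "a = g * b" unfolding g_def by (meson dvdE gcd_dvd1)
  have "N dvd a * k" using k b by (metis dvd_triv_left mult.assoc mult.commute)
  hence "of_int a * of_int k \<in> J" using of_int_mem[of "a * k"] by simp
  from unit_cancel[OF ideal assms this] have "N dvd k" using of_int_mem by simp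
  moreover have "k \<noteq> 0" using N_pos k by auto
  ultimately have "g dvd 1" using k by auto
  thus ?thesis unfolding g_def by (simp add: coprime_iff_gcd_eq_1)
qed

definition ev :: "int poly \<Rightarrow> nat \<Rightarrow> 'a" where
  "ev p j = poly (map_poly of_int p) (\<rho> j)"

lemma ev_simps [simp]:
  "ev (p + q) j = ev p j + ev q j" "ev (p - q) j = ev p j - ev q j" "ev (p * q) j = ev p j * ev q j"
  "ev (p ^ e) j = ev p j ^ e" "ev (pCons 0 1) j = \<rho> j" "ev 1 j = 1" "ev (smult c p) j = of_int c * ev p j"
  by (simp_all add: ev_def hom_distribs)

context
  fixes f :: "int poly"
  assumes degree_f: "degree f = d" and monic_f: "monic f"
    and coeff_f: "\<And>k. of_int (coeff f k) - coeff (\<Prod>j<d. [:- \<rho> j, 1:]) k \<in> J"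
begin

lemma ev_f: "ev f j \<in> J"
proof -
  have "poly (map_poly of_int f) (\<rho> (j mod d)) - poly (\<Prod>j<d. [:- \<rho> j, 1:]) (\<rho> (j mod d)) \<in> J"
    by (intro ring_ideal_poly_coeff_diff[OF ideal]) (unfold of_int_hom.coeff_map_poly_hom, rule coeff_f)
  moreover have "poly (\<Prod>j<d. [:- \<rho> j, 1:]) (\<rho> (j mod d)) = 0"
    using d_pos by (auto simp: poly_prod intro!: bexI[of _ "j mod d"])
  ultimately have "ev f (j mod d) \<in> J" by (simp add: ev_def)
  thus ?thesis
    using ring_idealD(2)[OF ideal ring_ideal_poly_diff[OF ideal root_mod[of j], of "map_poly of_int f"]]
    by (fastforce simp: ev_def)
qed

text \<open>A remainder of degree below d that vanishes modulo J at d roots with invertible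
  differences has all coefficients in J, hence divisible by N. Identities modulo f and N can
  therefore be checked at the roots.\<close>

lemma mem_poly_idealI:
  assumes "\<And>j. j < d \<Longrightarrow> ev p j \<in> J"
  shows "p \<in> poly_ideal N f"
proof -
  obtain q r where p: "p = f * q + r" and r: "r = 0 \<or> degree r < d"
    using monic_division[OF monic_f, of p] degree_f by metis
  have deg: "coeff r k = 0" if "k \<ge> d" for k
    using r that by (auto intro: coeff_eq_0)
  have "coeff (map_poly of_int r :: 'a poly) k \<in> J" for k
  proof (rule coeffs_in_ideal_if_vanishing[OF ideal, of d \<rho>])
    fix j assume "j < d"
    have "ev r j = ev p j - ev f j * ev q j" by (simp add: p)
    also have "\<dots> \<in> J"
      by (intro ring_idealD(6)[OF ideal] ring_idealD(4)[OF ideal] assms ev_f) fact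
    finally show "poly (map_poly of_int r) (\<rho> j) \<in> J" by (simp add: ev_def)
  qed (auto simp: deg intro: root_diff_unit)
  hence "N dvd coeff r k" for k using of_int_mem by simp
  hence "[:N:] dvd r" by (simp add: const_poly_dvd_iff)
  then obtain r' where "r = [:N:] * r'" by (elim dvdE)
  thus ?thesis using p by (auto simp: poly_ideal_def)
qed

lemma mem_poly_ideal_ev: "p \<in> poly_ideal N f \<Longrightarrow> ev p j \<in> J"
  using of_int_mem[of N] by (auto simp: poly_ideal_def intro!: ring_idealD[OF ideal] ev_f)

text \<open>The inverses at the single roots need not be values of an integer polynomial. But two
  powers \<open>p ^ a\<close> and \<open>p ^ b\<close> agree modulo f and N by finiteness, and
  cancelling the unit values of \<open>p ^ a\<close> shows that a power of p inverts p.\<close>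

lemma invertible_mod:
  assumes "\<And>j. j < d \<Longrightarrow> \<exists>v. ev p j * v - 1 \<in> J"
  shows "\<exists>u. u * p - 1 \<in> poly_ideal N f"
proof -
  define R where "R = {r :: int poly. degree r \<le> d \<and> (\<forall>k. coeff r k \<in> {0..<N})}"
  have "\<exists>r\<in>R. q - r \<in> poly_ideal N f" for q
  proof -
    obtain t r where q: "q = f * t + r" and r: "r = 0 \<or> degree r < d"
      using monic_division[OF monic_f, of q] degree_f by metis
    define r' where "r' = map_poly (\<lambda>a. a mod N) r"
    have "degree r' \<le> d" unfolding r'_def using r degree_map_poly_le[of "\<lambda>a. a mod N" r] by auto
    hence "r' \<in> R" using N_pos by (auto simp: R_def r'_def coeff_map_poly)
    moreover have "[:N:] dvd r - r'"
      by (auto simp: const_poly_dvd_iff r'_def coeff_map_poly mod_eq_dvd_iff[symmetric])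
    then obtain e where "r - r' = [:N:] * e" by (elim dvdE)
    hence "q - r' = f * t + smult N e" by (simp add: q algebra_simps)
    hence "q - r' \<in> poly_ideal N f" by (auto simp: poly_ideal_def)
    ultimately show ?thesis by blast
  qed
  then obtain red where red: "red q \<in> R" "q - red q \<in> poly_ideal N f" for q by metis
  have "\<not> inj (\<lambda>e :: nat. red (p ^ e))"
  proof
    assume inj: "inj (\<lambda>e :: nat. red (p ^ e))"
    have "range (\<lambda>e :: nat. red (p ^ e)) \<subseteq> R" using red by auto
    hence "finite (range (\<lambda>e :: nat. red (p ^ e)))"
      using finite_bounded_int_polys finite_subset unfolding R_def by blast
    thus False using finite_imageD[OF _ inj] by simp
  qed
  then obtain a b where ab: "red (p ^ a) = red (p ^ b)" "a < b"
    unfolding inj_def by (metis linorder_neqE_nat)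
  define e where "e = b - a - 1"
  have b: "b = a + Suc e" using ab by (simp add: e_def)
  have "p ^ b - p ^ a \<in> poly_ideal N f"
    using ring_idealD(6)[OF ring_ideal_poly_ideal red(2)[of "p ^ b"] red(2)[of "p ^ a"]] ab by simp
  hence *: "ev (p ^ b - p ^ a) j \<in> J" for j by (rule mem_poly_ideal_ev)
  have "p ^ e * p - 1 \<in> poly_ideal N f"
  proof (rule mem_poly_idealI)
    fix j assume j: "j < d"
    from assms[OF this] obtain v where "ev p j * v - 1 \<in> J" by blast
    from power_unit_mod[OF ideal this] obtain w where w: "ev p j ^ a * w - 1 \<in> J" by blast
    have "ev p j ^ a * ev (p ^ e * p - 1) j \<in> J"
      using *[of j] by (simp add: b power_add algebra_simps)
    from unit_cancel[OF ideal w this] show "ev (p ^ e * p - 1) j \<in> J" .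
  qed
  thus ?thesis by blast
qed

lemma discriminant_f: "of_int (discriminant f) - (\<Prod>j<d. \<Prod>i<j. (\<rho> i - \<rho> j)\<^sup>2) \<in> J"
  by (rule discriminant_cong[OF ideal degree_f coeff_f])

lemma cyclic_mod_f: "cyclic_mod n d N f"
  unfolding cyclic_mod_def
proof (intro conjI ballI monic_f degree_f)
  show "[:0, 1:] ^ (n ^ d) - [:0, 1:] \<in> poly_ideal N f"
    by (rule mem_poly_idealI) (simp add: trans_mem[OF root_power_iter root_period])
next
  fix i assume i: "i \<in> {1..<d}"
  show "\<exists>u. u * ([:0, 1:] ^ (n ^ i) - [:0, 1:]) - 1 \<in> poly_ideal N f"
  proof (rule invertible_mod)
    fix j
    \<comment> \<open>For 0 < i < d the i-fold power map moves every root, so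
      \<open>x ^ (n ^ i) - x\<close> takes a unit value at each of them.\<close>
    have "(j + i) mod d \<noteq> j mod d"
    proof
      assume "(j + i) mod d = j mod d"
      hence "d dvd i" using mod_eq_dvd_iff_nat[of j "j + i" d] by simp
      thus False using i by (auto dest: dvd_imp_le)
    qed
    then obtain v where v: "(\<rho> (j + i) - \<rho> j) * v - 1 \<in> J" using root_diff_unit_mod by blast
    have "(\<rho> j ^ (n ^ i) - \<rho> (j + i)) * v \<in> J" by (intro ring_idealD(4)[OF ideal] root_power_iter)
    from ring_idealD(2)[OF ideal this v]
    show "\<exists>v. ev ([:0, 1:] ^ (n ^ i) - [:0, 1:]) j * v - 1 \<in> J"
      by (intro exI[of _ v]) (simp add: algebra_simps)
  qed
next
  show "pcompose f ([:0, 1:] ^ n) \<in> poly_ideal N f"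
  proof (rule mem_poly_idealI)
    fix j
    have "ev (pcompose f ([:0, 1:] ^ n)) j = poly (map_poly of_int f) (\<rho> j ^ n)"
      by (simp add: ev_def of_int_hom.map_poly_pcompose poly_pcompose hom_distribs)
    moreover have "poly (map_poly of_int f) (\<rho> j ^ n) - ev f (Suc j) \<in> J"
      unfolding ev_def by (rule ring_ideal_poly_diff[OF ideal root_power])
    ultimately show "ev (pcompose f ([:0, 1:] ^ n)) j \<in> J"
      using ring_idealD(2)[OF ideal _ ev_f[of "Suc j"]] by fastforce
  qed
next
  have "Rings.coprime (poly f 0) N"
  proof -
    have "poly (map_poly of_int f) 0 - poly (\<Prod>j<d. [:- \<rho> j, 1:]) 0 \<in> J"
      by (intro ring_ideal_poly_coeff_diff[OF ideal]) (unfold of_int_hom.coeff_map_poly_hom, rule coeff_f)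
    moreover have "poly (map_poly of_int f :: 'a poly) 0 = of_int (poly f 0)"
      by (simp add: poly_0_coeff_0)
    moreover have "poly (\<Prod>j<d. [:- \<rho> j, 1:]) 0 = (\<Prod>j<d. - \<rho> j)" by (simp add: poly_prod)
    ultimately have *: "of_int (poly f 0) - (\<Prod>j<d. - \<rho> j) \<in> J" by simp
    have "\<exists>v. - \<rho> j * v - 1 \<in> J" if "j < d" for j
      using root_unit[OF that] by (metis minus_mult_minus)
    from prod_unit_mod[OF ideal, of "{..<d}" "\<lambda>j. - \<rho> j"] this
    obtain v where v: "(\<Prod>j<d. - \<rho> j) * v - 1 \<in> J" by auto
    from ring_idealD(2)[OF ideal ring_idealD(4)[OF ideal *, of v] v]
    have "of_int (poly f 0) * v - 1 \<in> J" by (simp add: algebra_simps)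
    thus ?thesis by (rule int_unit_coprime)
  qed
  moreover have "Rings.coprime (discriminant f) N"
  proof -
    have "\<exists>v. (\<Prod>i<j. (\<rho> i - \<rho> j)\<^sup>2) * v - 1 \<in> J" if "j < d" for j
    proof (rule prod_unit_mod[OF ideal])
      fix i assume "i \<in> {..<j}"
      with root_diff_unit[of i j] that show "\<exists>v. (\<rho> i - \<rho> j)\<^sup>2 * v - 1 \<in> J"
        by (auto intro: power_unit_mod[OF ideal])
    qed
    with prod_unit_mod[OF ideal, of "{..<d}" "\<lambda>j. \<Prod>i<j. (\<rho> i - \<rho> j)\<^sup>2"]
    obtain v where v: "(\<Prod>j<d. \<Prod>i<j. (\<rho> i - \<rho> j)\<^sup>2) * v - 1 \<in> J" by auto
    from ring_idealD(2)[OF ideal ring_idealD(4)[OF ideal discriminant_f, of v] v]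
    have "of_int (discriminant f) * v - 1 \<in> J" by (simp add: algebra_simps)
    thus ?thesis by (rule int_unit_coprime)
  qed
  ultimately show "Rings.coprime (poly f 0 * discriminant f) N" by simp
qed

end

text \<open>The assumption \<open>prod_coeff\<close> provides integers for the elementary symmetric
  functions of the roots. The leading coefficient is set to 1 instead of being chosen, so that f is
  monic of degree exactly d.\<close>

lemma exists_cyclic_mod:
  obtains f where "cyclic_mod n d N f"
    "\<And>k. of_int (coeff f k) - coeff (\<Prod>j<d. [:- \<rho> j, 1:]) k \<in> J"
    "of_int (discriminant f) - (\<Prod>j<d. \<Prod>i<j. (\<rho> i - \<rho> j)\<^sup>2) \<in> J"
proof -
  obtain a where a: "of_int (a k) - coeff (\<Prod>j<d. [:- \<rho> j, 1:]) k \<in> J" for k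
    using prod_coeff by metis
  define f where "f = monom 1 d + (\<Sum>k<d. monom (a k) k)"
  have coeff: "coeff f k = (if k = d then 1 else if k < d then a k else 0)" for k
    by (auto simp: f_def coeff_sum)
  have "degree f = d" by (rule antisym) (auto intro!: degree_le le_degree simp: coeff)
  moreover have "monic f" by (simp add: calculation coeff)
  moreover have "of_int (coeff f k) - coeff (\<Prod>j<d. [:- \<rho> j, 1:]) k \<in> J" for k
  proof -
    consider "k < d" | "k = d" | "k > d" by linarith
    thus ?thesis
    proof cases
      case 1
      thus ?thesis using a[of k] unfolding coeff by simp
    next
      case 2
      thus ?thesis unfolding coeff by (simp only: monic_prod_linear) (simp add: ring_idealD[OF ideal])
    next
      case 3
      hence "coeff (\<Prod>j<d. [:- \<rho> j, 1:]) k = 0"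
        using degree_prod_linear_le[of \<rho> d] by (intro coeff_eq_0) simp
      thus ?thesis using 3 by (simp add: coeff ring_idealD[OF ideal])
    qed
  qed
  ultimately show ?thesis
    using that[of f] cyclic_mod_f[of f] discriminant_f[of f] by blast
qed

end

section \<open>Change of representative and the Chinese remainder theorem\<close>

lemma discriminant_cong_mod:
  assumes "degree f = degree g" and coeff: "\<And>k. N dvd coeff f k - coeff g k"
  shows "N dvd discriminant f - discriminant g"
proof -
  define d where "d = degree f"
  have J: "ring_ideal {x. N dvd x}" by (auto simp: ring_ideal_def)
  have "Determinant.det (sylvester_mat_sub d (d - 1) f (pderiv f)) -
      Determinant.det (sylvester_mat_sub d (d - 1) g (pderiv g)) \<in> {x. N dvd x}"
  proof (rule ring_ideal_det_diff[OF J])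
    fix i j assume ij: "i < d + (d - 1)" "j < d + (d - 1)"
    have "N dvd coeff (pderiv f) k - coeff (pderiv g) k" for k
      using dvd_mult[OF coeff[of "Suc k"], of "of_nat (Suc k)"]
      by (simp add: coeff_pderiv algebra_simps)
    thus "sylvester_mat_sub d (d - 1) f (pderiv f) $$ (i, j) -
        sylvester_mat_sub d (d - 1) g (pderiv g) $$ (i, j) \<in> {x. N dvd x}"
      using coeff unfolding sylvester_mat_sub_index[OF ij] by simp
  qed auto
  hence "N dvd resultant f (pderiv f) - resultant g (pderiv g)"
    using assms(1) by (simp add: resultant_def sylvester_mat_def degree_pderiv d_def)
  from dvd_mult[OF this, of "(-1) ^ (d * (d - 1) div 2)"] show ?thesis
    using assms(1) by (simp add: discriminant_def d_def algebra_simps)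
qed

lemma coeff_cong_imp_smult:
  fixes f g :: "int poly"
  assumes "\<And>k. N dvd coeff f k - coeff g k"
  obtains h where "f = g + smult N h"
proof -
  have "[:N:] dvd f - g" using assms by (simp add: const_poly_dvd_iff)
  then obtain h where "f - g = [:N:] * h" by (elim dvdE)
  thus ?thesis by (intro that[of h]) (simp add: algebra_simps)
qed

lemma poly_ideal_cong:
  assumes "\<And>k. N dvd coeff f k - coeff g k"
  shows "poly_ideal N f = poly_ideal N g"
proof -
  have sub: "poly_ideal N (g + smult N h) \<subseteq> poly_ideal N g" for g h
  proof
    fix p assume "p \<in> poly_ideal N (g + smult N h)"
    then obtain q r where "p = (g + smult N h) * q + smult N r" by (auto simp: poly_ideal_def)
    hence "p = g * q + smult N (h * q + r)" by (simp add: algebra_simps smult_add_right)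
    thus "p \<in> poly_ideal N g" by (auto simp: poly_ideal_def)
  qed
  obtain h where h: "f = g + smult N h" using coeff_cong_imp_smult[OF assms] .
  have "g = f + smult N (- h)" using h by simp
  thus ?thesis using sub[of g h] sub[of f "- h"] h by simp
qed

lemma pcompose_smult_mem:
  "pcompose (f + smult N h) p - pcompose f p \<in> poly_ideal N g"
proof -
  have "pcompose (f + smult N h) p - pcompose f p = g * 0 + smult N (pcompose h p)"
    by (simp add: pcompose_add pcompose_smult)
  thus ?thesis unfolding poly_ideal_def by blast
qed

lemma cyclic_mod_cong:
  assumes f: "cyclic_mod n d N f" and g: "degree g = d" "monic g"
    and coeff: "\<And>k. N dvd coeff g k - coeff f k"
  shows "cyclic_mod n d N g"
proof -
  have I: "poly_ideal N g = poly_ideal N f" by (rule poly_ideal_cong[OF coeff])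
  obtain h where h: "g = f + smult N h" using coeff_cong_imp_smult[OF coeff] .
  have "N dvd discriminant g - discriminant f"
    using f g coeff by (intro discriminant_cong_mod) (auto simp: cyclic_mod_def)
  hence "[poly g 0 * discriminant g = poly f 0 * discriminant f] (mod N)"
    by (intro cong_mult) (simp_all add: cong_iff_dvd_diff h)
  hence "Rings.coprime (poly g 0 * discriminant g) N"
    using f cong_imp_coprime[OF cong_sym] unfolding cyclic_mod_def by blast
  moreover have "pcompose g ([:0, 1:] ^ n) \<in> poly_ideal N f"
    using ring_idealD(2)[OF ring_ideal_poly_ideal pcompose_smult_mem[of f N h "[:0, 1:] ^ n" f],
        of "pcompose f ([:0, 1:] ^ n)"] f
    by (simp add: h cyclic_mod_def)
  ultimately show ?thesis
    using f g unfolding cyclic_mod_def I by auto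
qed

lemma poly_ideal_mult:
  assumes "Rings.coprime N1 N2" "p \<in> poly_ideal N1 f" "p \<in> poly_ideal N2 f"
  shows "p \<in> poly_ideal (N1 * N2) f"
proof -
  obtain q1 r1 where 1: "p = f * q1 + smult N1 r1" using assms by (auto simp: poly_ideal_def)
  obtain q2 r2 where 2: "p = f * q2 + smult N2 r2" using assms by (auto simp: poly_ideal_def)
  obtain a b where ab: "a * N1 + b * N2 = 1"
    using assms(1) by (metis bezout_int coprime_iff_gcd_eq_1)
  have "p = smult (a * N1 + b * N2) p" by (simp add: ab)
  also have "\<dots> = smult (a * N1) (f * q2 + smult N2 r2) + smult (b * N2) (f * q1 + smult N1 r1)"
    using 1 2 by (simp add: smult_add_left)
  also have "\<dots> = f * (smult (a * N1) q2 + smult (b * N2) q1) + smult (N1 * N2) (smult a r2 + smult b r1)"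
    by (simp add: algebra_simps smult_add_right)
  finally show ?thesis unfolding poly_ideal_def by blast
qed

lemma invertible_poly_ideal_mult:
  assumes "Rings.coprime N1 N2" and u1: "u1 * p - 1 \<in> poly_ideal N1 f" and u2: "u2 * p - 1 \<in> poly_ideal N2 f"
  shows "\<exists>u. u * p - 1 \<in> poly_ideal (N1 * N2) f"
proof -
  obtain a b where ab: "a * N1 + b * N2 = 1"
    using assms(1) by (metis bezout_int coprime_iff_gcd_eq_1)
  define u where "u = smult (b * N2) u1 + smult (a * N1) u2"
  have u: "u = u1 + smult N1 (smult a (u2 - u1))"
  proof -
    have "b * N2 = 1 - a * N1" using ab by simp
    thus ?thesis by (simp add: u_def smult_diff_left smult_diff_right mult.commute)
  qed
  have u': "u = u2 + smult N2 (smult b (u1 - u2))"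
  proof -
    have "a * N1 = 1 - b * N2" using ab by simp
    thus ?thesis by (simp add: u_def smult_diff_left smult_diff_right mult.commute)
  qed
  have *: "(v + smult N w) * p - 1 \<in> poly_ideal N f" if "v * p - 1 \<in> poly_ideal N f" for v w N
  proof -
    have "smult N (w * p) = f * 0 + smult N (w * p)" by simp
    hence "smult N (w * p) \<in> poly_ideal N f" unfolding poly_ideal_def by blast
    from ring_idealD(2)[OF ring_ideal_poly_ideal that this] show ?thesis by (simp add: algebra_simps)
  qed
  have "u * p - 1 \<in> poly_ideal (N1 * N2) f"
  proof (rule poly_ideal_mult[OF assms(1)])
    show "u * p - 1 \<in> poly_ideal N1 f" by (subst u) (rule *[OF u1])
    show "u * p - 1 \<in> poly_ideal N2 f" by (subst u') (rule *[OF u2])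
  qed
  thus ?thesis by blast
qed

lemma cyclic_mod_mult:
  assumes cop: "Rings.coprime N1 N2" and 1: "cyclic_mod n d N1 f" and 2: "cyclic_mod n d N2 f"
  shows "cyclic_mod n d (N1 * N2) f"
  unfolding cyclic_mod_def
proof (intro conjI ballI)
  fix i assume "i \<in> {1..<d}"
  thus "\<exists>u. u * ([:0, 1:] ^ (n ^ i) - [:0, 1:]) - 1 \<in> poly_ideal (N1 * N2) f"
    using 1 2 invertible_poly_ideal_mult[OF cop, of _ "[:0, 1:] ^ (n ^ i) - [:0, 1:]" f]
    unfolding cyclic_mod_def by blast
qed (use 1 2 poly_ideal_mult[OF cop] in \<open>simp_all add: cyclic_mod_def\<close>)

lemma cyclic_mod_crt:
  assumes cop: "Rings.coprime N1 N2" and N: "N1 * N2 > 1"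
    and f1: "cyclic_mod n d N1 f1" and f2: "cyclic_mod n d N2 f2"
  obtains f where "cyclic_mod n d (N1 * N2) f" "monic_mod (N1 * N2) f"
    "\<And>k. N1 dvd coeff f k - coeff f1 k" "\<And>k. N2 dvd coeff f k - coeff f2 k"
proof -
  obtain a b where ab: "a * N1 + b * N2 = 1"
    using assms(1) by (metis bezout_int coprime_iff_gcd_eq_1)
  define g where "g = smult (b * N2) f1 + smult (a * N1) f2"
  define f where "f = poly_mod.Mp (N1 * N2) g"
  have d: "degree f1 = d" "degree f2 = d" "coeff f1 d = 1" "coeff f2 d = 1"
    using f1 f2 by (auto simp: cyclic_mod_def)
  have coeff: "coeff f k = coeff g k mod (N1 * N2)" for k
    by (simp add: f_def poly_mod.Mp_coeff poly_mod.M_def)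
  have cf: "N1 * N2 dvd coeff f k - coeff g k" for k
    unfolding coeff by (simp add: mod_eq_dvd_iff[symmetric])
  \<comment> \<open>The leading coefficient of g is \<open>b * N2 + a * N1 = 1\<close>; it survives
    the reduction because \<open>N1 * N2 > 1\<close>.\<close>
  have "coeff f d = 1"
    unfolding coeff using N ab d by (simp add: g_def add.commute)
  moreover have "coeff f k = 0" if "k > d" for k
    unfolding coeff using that d by (simp add: g_def coeff_eq_0)
  ultimately have deg: "degree f = d" "monic f"
    using le_degree[of f d] degree_le[of d f] by auto
  have g: "coeff g k = (b * N2) * coeff f1 k + (a * N1) * coeff f2 k" for k by (simp add: g_def)
  have g1: "coeff g k - coeff f1 k = N1 * (a * (coeff f2 k - coeff f1 k))" for k
  proof -
    have e: "b * N2 = 1 - a * N1" using ab by simp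
    show ?thesis unfolding g e by (simp add: algebra_simps)
  qed
  have g2: "coeff g k - coeff f2 k = N2 * (b * (coeff f1 k - coeff f2 k))" for k
  proof -
    have e: "a * N1 = 1 - b * N2" using ab by simp
    show ?thesis unfolding g e by (simp add: algebra_simps)
  qed
  have 1: "N1 dvd coeff f k - coeff f1 k" for k
  proof -
    have "N1 dvd (coeff f k - coeff g k) + (coeff g k - coeff f1 k)"
      unfolding g1 by (intro dvd_add dvd_mult_left[OF cf] dvd_triv_left)
    thus ?thesis by simp
  qed
  have 2: "N2 dvd coeff f k - coeff f2 k" for k
  proof -
    have "N2 dvd (coeff f k - coeff g k) + (coeff g k - coeff f2 k)"
      unfolding g2 by (intro dvd_add dvd_mult_right[OF cf] dvd_triv_left)
    thus ?thesis by simp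
  qed
  have "poly_mod.Mp (N1 * N2) f = f" by (simp add: f_def poly_mod.Mp_Mp)
  moreover have "cyclic_mod n d (N1 * N2) f"
    using cyclic_mod_mult[OF cop cyclic_mod_cong[OF f1 deg 1] cyclic_mod_cong[OF f2 deg 2]] .
  ultimately show ?thesis using that[of f] 1 2 deg by (simp add: monic_mod_def)
qed

section \<open>Jacobi symbols and the three steps of the test\<close>

lemma Legendre_cong: "[a = b] (mod p) \<Longrightarrow> Legendre a p = Legendre b p"
proof -
  assume "[a = b] (mod p)"
  hence "a mod p = b mod p" by (simp add: cong_def)
  thus ?thesis by (simp add: Legendre_def QuadRes_def cong_def)
qed

lemma jacobi_symbol_mult:
  "m > 0 \<Longrightarrow> k > 0 \<Longrightarrow> jacobi_symbol a (m * k) = jacobi_symbol a m * jacobi_symbol a k"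
  by (simp add: jacobi_symbol_def prime_factorization_mult)

lemma jacobi_symbol_cong:
  assumes "int m dvd a - b" "m > 0"
  shows "jacobi_symbol a m = jacobi_symbol b m"
  unfolding jacobi_symbol_def
proof (intro arg_cong[where f = prod_mset] image_mset_cong)
  fix p assume "p \<in># prime_factorization m"
  hence "int p dvd int m" by (auto simp: in_prime_factors_iff)
  thus "Legendre a (int p) = Legendre b (int p)"
    using dvd_trans[OF _ assms(1)] by (intro Legendre_cong) (simp add: cong_iff_dvd_diff)
qed

lemma poly_mod_eq_m_iff: "poly_mod.eq_m N f g \<longleftrightarrow> (\<forall>k. N dvd coeff f k - coeff g k)"
  by (simp add: poly_eq_iff poly_mod.Mp_coeff poly_mod.M_def mod_eq_dvd_iff)

lemma dvdm_iff_poly_ideal: "poly_mod.dvdm N f p \<longleftrightarrow> p \<in> poly_ideal N f"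
proof
  assume "poly_mod.dvdm N f p"
  then obtain q where "poly_mod.eq_m N p (f * q)" by (auto simp: poly_mod.dvdm_def)
  then obtain h where "p = f * q + smult N h"
    using coeff_cong_imp_smult[of N p "f * q"] unfolding poly_mod_eq_m_iff by blast
  thus "p \<in> poly_ideal N f" by (auto simp: poly_ideal_def)
next
  assume "p \<in> poly_ideal N f"
  then obtain q r where "p = f * q + smult N r" by (auto simp: poly_ideal_def)
  hence "poly_mod.eq_m N p (f * q)" by (simp add: poly_mod_eq_m_iff)
  thus "poly_mod.dvdm N f p" by (auto simp: poly_mod.dvdm_def)
qed

lemma ideal_mod_eq: "ideal_mod N g f = {p. \<exists>a. p - a * g \<in> poly_ideal N f}"
proof -
  have "(\<exists>b. poly_mod.eq_m N p (a * g + b * f)) \<longleftrightarrow> p - a * g \<in> poly_ideal N f" for p a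
    unfolding dvdm_iff_poly_ideal[symmetric] poly_mod.dvdm_def poly_mod_eq_m_iff
    by (simp add: algebra_simps)
  thus ?thesis unfolding ideal_mod_def by blast
qed

text \<open>In a single cycle of length d no root is fixed earlier, so the first d - 1 gcmd's are 1
  and the last one is f. The sum in the Jacobi step is then 1 for even d and 0 for odd d, whence the
  required symbol \<open>(-1) ^ (d - 1)\<close>.\<close>

lemma frobenius_pseudoprime_via_cycle:
  assumes n: "n > 1" "odd n" and d: "d \<ge> 1" and f: "monic_mod (int n) f"
    and cyc: "cyclic_mod n d (int n) f"
    and jac: "jacobi_symbol (discriminant f) n = (-1) ^ (d - 1)"
  shows "frobenius_pseudoprime_via f n (\<lambda>i. if i = d then f else 1)"
proof -
  define F where "F = (\<lambda>i. if i = d then f else 1)"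
  define X where "X = ([:0, 1:] :: int poly)"
  note I = ring_ideal_poly_ideal[of "int n" f]
  have deg: "degree f = d" and A: "X ^ (n ^ d) - X \<in> poly_ideal (int n) f"
    and B: "\<And>i. i \<in> {1..<d} \<Longrightarrow> \<exists>u. u * (X ^ (n ^ i) - X) - 1 \<in> poly_ideal (int n) f"
    and C: "pcompose f (X ^ n) \<in> poly_ideal (int n) f"
    and D: "Rings.coprime (poly f 0 * discriminant f) (int n)"
    using cyc by (auto simp: cyclic_mod_def X_def)
  have one: "monic_mod (int n) 1"
    using n by (auto simp: monic_mod_def poly_eq_iff poly_mod.Mp_coeff poly_mod.M_def)
  have gcmd1: "is_gcmd (int n) (X ^ (n ^ i) - X) f 1" if i: "i \<in> {1..<d}" for i
  proof -
    obtain u where u: "u * (X ^ (n ^ i) - X) - 1 \<in> poly_ideal (int n) f" using B[OF i] by blast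
    have "p \<in> ideal_mod (int n) (X ^ (n ^ i) - X) f" for p
      unfolding ideal_mod_eq using ring_idealD(3)[OF I u, of "- p"]
      by (auto simp: algebra_simps intro!: exI[of _ "p * u"])
    moreover have "p \<in> principal_ideal_mod (int n) 1" for p
      by (auto simp: principal_ideal_mod_def poly_mod.dvdm_def)
    ultimately show ?thesis using one by (auto simp: is_gcmd_def)
  qed
  have gcmdd: "is_gcmd (int n) (X ^ (n ^ d) - X) f f"
    unfolding is_gcmd_def
  proof (intro conjI f equalityI subsetI)
    fix p assume "p \<in> principal_ideal_mod (int n) f"
    hence "p - 0 * (X ^ (n ^ d) - X) \<in> poly_ideal (int n) f"
      by (simp add: principal_ideal_mod_def dvdm_iff_poly_ideal)
    thus "p \<in> ideal_mod (int n) (X ^ (n ^ d) - X) f" unfolding ideal_mod_eq by blast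
  next
    fix p assume "p \<in> ideal_mod (int n) (X ^ (n ^ d) - X) f"
    then obtain a where "p - a * (X ^ (n ^ d) - X) \<in> poly_ideal (int n) f"
      unfolding ideal_mod_eq by blast
    from ring_idealD(2)[OF I this ring_idealD(3)[OF I A, of a]]
    show "p \<in> principal_ideal_mod (int n) f"
      by (simp add: principal_ideal_mod_def dvdm_iff_poly_ideal)
  qed
  have "factorization_step n f F"
    unfolding factorization_step_def deg X_def[symmetric]
  proof (intro exI[of _ "\<lambda>i. if i < d then f else 1"] conjI ballI)
    fix i assume "i \<in> {1..d}"
    hence i: "i = d \<or> i \<in> {1..<d}" by auto
    thus "is_gcmd (int n) (X ^ n ^ i - X) (if i - 1 < d then f else 1) (F i)"
      using gcmd1[of i] gcmdd d by (auto simp: F_def)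
    show "poly_mod.eq_m (int n) (if i - 1 < d then f else 1) (F i * (if i < d then f else 1))"
      using i d by (auto simp: F_def)
  qed (use d in auto)
  moreover have "frobenius_step n f F"
    unfolding frobenius_step_def deg X_def[symmetric]
    using C one by (auto simp: F_def dvdm_iff_poly_ideal) (auto simp: poly_mod.dvdm_def simp flip: dvdm_iff_poly_ideal)
  moreover have "jacobi_step n f F"
  proof -
    have "(\<Sum>i\<in>{i\<in>{1..d}. even i}. degree (F i) div i) = (\<Sum>i\<in>{i\<in>{1..d}. even i}. if i = d then 1 else 0)"
      using d deg by (intro sum.cong) (auto simp: F_def)
    also have "\<dots> = (if even d then 1 else 0)" using d by auto
    finally show ?thesis
      unfolding jacobi_step_def deg jac using d by (cases "even d") auto
  qed
  ultimately show ?thesis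
    using n f D unfolding frobenius_pseudoprime_via_def F_def by (simp add: coprime_iff_coprime) (simp add: ac_simps)
qed

lemma cycle_count_cycle:
  assumes "\<sigma> permutes {1..d}" "cyclic_on \<sigma> {1..d}"
  shows "cycle_count d \<sigma> i = (if i = d then 1 else 0)"
proof -
  have orb: "orbit \<sigma> a = {1..d}" if "a \<in> {1..d}" for a
    using orbit_cyclic_eq3[OF assms(2) that] .
  have "{1..d} \<noteq> {}" using assms(2) by (auto simp: cyclic_on_def)
  hence "{C. \<exists>a\<in>{1..d}. C = orbit \<sigma> a \<and> card C = i} = (if i = d then {{1..d}} else {})"
    using orb by (auto split: if_splits)
  thus ?thesis by (simp add: cycle_count_def)
qed

lemma card_le_frobenius_count:
  assumes n: "n > 1" "odd n" and d: "d \<ge> 1"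
    and \<sigma>: "\<sigma> permutes {1..d}" "cyclic_on \<sigma> {1..d}"
    and A: "\<And>f. f \<in> A \<Longrightarrow> monic_mod (int n) f \<and> cyclic_mod n d (int n) f \<and>
      jacobi_symbol (discriminant f) n = (-1) ^ (d - 1)"
  shows "card A \<le> frobenius_count d \<sigma> n"
  unfolding frobenius_count_def
proof (rule card_mono)
  \<comment> \<open>\<open>card\<close> of an infinite set is 0 by default, so the lower bound would
    be lost without finiteness.\<close>
  show "finite {f. monic_mod (int n) f \<and> degree f = d \<and> (\<exists>F. frobenius_pseudoprime_via f n F \<and>
      (\<forall>i\<in>{1..d}. real (degree (F i)) / real i = real (cycle_count d \<sigma> i)))}"
  proof (rule finite_subset[OF _ finite_bounded_int_polys[of d "int n"]], safe)
    fix f k assume f: "monic_mod (int n) f"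
    have eq: "coeff f k = coeff f k mod int n"
      using f by (metis monic_mod_def poly_mod.M_def poly_mod.Mp_coeff)
    have "coeff f k mod int n \<in> {0..<int n}" using n by simp
    thus "coeff f k \<in> {0..<int n}" by (subst eq)
  qed
  show "A \<subseteq> {f. monic_mod (int n) f \<and> degree f = d \<and> (\<exists>F. frobenius_pseudoprime_via f n F \<and>
      (\<forall>i\<in>{1..d}. real (degree (F i)) / real i = real (cycle_count d \<sigma> i)))}"
  proof safe
    fix f assume f: "f \<in> A"
    from A[OF f] show "monic_mod (int n) f" "degree f = d" by (auto simp: cyclic_mod_def)
    show "\<exists>F. frobenius_pseudoprime_via f n F \<and>
      (\<forall>i\<in>{1..d}. real (degree (F i)) / real i = real (cycle_count d \<sigma> i))"
      using frobenius_pseudoprime_via_cycle[OF n d, of f] A[OF f]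
      by (intro exI[of _ "\<lambda>i. if i = d then f else 1"]) (auto simp: cycle_count_cycle[OF \<sigma>] cyclic_mod_def)
  qed
qed

section \<open>Numbers all of whose prime factors split\<close>

text \<open>The quotient of u^l - v^l by u - v, written as a sum so that it exists for natural
  numbers and also at u = v, where it is l * u^(l - 1).\<close>

definition slope :: "nat \<Rightarrow> 'a :: comm_semiring_1 \<Rightarrow> 'a \<Rightarrow> 'a" where
  "slope l u v = (\<Sum>i<l. v ^ (l - Suc i) * u ^ i)"

lemma slope_mult: "(u - v) * slope l u v = u ^ l - v ^ l" for u v :: "'a :: comm_ring_1"
  unfolding slope_def by (rule power_diff_sumr2[symmetric])

lemma slope_0_right: "l \<ge> 1 \<Longrightarrow> slope l u 0 = u ^ (l - 1)"
proof -
  assume l: "l \<ge> 1"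
  have "slope l u 0 = (\<Sum>i<l. if i = l - 1 then u ^ (l - 1) else 0)"
    unfolding slope_def using l by (intro sum.cong) (auto simp: power_0_left)
  thus ?thesis using l by simp
qed

lemma of_nat_slope: "of_nat (slope l u v) = slope l (of_nat u) (of_nat v)"
  by (simp add: slope_def)

lemma cong_slope:
  fixes u v :: "'a :: unique_euclidean_semiring"
  shows "[u = u'] (mod m) \<Longrightarrow> [v = v'] (mod m) \<Longrightarrow> [slope l u v = slope l u' v'] (mod m)"
  unfolding slope_def by (intro cong_sum cong_mult cong_pow) auto

section \<open>Power sums and the directions determined by the l-th power map\<close>

lemma prime_power_sum_dvd:
  fixes p :: nat
  assumes p: "prime p" and j: "0 < j" "j < p - 1"
  shows "int p dvd (\<Sum>u<p. int u ^ j)"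
proof -
  have p1: "p > 1" using p prime_gt_1_nat by blast
  obtain g where g: "residue_primroot p g" using prime_primitive_root_exists[OF _ p] p1 by auto
  have cop: "Rings.coprime p g" and ord: "ord p g = p - 1"
    using g p by (auto simp: residue_primroot_def totient_prime)
  \<comment> \<open>Multiplication by the primitive root permutes the residues and scales the power
    sum by \<open>g ^ j\<close>, which is not 1 modulo p for 0 < j < p - 1.\<close>
  have bij: "bij_betw (\<lambda>u. g * u mod p) {..<p} {..<p}"
  proof (rule bij_betw_imageI)
    show inj: "inj_on (\<lambda>u. g * u mod p) {..<p}"
    proof (rule inj_onI)
      fix x y assume "x \<in> {..<p}" "y \<in> {..<p}" "g * x mod p = g * y mod p"
      moreover have "[x = y] (mod p)"
        using cong_mult_lcancel_nat[of g p x y] cop calculation(3)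
        by (simp add: cong_def algebraic_semidom_class.coprime_commute)
      ultimately show "x = y" by (simp add: cong_def)
    qed
    show "(\<lambda>u. g * u mod p) ` {..<p} = {..<p}"
      using p1 by (intro endo_inj_surj inj) auto
  qed
  define S where "S = (\<Sum>u<p. int u ^ j)"
  have "S = (\<Sum>u<p. int (g * u mod p) ^ j)"
    unfolding S_def by (rule sum.reindex_bij_betw[OF bij, symmetric])
  also have "[\<dots> = (\<Sum>u<p. (int g * int u) ^ j)] (mod int p)"
    by (intro cong_sum cong_pow) (simp add: cong_def of_nat_mod)
  also have "(\<Sum>u<p. (int g * int u) ^ j) = int g ^ j * S"
    by (simp add: S_def power_mult_distrib sum_distrib_left)
  finally have "int p dvd (int g ^ j - 1) * S"
    by (simp add: cong_iff_dvd_diff algebra_simps dvd_diff_commute)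
  moreover have "\<not> int p dvd int g ^ j - 1"
  proof
    assume "int p dvd int g ^ j - 1"
    hence "[int (g ^ j) = int 1] (mod int p)" by (simp add: cong_iff_dvd_diff)
    hence "[g ^ j = 1] (mod p)" by (simp only: cong_int_iff)
    thus False using ord_minimal[of j p g] j ord by simp
  qed
  ultimately show ?thesis using p unfolding S_def by (simp add: prime_dvd_mult_iff)
qed

lemma prime_power_sum_not_dvd:
  fixes p :: nat
  assumes p: "prime p"
  shows "\<not> int p dvd (\<Sum>u<p. int u ^ (p - 1))"
proof -
  have p1: "p > 1" using p prime_gt_1_nat by blast
  have "(\<Sum>u<p. int u ^ (p - 1)) = (\<Sum>u\<in>{1..<p}. int u ^ (p - 1))"
    using p1 by (intro sum.mono_neutral_right) (auto simp: power_0_left)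
  also have "[\<dots> = (\<Sum>u\<in>{1..<p}. 1)] (mod int p)"
  proof (rule cong_sum)
    fix u assume "u \<in> {1..<p}"
    hence "\<not> p dvd u" by (auto dest: dvd_imp_le)
    hence "[u ^ (p - 1) = 1] (mod p)" by (rule fermat_theorem[OF p])
    hence "[int (u ^ (p - 1)) = int 1] (mod int p)" by (simp only: cong_int_iff)
    thus "[int u ^ (p - 1) = 1] (mod int p)" by simp
  qed
  finally have *: "[(\<Sum>u<p. int u ^ (p - 1)) = int (p - 1)] (mod int p)" by simp
  show ?thesis
  proof
    assume "int p dvd (\<Sum>u<p. int u ^ (p - 1))"
    hence "int p dvd int (p - 1)" using cong_dvd_iff[OF *] by blast
    hence "p dvd p - 1" by (simp only: int_dvd_int_iff)
    thus False using p1 by (auto dest: dvd_imp_le)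
  qed
qed

text \<open>The argument of Redei and of Lovasz and Schrijver: the map \<open>u \<mapsto> u ^ l - \<lambda> * u\<close> permutes
  the residues unless \<open>\<lambda>\<close> is a slope, so its low power sums vanish; as polynomials in
  \<open>\<lambda>\<close> they have too many roots unless all their coefficients vanish.\<close>

lemma card_slopes:
  fixes p l :: nat
  assumes p: "prime p" and l: "l \<ge> 3" and pl: "p > 6 * l"
  shows "p + 1 < 2 * card {x\<in>{..<p}. \<exists>u<p. \<exists>v<p. u \<noteq> v \<and> [slope l u v = x] (mod p)}"
proof (rule ccontr)
  define D where "D = {x\<in>{..<p}. \<exists>u<p. \<exists>v<p. u \<noteq> v \<and> [slope l u v = x] (mod p)}"
  define L where "L = {..<p} - D"
  \<comment> \<open>Since p - 1 = l * m + i, in the sum over u of (u^l - \<lambda> * u)^j with j = i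
    + m the coefficient of \<lambda>^i involves exactly u^(p - 1), a power whose sum does not vanish
    modulo p.\<close>
  define m where "m = (p - 1) div l"
  define i where "i = (p - 1) mod l"
  define j where "j = i + m"
  assume "\<not> ?thesis"
  hence "2 * card D \<le> p + 1" by (simp add: D_def)
  moreover have "card L = p - card D" unfolding L_def by (subst card_Diff_subset) (auto simp: D_def)
  ultimately have cardL: "2 * card L + 1 \<ge> p" by linarith
  have i: "i < l" unfolding i_def using l by simp
  have p1: "p - 1 = l * m + i" unfolding m_def i_def by simp
  have "3 * m \<le> l * m" using l by simp
  hence "3 * j \<le> (l * m + i) + 2 * l" using i unfolding j_def add_mult_distrib2 by linarith
  hence "3 * j \<le> (p - 1) + 2 * l" by (simp only: p1)
  \<comment> \<open>Here the constant 6 is used: the polynomial \<open>Q\<close> of degree at most j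
    gets at least j + 1 roots among the residues that are not slopes, and j stays below p -
    1.\<close>
  hence "2 * j + 3 \<le> p" using pl l by linarith
  hence jL: "j + 1 \<le> card L" and jp: "j < p - 1" using cardL by linarith+
  have j0: "j > 0" using p1 pl l by (cases "m = 0") (auto simp: j_def)
  have J: "ring_ideal {x. int p dvd x}" by (auto simp: ring_ideal_def)
  define Q where "Q = (\<Sum>u<p. [:int u ^ l, - int u:] ^ j)"
  have coeffQ: "coeff Q k = (\<Sum>u<p. of_nat (j choose k) * (- int u) ^ k * (int u ^ l) ^ (j - k))" if "k \<le> j" for k
    unfolding Q_def coeff_sum using that by (intro sum.cong refl coeff_linear_poly_power)
  have degQ: "degree Q \<le> j"
    unfolding Q_def
  proof (rule degree_sum_le)
    fix u show "degree ([:int u ^ l, - int u:] ^ j) \<le> j"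
      using degree_power_le[of "[:int u ^ l, - int u:]" j] by (auto split: if_splits)
  qed simp
  obtain \<rho> where \<rho>: "bij_betw \<rho> {0..<card L} L"
    using ex_bij_betw_nat_finite[of L] by (auto simp: L_def)
  have \<rho>_in: "\<rho> k \<in> L" if "k < card L" for k using \<rho> that by (auto simp: bij_betw_def)
  have "coeff Q i \<in> {x. int p dvd x}"
  proof (rule coeffs_in_ideal_if_vanishing[OF J, of "j + 1" "\<lambda>k. int (\<rho> k)"])
    fix a b assume ab: "a < b" "b < j + 1"
    have "\<rho> a \<noteq> \<rho> b" "\<rho> a < p" "\<rho> b < p"
      using ab jL \<rho>_in[of a] \<rho>_in[of b] inj_onD[OF bij_betw_imp_inj_on[OF \<rho>], of a b]
      by (auto simp: L_def)
    hence "\<not> int p dvd int (\<rho> a) - int (\<rho> b)"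
      using zdvd_not_zless[of "\<bar>int (\<rho> a) - int (\<rho> b)\<bar>" "int p"] by simp
    hence "Rings.coprime (int p) (int (\<rho> a) - int (\<rho> b))"
      using p by (intro prime_imp_coprime) auto
    then obtain v where "[(int (\<rho> a) - int (\<rho> b)) * v = 1] (mod int p)"
      using cong_solve_coprime_int[of "int (\<rho> a) - int (\<rho> b)" "int p"] by (auto simp: algebraic_semidom_class.coprime_commute)
    thus "\<exists>v. (int (\<rho> a) - int (\<rho> b)) * v - 1 \<in> {x. int p dvd x}"
      by (auto simp: cong_iff_dvd_diff)
  next
    fix k assume "k \<ge> j + 1"
    thus "coeff Q k = 0" using degQ by (intro coeff_eq_0) simp
  next
    fix k assume "k < j + 1"
    define c where "c = \<rho> k"
    have c: "c < p" "c \<notin> D" using \<rho>_in[of k] \<open>k < j + 1\<close> jL by (auto simp: L_def c_def)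
    define h where "h = (\<lambda>u. nat ((int u ^ l - int c * int u) mod int p))"
    have ppos: "p > 0" using p prime_gt_0_nat by blast
    have h: "int (h u) = (int u ^ l - int c * int u) mod int p" for u
      using ppos by (simp add: h_def)
    have hp: "h u < p" for u
    proof -
      have "int (h u) < int p" unfolding h using ppos by simp
      thus ?thesis by simp
    qed
    have inj: "inj_on h {..<p}"
    proof (rule inj_onI, rule ccontr)
      fix u v assume uv: "u \<in> {..<p}" "v \<in> {..<p}" "h u = h v" "u \<noteq> v"
      have "(int u ^ l - int c * int u) mod int p = (int v ^ l - int c * int v) mod int p"
        using uv(3) h[of u] h[of v] by simp
      hence "int p dvd (int u ^ l - int c * int u) - (int v ^ l - int c * int v)"
        by (rule mod_eq_dvd_iff[THEN iffD1])
      also have "\<dots> = (int u - int v) * (slope l (int u) (int v) - int c)"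
        using slope_mult[of "int u" "int v" l] by (simp add: algebra_simps)
      finally have "int p dvd int u - int v \<or> int p dvd slope l (int u) (int v) - int c"
        using p by (simp add: prime_dvd_mult_iff)
      moreover have "\<not> int p dvd int u - int v"
        using zdvd_not_zless[of "\<bar>int u - int v\<bar>" "int p"] uv by simp
      ultimately have "[int (slope l u v) = int c] (mod int p)"
        by (simp add: cong_iff_dvd_diff of_nat_slope)
      hence "[slope l u v = c] (mod p)" by (simp only: cong_int_iff)
      hence "c \<in> D" using uv c(1) unfolding D_def by auto
      thus False using c by simp
    qed
    have bij: "bij_betw h {..<p} {..<p}"
      by (rule bij_betw_imageI[OF inj]) (use hp in \<open>auto intro!: endo_inj_surj[OF _ _ inj]\<close>)
    have "poly Q (int c) = (\<Sum>u<p. (int u ^ l - int c * int u) ^ j)"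
      unfolding Q_def poly_sum by (intro sum.cong) (auto simp: algebra_simps)
    also have "[\<dots> = (\<Sum>u<p. int (h u) ^ j)] (mod int p)"
      by (intro cong_sum cong_pow) (simp add: h cong_def)
    also have "(\<Sum>u<p. int (h u) ^ j) = (\<Sum>u<p. int u ^ j)"
      by (rule sum.reindex_bij_betw[OF bij])
    finally have "[poly Q (int c) = (\<Sum>u<p. int u ^ j)] (mod int p)" .
    hence "int p dvd poly Q (int c)"
      using prime_power_sum_dvd[OF p j0 jp] cong_dvd_iff by blast
    thus "poly Q (int (\<rho> k)) \<in> {x. int p dvd x}" by (simp add: c_def)
  qed
  hence "int p dvd (\<Sum>u<p. of_nat (j choose i) * (- int u) ^ i * (int u ^ l) ^ (j - i))"
    using coeffQ[of i] by (simp add: j_def)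
  also have "(\<Sum>u<p. of_nat (j choose i) * (- int u) ^ i * (int u ^ l) ^ (j - i)) =
     (-1) ^ i * int (j choose i) * (\<Sum>u<p. int u ^ (p - 1))"
    unfolding sum_distrib_left
  proof (intro sum.cong refl)
    fix u
    have "(- int u) ^ i = (-1) ^ i * int u ^ i" by (rule power_minus)
    moreover have "int u ^ i * (int u ^ l) ^ (j - i) = int u ^ (p - 1)"
      unfolding p1 by (simp add: j_def power_add power_mult mult.commute)
    ultimately show "of_nat (j choose i) * (- int u) ^ i * (int u ^ l) ^ (j - i) =
        (-1) ^ i * int (j choose i) * int u ^ (p - 1)"
      by (simp add: mult_ac)
  qed
  finally have "int p dvd int (j choose i) * (\<Sum>u<p. int u ^ (p - 1))"
    by (cases "even i") (simp_all add: mult.assoc)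
  moreover have "\<not> int p dvd int (j choose i)"
  proof
    assume "int p dvd int (j choose i)"
    hence "p dvd j choose i" by simp
    moreover have "(j choose i) dvd fact j"
      by (metis binomial_fact_lemma dvd_triv_right j_def le_add1)
    ultimately have "p dvd fact j" using dvd_trans by blast
    thus False using p jp by (simp add: prime_dvd_fact_iff)
  qed
  ultimately show False
    using p prime_power_sum_not_dvd[OF p] by (simp add: prime_dvd_mult_iff)
qed

section \<open>Residue classes met by products of three slope values\<close>

lemma prod_prime_factors_dvd: "M > 0 \<Longrightarrow> \<Prod>(prime_factors M) dvd (M :: nat)"
proof -
  assume "M > 0"
  have "(\<Prod>p\<in>prime_factors M. p) dvd (\<Prod>p\<in>prime_factors M. p ^ multiplicity p M)"
    by (intro prod_dvd_prod) (auto simp: prime_factors_multiplicity)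
  also have "\<dots> = M" using \<open>M > 0\<close> by (simp add: prime_factorization_nat[symmetric])
  finally show ?thesis by simp
qed

lemma prime_factors_prod_primes:
  assumes "finite T" "\<And>p. p \<in> T \<Longrightarrow> prime (p::nat)"
  shows "prime_factors (\<Prod>T) = T"
proof -
  have "\<Prod>T > 0" by (intro prod_pos) (use assms(2) in \<open>auto intro: prime_gt_0_nat\<close>)
  hence nz: "\<Prod>T \<noteq> 0" by simp
  show ?thesis
  proof (intro equalityI subsetI)
    fix q assume "q \<in> prime_factors (\<Prod>T)"
    hence q: "prime q" "q dvd \<Prod>T" by (simp_all only: in_prime_factors_iff)
    have "\<exists>p\<in>T. q dvd p" using q(2) by (subst (asm) prime_dvd_prod_iff[OF assms(1) q(1)])
    then obtain p where p: "p \<in> T" "q dvd p" ..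
    hence "q = p" using assms(2) q(1) primes_dvd_imp_eq by blast
    thus "q \<in> T" using p by simp
  next
    fix q assume q: "q \<in> T"
    have "q dvd \<Prod>T" using assms(1) q by (rule dvd_prodI)
    thus "q \<in> prime_factors (\<Prod>T)" using nz assms(2)[OF q] by (simp only: in_prime_factors_iff not_False_eq_True simp_thms)
  qed
qed

lemma coprime_natI:
  assumes "\<And>p. prime p \<Longrightarrow> p dvd a \<Longrightarrow> p dvd b \<Longrightarrow> False"
  shows "Rings.coprime (a :: nat) b"
proof (rule ccontr)
  assume "\<not> Rings.coprime a b"
  hence "gcd a b \<noteq> 1" by (simp only: coprime_iff_gcd_eq_1 not_False_eq_True)
  then obtain p where "prime p" "p dvd gcd a b" using prime_factor_nat by blast
  thus False using assms[of p] by simp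
qed

text \<open>Slopes fill more than half of the nonzero residues, and so do the quotients c / x of c
  by nonzero slopes x. The two sets must meet. For primes up to 6 * l no such count is available,
  which is why c is assumed to be 1 there.\<close>

lemma product_of_two_slopes:
  fixes p l c :: nat
  assumes p: "prime p" and l: "l \<ge> 2" and c: "\<not> p dvd c"
    and small: "p \<le> 6 * l \<Longrightarrow> [c = 1] (mod p)"
  shows "\<exists>u v u' v'. [slope l u v * slope l u' v' = c] (mod p)"
proof -
  consider "p \<le> 6 * l" | "l = 2" | "p > 6 * l" "l \<ge> 3" using l by linarith
  thus ?thesis
  proof cases
    case 1
    have "slope l 1 0 * slope l 1 0 = (1 :: nat)" using l by (simp add: slope_0_right)
    thus ?thesis using small[OF 1] cong_sym by metis
  next
    case 2
    have "slope l c 0 * slope l 1 0 = c" using 2 by (simp add: slope_0_right)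
    thus ?thesis using cong_refl by metis
  next
    case 3
    define D where "D = {x\<in>{..<p}. \<exists>u<p. \<exists>v<p. u \<noteq> v \<and> [slope l u v = x] (mod p)}"
    define D' where "D' = D - {0}"
    define E where "E = {y\<in>{1..<p}. \<exists>x\<in>D'. [x * y = c] (mod p)}"
    have p1: "p > 1" using p prime_gt_1_nat by blast
    have fin: "finite D'" "finite E" by (auto simp: D'_def D_def E_def)
    have D'_sub: "D' \<subseteq> {1..<p}" by (auto simp: D'_def D_def Suc_le_eq)
    have "p + 1 < 2 * card D" using card_slopes[OF p 3(2,1)] by (simp add: D_def)
    moreover have "card D \<le> card D' + 1"
      using card_Diff1_le[of D 0] by (cases "0 \<in> D") (auto simp: D'_def card_Diff_singleton_if)
    ultimately have cardD': "2 * card D' \<ge> p" by linarith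
    have unit: "Rings.coprime x p" if "x \<in> {1..<p}" for x
    proof -
      have "\<not> p dvd x" using that by (auto dest: dvd_imp_le)
      thus ?thesis using prime_imp_coprime[OF p] algebraic_semidom_class.coprime_commute by blast
    qed
    have "\<exists>y\<in>E. [x * y = c] (mod p)" if x: "x \<in> D'" for x
    proof -
      have "x \<in> {1..<p}" using x D'_sub by auto
      from cong_solve_coprime_nat[OF unit[OF this]] obtain w where w: "[x * w = 1] (mod p)" by auto
      have "[(x * w) * c = 1 * c] (mod p)" by (intro cong_mult w) auto
      hence *: "[x * (w * c mod p) = c] (mod p)" by (simp add: cong_def mod_mult_right_eq mult_ac)
      have "w * c mod p \<noteq> 0"
      proof
        assume "w * c mod p = 0"
        hence "[0 = c] (mod p)" using * by simp
        hence "[c = 0] (mod p)" by (rule cong_sym)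
        thus False using c by (simp add: cong_0_iff)
      qed
      hence "w * c mod p \<in> E" unfolding E_def using * x p1 by auto
      thus ?thesis using * by blast
    qed
    then obtain f where f: "f x \<in> E" "[x * f x = c] (mod p)" if "x \<in> D'" for x by metis
    have "inj_on f D'"
    proof (rule inj_onI)
      fix x y assume xy: "x \<in> D'" "y \<in> D'" "f x = f y"
      have "Rings.coprime (f x) p" using f(1)[OF xy(1)] unit by (auto simp: E_def)
      moreover have "[x * f x = y * f x] (mod p)"
        using cong_trans[OF f(2)[OF xy(1)] cong_sym[OF f(2)[OF xy(2)]]] xy(3) by simp
      ultimately have "[x = y] (mod p)" by (simp add: cong_mult_rcancel_nat)
      moreover have "x < p" "y < p" using xy D'_sub by auto
      ultimately show "x = y" by (simp add: cong_def)
    qed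
    hence "card D' \<le> card E" using f fin by (intro card_inj_on_le[of f]) auto
    have "D' \<inter> E \<noteq> {}"
    proof
      assume "D' \<inter> E = {}"
      hence "card D' + card E = card (D' \<union> E)" using fin by (simp add: card_Un_disjoint)
      also have "\<dots> \<le> card {1..<p}" using D'_sub by (intro card_mono) (auto simp: E_def)
      finally show False using cardD' \<open>card D' \<le> card E\<close> p1 by simp
    qed
    then obtain x y where xy: "y \<in> D'" "x \<in> D'" "[x * y = c] (mod p)" by (auto simp: E_def)
    obtain u v where 1: "[slope l u v = x] (mod p)" using xy by (auto simp: D'_def D_def)
    obtain u' v' where 2: "[slope l u' v' = y] (mod p)" using xy by (auto simp: D'_def D_def)
    show ?thesis using cong_trans[OF cong_mult[OF 1 2] xy(3)] by blast
  qed
qed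

text \<open>The quotient u / v has order exactly l modulo q, so l divides q - 1. Coprimality of u
  and v makes v invertible; and u = v modulo q would give a slope \<open>l * v ^ (l - 1)\<close>,
  which q different from l does not divide.\<close>

lemma prime_dvd_slope_cong_1:
  fixes q l u v :: nat
  assumes q: "prime q" and l: "prime l" and ql: "q \<noteq> l" and dvd: "q dvd slope l u v"
    and cop: "Rings.coprime u v"
  shows "[q = 1] (mod l)"
proof -
  have l1: "l > 1" using l prime_gt_1_nat by blast
  have nv: "\<not> q dvd v"
  proof
    assume v: "q dvd v"
    hence "[slope l u v = slope l u 0] (mod q)"
      by (intro cong_slope) (auto simp: cong_0_iff)
    hence "q dvd u ^ (l - 1)" using dvd l1 cong_dvd_iff by (simp add: slope_0_right) blast
    hence "q dvd u" using q prime_dvd_power by blast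
    thus False using v cop q by (meson coprime_common_divisor not_prime_unit)
  qed
  hence "Rings.coprime v q" using q by (metis algebraic_semidom_class.coprime_commute prime_imp_coprime)
  from cong_solve_coprime_nat[OF this] obtain w where w: "[v * w = 1] (mod q)" by auto
  define z where "z = u * w"
  have "int q dvd (int u - int v) * slope l (int u) (int v)"
    using dvd by (simp flip: of_nat_slope)
  hence "[int (u ^ l) = int (v ^ l)] (mod int q)" by (simp add: slope_mult cong_iff_dvd_diff)
  hence uv: "[u ^ l = v ^ l] (mod q)" by (simp only: cong_int_iff)
  have "[z ^ l = (v * w) ^ l] (mod q)"
    unfolding z_def power_mult_distrib by (intro cong_mult uv cong_refl)
  also have "[(v * w) ^ l = 1 ^ l] (mod q)" by (rule cong_pow[OF w])
  finally have zl: "[z ^ l = 1] (mod q)" by simp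
  have z1: "\<not> [z = 1] (mod q)"
  proof
    assume "[z = 1] (mod q)"
    hence "[z * v = 1 * v] (mod q)" by (intro cong_mult cong_refl)
    moreover have "[u * (v * w) = u * 1] (mod q)" by (intro cong_mult w cong_refl)
    ultimately have uv: "[u = v] (mod q)"
      by (simp add: z_def mult_ac) (metis cong_sym cong_trans)
    have "[slope l u v = slope l v v] (mod q)" by (intro cong_slope uv cong_refl)
    moreover have "slope l v v = l * v ^ (l - 1)"
      unfolding slope_def by (simp flip: power_add)
    ultimately have "q dvd l * v ^ (l - 1)" using dvd cong_dvd_iff by metis
    hence "q dvd l" using q nv by (auto simp: prime_dvd_mult_iff dest: prime_dvd_power)
    thus False using q l ql primes_dvd_imp_eq by blast
  qed
  have "ord q z dvd l" using zl by (simp only: ord_divides)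
  moreover have "ord q z \<noteq> 1" using z1 ord_divides[of z 1 q] by auto
  ultimately have "ord q z = l" using l prime_nat_iff by blast
  moreover have "\<not> q dvd z"
  proof
    assume "q dvd z"
    hence "q dvd z ^ l" using l1 by (simp add: dvd_power_iff_le dvd_trans[OF _ dvd_power])
    hence "q dvd 1" using zl cong_dvd_iff by blast
    thus False using q by auto
  qed
  hence "[z ^ (q - 1) = 1] (mod q)" by (rule fermat_theorem[OF q])
  hence "ord q z dvd q - 1" by (simp only: ord_divides)
  ultimately have "l dvd q - 1" by simp
  thus ?thesis using prime_gt_1_nat[OF q]
    by (metis cong_altdef_nat less_imp_le_nat cong_sym)
qed

text \<open>A lifting argument done for all prime powers at once. For x and y divisible by R the
  difference of the slopes is (x - y) * (1 + R * k), and the second factor is a unit modulo M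
  because R contains every prime of M. So the shifted slope is an injective, hence surjective, map
  of the multiples of R modulo M to themselves.\<close>

lemma slope_hits_unit_residue:
  fixes M R c l :: nat
  assumes M: "M > 0" and R: "R dvd M" "\<And>p. prime p \<Longrightarrow> p dvd M \<Longrightarrow> p dvd R" and l: "l \<ge> 2"
    and c: "[c = 1] (mod R)"
  shows "\<exists>u<M. [slope l u 1 = c] (mod M)"
proof -
  define A where "A = {u\<in>{..<M}. R dvd u}"
  define f where "f = (\<lambda>u. nat ((slope l (int u) 1 - 1) mod int M))"
  have f: "int (f u) = (slope l (int u) 1 - 1) mod int M" for u using M by (simp add: f_def)
  have fM: "f u < M" for u
  proof -
    have "int (f u) < int M" unfolding f using M by simp
    thus ?thesis by simp
  qed
  have factor: "\<exists>k. slope l x 1 - slope l y 1 = (x - y) * (1 + int R * k)"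
    if xy: "int R dvd x" "int R dvd y" for x y :: int
  proof -
    have "\<exists>k. x ^ i - y ^ i = (x - y) * (int R * k)" if "i \<ge> 2" for i
    proof -
      have "int R dvd (\<Sum>t<i. y ^ (i - Suc t) * x ^ t)"
      proof (rule dvd_sum)
        fix t assume "t \<in> {..<i}"
        hence "i - Suc t > 0 \<or> t > 0" using that by auto
        thus "int R dvd y ^ (i - Suc t) * x ^ t"
        proof
          assume "i - Suc t > 0"
          from dvd_trans[OF xy(2) dvd_power[of "i - Suc t" y]] this show ?thesis by simp
        next
          assume "t > 0"
          from dvd_trans[OF xy(1) dvd_power[of t x]] this show ?thesis by simp
        qed
      qed
      thus ?thesis unfolding power_diff_sumr2 by (auto elim!: dvdE)
    qed
    then obtain k where k: "x ^ i - y ^ i = (x - y) * (int R * k i)" if "i \<ge> 2" for i by metis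
    have split: "{..<l} = insert 0 (insert 1 {2..<l})" using l by auto
    have "slope l x 1 - slope l y 1 = (\<Sum>i<l. x ^ i - y ^ i)"
      by (simp add: slope_def sum_subtractf)
    also have "\<dots> = (x - y) + (\<Sum>i=2..<l. x ^ i - y ^ i)"
      unfolding split by (subst sum.insert, simp, simp, subst sum.insert) auto
    also have "(\<Sum>i=2..<l. x ^ i - y ^ i) = (\<Sum>i=2..<l. (x - y) * (int R * k i))"
      by (intro sum.cong) (auto simp: k)
    also have "\<dots> = (x - y) * (int R * (\<Sum>i=2..<l. k i))" by (simp add: sum_distrib_left)
    finally show ?thesis by (intro exI[of _ "\<Sum>i=2..<l. k i"]) (simp add: algebra_simps)
  qed
  have unit: "Rings.coprime (int M) (1 + int R * k)" for k
  proof -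
    define e where "e = nat (gcd (int M) (1 + int R * k))"
    have e: "int e = gcd (int M) (1 + int R * k)" by (simp add: e_def)
    have "e = 1"
    proof (rule ccontr)
      assume "e \<noteq> 1"
      then obtain q where q: "prime q" "q dvd e" using prime_factor_nat by blast
      have "int q dvd gcd (int M) (1 + int R * k)" using q(2) by (simp flip: e)
      hence qM: "int q dvd int M" and *: "int q dvd 1 + int R * k" by simp_all
      have "int q dvd int R * k" using R(2)[OF q(1)] qM by simp
      hence "int q dvd 1" using * by (simp add: dvd_add_left_iff)
      thus False using q by auto
    qed
    hence "gcd (int M) (1 + int R * k) = 1" using e by simp
    thus ?thesis by (simp only: coprime_iff_gcd_eq_1)
  qed
  have "f u \<in> A" if "u \<in> A" for u
  proof -
    obtain k where "slope l (int u) 1 - slope l 0 1 = (int u - 0) * (1 + int R * k)"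
      using factor[of "int u" 0] \<open>u \<in> A\<close> by (auto simp: A_def)
    moreover have "slope l (0::int) 1 = 1"
    proof -
      have "slope l (0::int) 1 = (\<Sum>i<l. if i = 0 then 1 else 0)"
        unfolding slope_def by (intro sum.cong) auto
      thus ?thesis using l by simp
    qed
    ultimately have "int R dvd slope l (int u) 1 - 1" using \<open>u \<in> A\<close> by (simp add: A_def)
    hence "int R dvd int (f u)" unfolding f using R(1) by (simp add: dvd_mod_iff)
    thus ?thesis using fM by (simp add: A_def)
  qed
  moreover have inj: "inj_on f A"
  proof (rule inj_onI)
    fix x y assume xy: "x \<in> A" "y \<in> A" "f x = f y"
    obtain k where k: "slope l (int x) 1 - slope l (int y) 1 = (int x - int y) * (1 + int R * k)"
      using factor[of "int x" "int y"] xy by (auto simp: A_def)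
    have "(slope l (int x) 1 - 1) mod int M = (slope l (int y) 1 - 1) mod int M"
      using f[of x] f[of y] xy(3) by simp
    hence "int M dvd (slope l (int x) 1 - 1) - (slope l (int y) 1 - 1)"
      by (rule mod_eq_dvd_iff[THEN iffD1])
    hence "int M dvd (int x - int y) * (1 + int R * k)" by (simp add: k)
    hence "int M dvd int x - int y" using unit by (metis coprime_dvd_mult_left_iff)
    hence "[x = y] (mod M)" by (simp add: cong_iff_dvd_diff flip: cong_int_iff)
    thus "x = y" using xy by (auto simp: A_def cong_def)
  qed
  moreover have "finite A" by (simp add: A_def)
  ultimately have surj: "f ` A = A" by (intro endo_inj_surj) auto
  define c' where "c' = nat ((int c - 1) mod int M)"
  have c': "int c' = (int c - 1) mod int M" using M by (simp add: c'_def)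
  have "int c' < int M" unfolding c' using M by simp
  moreover have "int R dvd int c'"
  proof -
    have "[int c = int 1] (mod int R)" using c by (simp only: cong_int_iff)
    hence "int R dvd int c - 1" by (simp add: cong_iff_dvd_diff)
    thus ?thesis unfolding c' using R(1) by (simp add: dvd_mod_iff)
  qed
  ultimately have "c' \<in> A" by (simp add: A_def)
  then obtain u where u: "u \<in> A" "f u = c'" using surj by (metis imageE)
  have "(slope l (int u) 1 - 1) mod int M = (int c - 1) mod int M"
    using f[of u] c' u(2) by simp
  hence "int M dvd (slope l (int u) 1 - 1) - (int c - 1)" by (rule mod_eq_dvd_iff[THEN iffD1])
  hence "[int (slope l u 1) = int c] (mod int M)" by (simp add: cong_iff_dvd_diff of_nat_slope)
  hence "[slope l u 1 = c] (mod M)" by (simp only: cong_int_iff)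
  thus ?thesis using u by (auto simp: A_def)
qed

lemma chinese_remainder_primes:
  fixes Q :: "nat set"
  assumes "finite Q" "\<And>q. q \<in> Q \<Longrightarrow> prime q"
  shows "\<exists>x < \<Prod>Q. \<forall>q\<in>Q. [x = t q] (mod q)"
proof -
  have "\<forall>i\<in>Q. \<forall>j\<in>Q. i \<noteq> j \<longrightarrow> Rings.coprime i j"
    using assms primes_coprime by blast
  moreover have "\<forall>i\<in>Q. i \<noteq> 0" using assms by (metis not_prime_0)
  ultimately show ?thesis
    using chinese_remainder_unique_nat[OF assms(1), of "\<lambda>q. q" t] by auto
qed

text \<open>Prime divisors of a slope are controlled only for coprime arguments, and residues
  prescribed modulo the primes of M do not ensure this. So a is also required to be 1 modulo every
  prime of b outside M; this makes its bound quadratic.\<close>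

lemma coprime_lift:
  fixes M :: nat and u v :: "nat \<Rightarrow> nat"
  assumes M: "M > 0" and uv: "\<And>p. prime p \<Longrightarrow> p dvd M \<Longrightarrow> \<not> p dvd u p \<or> \<not> p dvd v p"
  obtains a b where "Rings.coprime a b" "a \<le> M ^ 2" "b \<le> M"
    "\<And>p. prime p \<Longrightarrow> p dvd M \<Longrightarrow> [a = u p] (mod p) \<and> [b = v p] (mod p)"
proof -
  define P where "P = prime_factors M"
  have P: "finite P" "\<And>p. p \<in> P \<Longrightarrow> prime p" by (auto simp: P_def)
  have memP: "p \<in> P \<longleftrightarrow> prime p \<and> p dvd M" for p using M by (auto simp: P_def prime_factors_dvd)
  have prodP: "\<Prod>P \<le> M" "\<Prod>P > 0"
  proof -
    have "\<Prod>P dvd M" unfolding P_def by (rule prod_prime_factors_dvd[OF M])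
    thus "\<Prod>P \<le> M" using M by (simp add: dvd_imp_le)
    show "\<Prod>P > 0" using P by (intro prod_pos) (auto intro: prime_gt_0_nat)
  qed
  obtain b0 where b0: "b0 < \<Prod>P" "\<forall>p\<in>P. [b0 = v p] (mod p)"
    using chinese_remainder_primes[OF P] by blast
  \<comment> \<open>The value 0 is avoided because the prime factors of b have to be a finite list
    of all primes dividing it.\<close>
  define b where "b = b0 + (if b0 = 0 then \<Prod>P else 0)"
  have b: "b > 0" "b \<le> \<Prod>P" "\<forall>p\<in>P. [b = v p] (mod p)"
  proof -
    show "b > 0" "b \<le> \<Prod>P" using prodP b0 by (auto simp: b_def)
    show "\<forall>p\<in>P. [b = v p] (mod p)"
    proof
      fix p assume p: "p \<in> P"
      have "p dvd \<Prod>P" using P(1) p by (intro dvd_prodI)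
      hence "[b = b0] (mod p)" by (simp add: b_def cong_def)
      thus "[b = v p] (mod p)" using b0 p cong_trans by blast
    qed
  qed
  define Q where "Q = P \<union> (prime_factors b - P)"
  have Q: "finite Q" "\<And>p. p \<in> Q \<Longrightarrow> prime p" using P by (auto simp: Q_def)
  obtain a where a: "a < \<Prod>Q" "\<forall>p\<in>Q. [a = (if p \<in> P then u p else 1)] (mod p)"
    using chinese_remainder_primes[of Q "\<lambda>p. if p \<in> P then u p else 1"] Q by blast
  have "\<Prod>(prime_factors b - P) \<le> b"
  proof -
    have "\<Prod>(prime_factors b - P) dvd \<Prod>(prime_factors b)" by (intro prod_dvd_prod_subset) auto
    also have "\<dots> dvd b" by (rule prod_prime_factors_dvd[OF b(1)])
    finally show ?thesis using b(1) by (simp add: dvd_imp_le)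
  qed
  hence "\<Prod>Q \<le> M * M"
    unfolding Q_def using P prodP b by (subst prod.union_disjoint) (auto intro!: mult_mono)
  hence "a \<le> M ^ 2" using a by (simp add: power2_eq_square)
  moreover have "Rings.coprime a b"
  proof (rule coprime_natI)
    fix r assume r: "prime r" "r dvd a" "r dvd b"
    show False
    proof (cases "r \<in> P")
      case True
      hence "[a = u r] (mod r)" "[b = v r] (mod r)"
        using a(2)[rule_format, of r] b(3) by (auto simp: Q_def)
      hence "r dvd u r" "r dvd v r" using r cong_dvd_iff by blast+
      thus False using uv[of r] True memP by blast
    next
      case False
      hence "r \<in> Q" using r b by (simp add: Q_def prime_factors_dvd)
      hence "[a = 1] (mod r)" using a False by auto
      hence "r dvd 1" using r cong_dvd_iff by blast
      thus False using r by auto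
    qed
  qed
  moreover have "b \<le> M" using b prodP by simp
  ultimately have "Rings.coprime a b" "a \<le> M ^ 2" "b \<le> M" by blast+
  thus ?thesis
  proof (rule that)
    fix p assume "prime p" "p dvd M"
    hence "p \<in> P" using memP by blast
    thus "[a = u p] (mod p) \<and> [b = v p] (mod p)"
      using a(2)[rule_format, of p] b(3) by (auto simp: Q_def)
  qed
qed


lemma slope_le:
  fixes u v B :: nat
  assumes "u \<le> B" "v \<le> B" "B \<ge> 1" "l \<ge> 1"
  shows "slope l u v \<le> l * B ^ l"
proof -
  have "slope l u v \<le> (\<Sum>i<l. B ^ (l - 1))"
    unfolding slope_def
  proof (intro sum_mono)
    fix i assume "i \<in> {..<l}"
    hence "B ^ (l - 1) = B ^ (l - Suc i) * B ^ i" by (simp flip: power_add)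
    thus "v ^ (l - Suc i) * u ^ i \<le> B ^ (l - 1)"
      using assms by (simp add: mult_mono power_mono)
  qed
  also have "\<dots> \<le> l * B ^ l"
    using assms by (simp add: power_increasing)
  finally show ?thesis .
qed

text \<open>Two slopes fix the residue modulo each prime of M. A third one corrects it from the
  product R of these primes to M itself.\<close>

lemma residue_class_meets_split_numbers:
  fixes l M \<tau> :: nat
  assumes l: "prime l" and M: "M > 0" and lM: "l dvd M" and \<tau>: "Rings.coprime \<tau> M"
    and small: "\<And>p. prime p \<Longrightarrow> p dvd M \<Longrightarrow> p \<le> 6 * l \<Longrightarrow> [\<tau> = 1] (mod p)"
  obtains m where "[m = \<tau>] (mod M)" "m > 0" "m \<le> (l * M ^ (2 * l)) ^ 3"
    "\<And>q. prime q \<Longrightarrow> q dvd m \<Longrightarrow> [q = 1] (mod l)"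
proof -
  have l2: "l \<ge> 2" using l prime_ge_2_nat by blast
  define R where "R = \<Prod>(prime_factors M)"
  have R: "R dvd M" unfolding R_def by (rule prod_prime_factors_dvd[OF M])
  have pR: "p dvd R" if "prime p" "p dvd M" for p
    unfolding R_def using that M by (intro dvd_prodI) (auto simp: prime_factors_dvd)
  have unit: "\<not> p dvd \<tau>" if "prime p" "p dvd M" for p
    using that \<tau> by (metis coprime_common_divisor not_prime_unit)
  have "\<exists>u v u' v'. [slope l u v * slope l u' v' = \<tau>] (mod p)" if "prime p" "p dvd M" for p
    using product_of_two_slopes[OF that(1) l2 unit[OF that]] small[OF that] by blast
  then obtain u v u' v' where s:
    "[slope l (u p) (v p) * slope l (u' p) (v' p) = \<tau>] (mod p)" if "prime p" "p dvd M" for p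
    by metis
  have nz: "\<not> p dvd slope l (u p) (v p)" "\<not> p dvd slope l (u' p) (v' p)" if "prime p" "p dvd M" for p
    using unit[OF that] cong_dvd_iff[OF s[OF that]] by auto
  have nz0: "\<not> p dvd slope l x y \<Longrightarrow> \<not> p dvd x \<or> \<not> p dvd y" for p x y :: nat
  proof (rule ccontr)
    assume *: "\<not> p dvd slope l x y" "\<not> (\<not> p dvd x \<or> \<not> p dvd y)"
    hence "[slope l x y = slope l 0 0] (mod p)" by (intro cong_slope) (auto simp: cong_0_iff)
    moreover have "slope l 0 0 = (0 :: nat)" using l2 by (simp add: slope_0_right)
    ultimately show False using * by (simp add: cong_0_iff)
  qed
  obtain a b where ab: "Rings.coprime a b" "a \<le> M ^ 2" "b \<le> M"
    "\<And>p. prime p \<Longrightarrow> p dvd M \<Longrightarrow> [a = u p] (mod p) \<and> [b = v p] (mod p)"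
    using coprime_lift[OF M, of u v] nz nz0 by blast
  obtain a' b' where ab': "Rings.coprime a' b'" "a' \<le> M ^ 2" "b' \<le> M"
    "\<And>p. prime p \<Longrightarrow> p dvd M \<Longrightarrow> [a' = u' p] (mod p) \<and> [b' = v' p] (mod p)"
    using coprime_lift[OF M, of u' v'] nz nz0 by blast
  define S where "S = slope l a b * slope l a' b'"
  have S: "[S = \<tau>] (mod p)" if "prime p" "p dvd M" for p
  proof -
    have "[S = slope l (u p) (v p) * slope l (u' p) (v' p)] (mod p)"
      unfolding S_def using ab(4)[OF that] ab'(4)[OF that] by (intro cong_mult cong_slope) auto
    thus ?thesis using s[OF that] cong_trans by blast
  qed
  have "Rings.coprime S M"
  proof (rule coprime_natI)
    fix p assume p: "prime p" "p dvd S" "p dvd M"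
    thus False using unit cong_dvd_iff[OF S] by blast
  qed
  from cong_solve_coprime_nat[OF this] obtain w where w: "[S * w = 1] (mod M)" by auto
  \<comment> \<open>The missing factor \<open>w * \<tau>\<close> is already 1 modulo the radical, so
    one value \<open>slope l y 1\<close> can supply it modulo M.\<close>
  have "[w * \<tau> = 1] (mod R)"
  proof -
    have "[w * \<tau> = 1] (mod p)" if "p \<in> prime_factors M" for p
    proof -
      have p: "prime p" "p dvd M" using that by (auto simp: prime_factors_dvd M)
      have "[w * \<tau> = w * S] (mod p)" by (intro cong_mult cong_refl cong_sym[OF S[OF p]])
      moreover have "[w * S = 1] (mod p)" using cong_dvd_modulus_nat[OF w p(2)] by (simp add: mult.commute)
      ultimately show ?thesis using cong_trans by blast
    qed
    thus ?thesis unfolding R_def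
      by (intro coprime_cong_prod_nat) (auto intro: primes_coprime)
  qed
  from slope_hits_unit_residue[OF M R pR l2 this]
  obtain y where y: "y < M" "[slope l y 1 = w * \<tau>] (mod M)" by blast
  define m where "m = S * slope l y 1"
  have "[m = S * (w * \<tau>)] (mod M)" unfolding m_def by (intro cong_mult cong_refl y)
  also have "S * (w * \<tau>) = (S * w) * \<tau>" by simp
  also have "[(S * w) * \<tau> = 1 * \<tau>] (mod M)" by (intro cong_mult cong_refl w)
  finally have m\<tau>: "[m = \<tau>] (mod M)" by simp
  \<comment> \<open>A slope may be divisible by l; since \<open>l dvd M\<close> and \<tau> is a unit
    modulo M, this exceptional prime cannot occur.\<close>
  have "\<not> l dvd m"
    using unit[OF l lM] cong_dvd_iff[OF cong_dvd_modulus_nat[OF m\<tau> lM]] by blast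
  hence m0: "m > 0" and ml: "\<And>q. prime q \<Longrightarrow> q dvd m \<Longrightarrow> q \<noteq> l" by (auto intro: Nat.gr0I)
  have le1: "M \<le> M ^ 2" using M by (simp add: power2_eq_square)
  have M2: "1 \<le> M ^ 2" using M by simp
  have e: "(M ^ 2) ^ l = M ^ (2 * l)" by (simp add: power_mult)
  have "slope l a b \<le> l * M ^ (2 * l)"
    using slope_le[of a "M ^ 2" b l] ab le1 M2 l2 e by simp
  moreover have "slope l a' b' \<le> l * M ^ (2 * l)"
    using slope_le[of a' "M ^ 2" b' l] ab' le1 M2 l2 e by simp
  moreover have "slope l y 1 \<le> l * M ^ (2 * l)"
    using slope_le[of y "M ^ 2" 1 l] y le1 M2 l2 e by simp
  ultimately have "m \<le> (l * M ^ (2 * l)) ^ 3"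
    unfolding m_def S_def power3_eq_cube by (intro mult_mono) auto
  moreover have "[q = 1] (mod l)" if q: "prime q" "q dvd m" for q
  proof -
    have "q dvd slope l a b \<or> q dvd slope l a' b' \<or> q dvd slope l y 1"
      using q by (auto simp: m_def S_def prime_dvd_mult_iff)
    moreover have "Rings.coprime y 1" by simp
    ultimately show ?thesis
      using prime_dvd_slope_cong_1[OF q(1) l ml[OF q]] ab(1) ab'(1) by blast
  qed
  ultimately show ?thesis using that m\<tau> m0 by blast
qed

section \<open>Polynomials modulo split factors\<close>

text \<open>Raising to a power of q keeps the class modulo q but removes the q-part of the order
  modulo a higher power of q. This is the Teichmueller lift used for roots modulo prime powers and
  for the residue modulo a power of l.\<close>

lemma cong_pow_prime_power:
  fixes a q :: nat
  assumes "prime q"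
  shows "[a ^ (q ^ e) = a] (mod q)"
proof (induction e)
  case (Suc e)
  have *: "[a ^ q = a] (mod q)" for a :: nat
  proof (cases "q dvd a")
    case True
    moreover have "q dvd a ^ q" using True assms by (simp add: dvd_power_le prime_gt_0_nat dvd_trans[OF True dvd_power])
    ultimately show ?thesis by (simp add: cong_def dvd_eq_mod_eq_0)
  next
    case False
    have "[a * a ^ (q - 1) = a * 1] (mod q)" by (intro cong_mult cong_refl fermat_theorem assms False)
    thus ?thesis using prime_gt_0_nat[OF assms] by (simp flip: power_Suc)
  qed
  have "[(a ^ (q ^ e)) ^ q = a ^ (q ^ e)] (mod q)" by (rule *)
  thus ?case using Suc by (simp add: power_mult[symmetric] mult.commute) (metis cong_trans)
qed simp

lemma cong_power_eq_self:
  fixes a m k n :: nat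
  assumes "[a ^ k = 1] (mod m)" "[n = 1] (mod k)" "n > 0"
  shows "[a ^ n = a] (mod m)"
proof -
  have "k dvd n - 1" using assms by (simp add: cong_altdef_nat)
  then obtain t where "n - 1 = k * t" by (elim dvdE)
  hence "n = Suc (k * t)" using assms by simp
  hence "a ^ n = a * (a ^ k) ^ t" by (simp add: power_mult)
  moreover have "[a * (a ^ k) ^ t = a * 1 ^ t] (mod m)" by (intro cong_mult cong_refl cong_pow assms)
  ultimately show ?thesis by simp
qed

lemma cong_power_eq_selfD:
  fixes a q n :: nat
  assumes "[a ^ n = a] (mod q)" "Rings.coprime a q" "n > 0"
  shows "[a ^ (n - 1) = 1] (mod q)"
proof -
  have "[a * a ^ (n - 1) = a * 1] (mod q)" using assms by (simp flip: power_Suc)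
  thus ?thesis using cong_mult_lcancel_nat[OF assms(2)] by blast
qed

text \<open>The order of the Teichmueller lift of b divides q - 1, which suits q in T because n^d =
  1 modulo q - 1. For other q nothing is known about n modulo q - 1, so an element of order l is
  lifted instead; then n^d = 1 modulo l is enough.\<close>

lemma prime_power_root:
  fixes q l n d e :: nat
  assumes q: "prime q" and l: "prime l" and ql: "[q = 1] (mod l)" and n: "n > 0"
    and nd: "[n ^ d = 1] (mod l)" and ni: "\<And>i. 0 < i \<Longrightarrow> i < d \<Longrightarrow> \<not> [n ^ i = 1] (mod l)"
    and T: "q \<in> T \<Longrightarrow> [n ^ d = 1] (mod (q - 1)) \<and> \<not> q dvd b \<and> \<not> [b ^ ((q - 1) div l) = 1] (mod q)"
    and e: "e > 0"
  shows "\<exists>a. [a ^ (n ^ d) = a] (mod q ^ e) \<and> \<not> q dvd a \<and>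
    (\<forall>i. 0 < i \<and> i < d \<longrightarrow> \<not> [a ^ (n ^ i) = a] (mod q)) \<and> (q \<in> T \<longrightarrow> [a = b] (mod q))"
proof -
  define r where "r = (q - 1) div l"
  have q1: "q > 1" using q prime_gt_1_nat by blast
  have "l dvd q - 1" using ql q1 by (simp add: cong_altdef_nat)
  hence r: "q - 1 = l * r" by (simp add: r_def)
  have nn: "n ^ i > 0" for i using n by simp
  have lni: "\<not> l dvd n ^ i - 1" if "0 < i" "i < d" for i
    using ni[OF that] nn[of i] by (simp add: cong_altdef_nat)
  have euler: "[h ^ (q ^ (e - 1) * (q - 1)) = 1] (mod q ^ e)" if "\<not> q dvd h" for h
  proof -
    have "Rings.coprime h (q ^ e)"
      using that q prime_imp_coprime[OF q] algebraic_semidom_class.coprime_commute by auto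
    thus ?thesis using euler_theorem[of h "q ^ e"] totient_prime_power[OF q e] by simp
  qed
  \<comment> \<open>A fixed point would have order dividing n^i - 1, which is prime to l. That order
    also divides l * k, hence k, contrary to a^k not being 1.\<close>
  have nofix: "\<not> [a ^ (n ^ i) = a] (mod q)"
    if i: "0 < i" "i < d" and a: "\<not> q dvd a" "[a ^ (l * k) = 1] (mod q)" "\<not> [a ^ k = 1] (mod q)" for i a k
  proof
    assume "[a ^ (n ^ i) = a] (mod q)"
    moreover have "Rings.coprime a q" using a prime_imp_coprime[OF q] algebraic_semidom_class.coprime_commute by blast
    ultimately have "[a ^ (n ^ i - 1) = 1] (mod q)" using nn by (rule cong_power_eq_selfD)
    hence 1: "ord q a dvd n ^ i - 1" by (simp only: ord_divides)
    have "ord q a dvd l * k" using a(2) by (simp only: ord_divides)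
    moreover have "Rings.coprime (ord q a) l"
      using 1 lni[OF i] prime_imp_coprime[OF l] dvd_trans algebraic_semidom_class.coprime_commute by metis
    ultimately have "ord q a dvd k" by (simp add: coprime_dvd_mult_right_iff)
    thus False using a(3) ord_divides by blast
  qed
  show ?thesis
  proof (cases "q \<in> T")
    case True
    define a where "a = b ^ (q ^ (e - 1))"
    note T = T[OF True]
    have ab: "[a = b] (mod q)" unfolding a_def by (rule cong_pow_prime_power[OF q])
    have "\<not> q dvd a" using T cong_dvd_iff[OF ab] by blast
    moreover have "[a ^ (q - 1) = 1] (mod q ^ e)"
      using euler[of b] T by (simp add: a_def power_mult)
    hence "[a ^ (n ^ d) = a] (mod q ^ e)" using T nn by (intro cong_power_eq_self) auto
    moreover have "\<not> [a ^ (n ^ i) = a] (mod q)" if "0 < i" "i < d" for i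
    proof (rule nofix[OF that])
      show "[a ^ (l * r) = 1] (mod q)" using fermat_theorem[OF q \<open>\<not> q dvd a\<close>] unfolding r .
      show "\<not> [a ^ r = 1] (mod q)"
        using T cong_pow[OF ab, of r] unfolding r_def by (meson cong_sym cong_trans)
    qed fact
    ultimately show ?thesis using ab by blast
  next
    case False
    obtain g where g: "residue_primroot q g" using prime_primitive_root_exists[OF _ q] q1 by auto
    have cop: "Rings.coprime q g" and ord: "ord q g = q - 1"
      using g q by (auto simp: residue_primroot_def totient_prime)
    have gq: "\<not> q dvd g" using cop q by (metis coprime_common_divisor dvd_refl not_prime_unit)
    have gr: "\<not> [g ^ r = 1] (mod q)"
      using ord_minimal[of r q g] ord r q1 prime_gt_1_nat[OF l] by (cases "r = 0") auto
    define a where "a = (g ^ r) ^ (q ^ (e - 1))"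
    have ag: "[a = g ^ r] (mod q)" unfolding a_def by (rule cong_pow_prime_power[OF q])
    have "\<not> q dvd g ^ r" using gq q prime_dvd_power by blast
    hence qa: "\<not> q dvd a" using cong_dvd_iff[OF ag] by blast
    moreover have al: "[a ^ l = 1] (mod q ^ e)"
    proof -
      have "a ^ l = g ^ (q ^ (e - 1) * (q - 1))"
        unfolding a_def r by (simp add: mult_ac flip: power_mult)
      thus ?thesis using euler[OF gq] by simp
    qed
    hence "[a ^ (n ^ d) = a] (mod q ^ e)" using nd nn by (intro cong_power_eq_self) auto
    moreover have "\<not> [a ^ (n ^ i) = a] (mod q)" if "0 < i" "i < d" for i
    proof (rule nofix[OF that])
      show "[a ^ (l * 1) = 1] (mod q)" using cong_dvd_modulus_nat[OF al, of q] e by simp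
      show "\<not> [a ^ 1 = 1] (mod q)" using ag gr by (metis cong_sym cong_trans power_one_right)
    qed fact
    ultimately show ?thesis using False by blast
  qed
qed

lemma split_root:
  fixes n1 l n d :: nat and T :: "nat set"
  assumes n1: "n1 > 0" and l: "prime l" and ql: "\<And>q. prime q \<Longrightarrow> q dvd n1 \<Longrightarrow> [q = 1] (mod l)" and n: "n > 0"
    and nd: "[n ^ d = 1] (mod l)" and ni: "\<And>i. 0 < i \<Longrightarrow> i < d \<Longrightarrow> \<not> [n ^ i = 1] (mod l)"
    and T: "\<And>q. q \<in> T \<Longrightarrow> [n ^ d = 1] (mod (q - 1)) \<and> \<not> q dvd b \<and> \<not> [b ^ ((q - 1) div l) = 1] (mod q)"
    and T': "\<And>q. q \<in> T \<Longrightarrow> prime q \<and> q dvd n1"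
  obtains a where "[a ^ (n ^ d) = a] (mod n1)" "\<And>q. prime q \<Longrightarrow> q dvd n1 \<Longrightarrow> \<not> q dvd a"
    "\<And>q i. prime q \<Longrightarrow> q dvd n1 \<Longrightarrow> 0 < i \<Longrightarrow> i < d \<Longrightarrow> \<not> [a ^ (n ^ i) = a] (mod q)"
    "\<And>q. q \<in> T \<Longrightarrow> [a = b] (mod q)"
proof -
  define P where "P = prime_factors n1"
  define e where "e = (\<lambda>q. multiplicity q n1)"
  have P: "finite P" "q \<in> P \<longleftrightarrow> prime q \<and> q dvd n1" for q
    using n1 by (auto simp: P_def prime_factors_dvd)
  have eP: "e q > 0" if "q \<in> P" for q
    using that by (auto simp: P_def e_def prime_factors_multiplicity)
  have "\<forall>q\<in>P. \<exists>a. [a ^ (n ^ d) = a] (mod q ^ e q) \<and> \<not> q dvd a \<and>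
    (\<forall>i. 0 < i \<and> i < d \<longrightarrow> \<not> [a ^ (n ^ i) = a] (mod q)) \<and> (q \<in> T \<longrightarrow> [a = b] (mod q))"
    using P by (intro ballI prime_power_root[OF _ l ql n nd ni T eP]) auto
  from bchoice[OF this] obtain c where c: "\<forall>q\<in>P. [c q ^ (n ^ d) = c q] (mod q ^ e q) \<and> \<not> q dvd c q \<and>
    (\<forall>i. 0 < i \<and> i < d \<longrightarrow> \<not> [c q ^ (n ^ i) = c q] (mod q)) \<and> (q \<in> T \<longrightarrow> [c q = b] (mod q))"
    ..
  have cop: "\<forall>i\<in>P. \<forall>j\<in>P. i \<noteq> j \<longrightarrow> Rings.coprime (i ^ e i) (j ^ e j)"
  proof (intro ballI impI)
    fix i j assume "i \<in> P" "j \<in> P" "i \<noteq> j"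
    hence "Rings.coprime i j" using P by (intro primes_coprime) auto
    thus "Rings.coprime (i ^ e i) (j ^ e j)" by simp
  qed
  obtain x where x: "\<forall>q\<in>P. [x = c q] (mod q ^ e q)"
    using chinese_remainder_nat[OF P(1) cop] by blast
  have xq: "[x = c q] (mod q)" if "q \<in> P" for q
    using x that eP[OF that] by (meson cong_dvd_modulus_nat dvd_power)
  have prod: "n1 = (\<Prod>q\<in>P. q ^ e q)"
    using n1 unfolding P_def e_def by (simp add: prime_factorization_nat[symmetric])
  have "[x ^ (n ^ d) = x] (mod q ^ e q)" if "q \<in> P" for q
    using x c that cong_pow[of x "c q" "q ^ e q" "n ^ d"] by (meson cong_sym cong_trans)
  hence "[x ^ (n ^ d) = x] (mod n1)"
    unfolding prod using cop by (intro coprime_cong_prod_nat) auto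
  moreover have "\<not> q dvd x" if "prime q" "q dvd n1" for q
    using that c P cong_dvd_iff[OF xq[of q]] by blast
  moreover have "\<not> [x ^ (n ^ i) = x] (mod q)" if "prime q" "q dvd n1" "0 < i" "i < d" for q i
    using that c P xq[of q] cong_pow[OF xq[of q], of "n ^ i"] by (meson cong_sym cong_trans)
  moreover have "[x = b] (mod q)" if "q \<in> T" for q
  proof -
    have "q \<in> P" using T'[OF that] P by blast
    thus ?thesis using cong_trans[OF xq] c that by blast
  qed
  ultimately show ?thesis by (rule that[of x])
qed

text \<open>All roots lie in Z/n1, so the discriminant is the square of an integer modulo n1 and
  every Legendre symbol is 1. The last conclusion recovers b modulo p up to the power orbit from f
  alone; the injectivity of the final count rests on it.\<close>

lemma split_factor:
  fixes n1 l n d b :: nat and T :: "nat set"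
  assumes n1: "n1 > 0" and l: "prime l" and ql: "\<And>q. prime q \<Longrightarrow> q dvd n1 \<Longrightarrow> [q = 1] (mod l)" and n: "n > 0"
    and d: "d \<ge> 1"
    and nd: "[n ^ d = 1] (mod l)" and ni: "\<And>i. 0 < i \<Longrightarrow> i < d \<Longrightarrow> \<not> [n ^ i = 1] (mod l)"
    and T: "\<And>q. q \<in> T \<Longrightarrow> [n ^ d = 1] (mod (q - 1)) \<and> \<not> q dvd b \<and> \<not> [b ^ ((q - 1) div l) = 1] (mod q)"
    and T': "\<And>q. q \<in> T \<Longrightarrow> prime q \<and> q dvd n1"
  obtains f where "cyclic_mod n d (int n1) f" "jacobi_symbol (discriminant f) n1 = 1"
    "\<And>p. p \<in> T \<Longrightarrow> int p dvd poly f (int b)"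
    "\<And>p x. p \<in> T \<Longrightarrow> int p dvd poly f (int x) \<Longrightarrow> \<exists>j<d. [x = b ^ (n ^ j)] (mod p)"
proof -
  obtain a where a: "[a ^ (n ^ d) = a] (mod n1)" "\<And>q. prime q \<Longrightarrow> q dvd n1 \<Longrightarrow> \<not> q dvd a"
    "\<And>q i. prime q \<Longrightarrow> q dvd n1 \<Longrightarrow> 0 < i \<Longrightarrow> i < d \<Longrightarrow> \<not> [a ^ (n ^ i) = a] (mod q)"
    "\<And>q. q \<in> T \<Longrightarrow> [a = b] (mod q)"
    using split_root[OF n1 l ql n nd ni T T'] by blast
  define \<rho> where "\<rho> = (\<lambda>j. int a ^ (n ^ j))"
  define J where "J = {x. int n1 dvd x}"
  have period: "[a ^ (n ^ (j + d)) = a ^ (n ^ j)] (mod n1)" for j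
    using cong_pow[OF a(1), of "n ^ j"] by (simp add: power_add mult.commute flip: power_mult)
  have diff: "\<not> int q dvd \<rho> i - \<rho> j" if q: "prime q" "q dvd n1" and ij: "i < j" "j < d" for q i j
  proof
    assume "int q dvd \<rho> i - \<rho> j"
    hence "[int (a ^ (n ^ i)) = int (a ^ (n ^ j))] (mod int q)" by (simp add: \<rho>_def cong_iff_dvd_diff)
    hence "[a ^ (n ^ i) = a ^ (n ^ j)] (mod q)" by (simp only: cong_int_iff)
    \<comment> \<open>The power \<open>n ^ (d - i)\<close> rotates the coincidence of two roots into
      a point fixed by the power \<open>n ^ (j - i)\<close>.\<close>
    from cong_pow[OF this, of "n ^ (d - i)"]
    have "[a ^ (n ^ (i + (d - i))) = a ^ (n ^ (j + (d - i)))] (mod q)"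
      by (simp only: power_mult[symmetric] power_add[symmetric])
    hence "[a ^ (n ^ d) = a ^ (n ^ ((j - i) + d))] (mod q)" using ij by simp
    moreover have "[a ^ (n ^ ((j - i) + d)) = a ^ (n ^ (j - i))] (mod q)"
      by (rule cong_dvd_modulus_nat[OF period q(2)])
    moreover have "[a ^ (n ^ d) = a] (mod q)" by (rule cong_dvd_modulus_nat[OF a(1) q(2)])
    ultimately have "[a ^ (n ^ (j - i)) = a] (mod q)" by (meson cong_sym cong_trans)
    thus False using a(3)[OF q, of "j - i"] ij by simp
  qed
  have unit: "\<exists>v. x * v - 1 \<in> J" if "\<And>q. prime q \<Longrightarrow> q dvd n1 \<Longrightarrow> \<not> int q dvd x" for x :: int
  proof -
    have "Rings.coprime (nat \<bar>x\<bar>) n1"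
      using that by (intro coprime_natI) (metis int_dvd_int_iff dvd_abs_iff nat_abs_dvd_iff nat_0_le abs_ge_zero int_nat_eq)
    hence "Rings.coprime x (int n1)" by (metis coprime_int_iff int_nat_eq abs_ge_zero coprime_abs_left_iff)
    from cong_solve_coprime_int[OF this] show ?thesis by (auto simp: J_def cong_iff_dvd_diff)
  qed
  interpret frobenius_roots J "int n1" n d \<rho>
  proof
    show "ring_ideal J" by (auto simp: ring_ideal_def J_def)
    show "of_int x \<in> J \<longleftrightarrow> int n1 dvd x" for x by (simp add: J_def)
    show "\<rho> j ^ n - \<rho> (Suc j) \<in> J" for j by (simp add: J_def \<rho>_def mult.commute flip: power_mult)
    have "[int (a ^ (n ^ (j + d))) = int (a ^ (n ^ j))] (mod int n1)" for j
      using period by (simp only: cong_int_iff)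
    thus "\<rho> (j + d) - \<rho> j \<in> J" for j by (simp add: J_def \<rho>_def cong_iff_dvd_diff)
    show "\<exists>v. (\<rho> i - \<rho> j) * v - 1 \<in> J" if ij: "i < d" "j < d" "i \<noteq> j" for i j
    proof (rule unit)
      fix q assume q: "prime q" "q dvd n1"
      show "\<not> int q dvd \<rho> i - \<rho> j"
        using diff[OF q, of i j] diff[OF q, of j i] ij by (metis dvd_diff_commute linorder_neqE_nat)
    qed
    show "\<exists>v. \<rho> j * v - 1 \<in> J" for j
    proof (rule unit)
      fix q assume q: "prime q" "q dvd n1"
      show "\<not> int q dvd \<rho> j"
      proof
        assume "int q dvd \<rho> j"
        hence "q dvd a ^ (n ^ j)" by (simp add: \<rho>_def flip: of_nat_power)
        thus False using a(2)[OF q] q prime_dvd_power by blast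
      qed
    qed
    show "\<exists>c. of_int c - coeff (\<Prod>j<d. [:- \<rho> j, 1:]) k \<in> J" for k
      by (intro exI[of _ "coeff (\<Prod>j<d. [:- \<rho> j, 1:]) k"]) (simp add: J_def)
  qed (use n1 d in auto)
  obtain f where f: "cyclic_mod n d (int n1) f"
    "\<And>k. of_int (coeff f k) - coeff (\<Prod>j<d. [:- \<rho> j, 1:]) k \<in> J"
    "of_int (discriminant f) - (\<Prod>j<d. \<Prod>i<j. (\<rho> i - \<rho> j)\<^sup>2) \<in> J"
    using exists_cyclic_mod by blast
  have "jacobi_symbol (discriminant f) n1 = 1"
    unfolding jacobi_symbol_def
  proof (intro prod_mset.neutral ballI)
    fix s assume "s \<in># image_mset (\<lambda>p. Legendre (discriminant f) (int p)) (prime_factorization n1)"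
    then obtain q where q: "prime q" "q dvd n1" "s = Legendre (discriminant f) (int q)"
      by (auto simp: in_prime_factors_iff)
    have "int n1 dvd discriminant f - (\<Prod>j<d. \<Prod>i<j. (\<rho> i - \<rho> j)\<^sup>2)" using f(3) by (simp add: J_def)
    hence "int q dvd discriminant f - (\<Prod>j<d. \<Prod>i<j. \<rho> i - \<rho> j)\<^sup>2"
      using q(2) by (simp add: prod_power_distrib dvd_trans[of "int q" "int n1"])
    hence "QuadRes (int q) (discriminant f)"
      unfolding QuadRes_def by (metis cong_iff_dvd_diff cong_sym)
    moreover have "\<not> [discriminant f = 0] (mod int q)"
    proof
      assume "[discriminant f = 0] (mod int q)"
      hence "int q dvd poly f 0 * discriminant f" by (simp add: cong_0_iff)
      moreover have "int q dvd int n1" using q by simp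
      ultimately have "is_unit (int q)" using f(1) coprime_common_divisor unfolding cyclic_mod_def by blast
      thus False using q(1) by auto
    qed
    ultimately show "s = 1" using q(3) by (simp add: Legendre_def)
  qed
  have polyf: "int p dvd poly f x - (\<Prod>j<d. x - int b ^ (n ^ j))" if p: "p \<in> T" for p x
  proof -
    have Jp: "ring_ideal {x. int p dvd x}" by (auto simp: ring_ideal_def)
    have pn: "int p dvd int n1" using T'[OF p] by simp
    have "int n1 dvd coeff f k - coeff (\<Prod>j<d. [:- \<rho> j, 1:]) k" for k
      using f(2)[of k] unfolding J_def mem_Collect_eq by (simp only: of_int_eq_id id_apply)
    hence 1: "poly f x - poly (\<Prod>j<d. [:- \<rho> j, 1:]) x \<in> {x. int p dvd x}"
      by (intro ring_ideal_poly_coeff_diff[OF Jp]) (blast intro: dvd_trans[OF pn])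
    have 2: "poly (\<Prod>j<d. [:- \<rho> j, 1:]) x = (\<Prod>j<d. x - \<rho> j)" by (simp add: poly_prod)
    have "(\<Prod>j<d. x - \<rho> j) - (\<Prod>j<d. x - int b ^ (n ^ j)) \<in> {x. int p dvd x}"
    proof (rule ring_ideal_prod_diff[OF Jp])
      fix j
      have "[b ^ (n ^ j) = a ^ (n ^ j)] (mod p)" using a(4)[OF p] by (intro cong_pow) (rule cong_sym)
      hence "[int (b ^ (n ^ j)) = int (a ^ (n ^ j))] (mod int p)" by (simp only: cong_int_iff)
      thus "(x - \<rho> j) - (x - int b ^ (n ^ j)) \<in> {x. int p dvd x}" by (simp add: \<rho>_def cong_iff_dvd_diff)
    qed
    from ring_idealD(2)[OF Jp 1 this] show ?thesis unfolding 2 by simp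
  qed
  have "int p dvd poly f (int b)" if p: "p \<in> T" for p
  proof -
    have "(\<Prod>j<d. int b - int b ^ (n ^ j)) = 0"
      using d by (auto intro!: prod_zero bexI[of _ 0])
    thus ?thesis using polyf[OF p, of "int b"] by (simp only: diff_0_right)
  qed
  moreover have "\<exists>j<d. [x = b ^ (n ^ j)] (mod p)" if p: "p \<in> T" "int p dvd poly f (int x)" for p x
  proof -
    have "int p dvd (\<Prod>j<d. int x - int b ^ (n ^ j))"
      using polyf[OF p(1), of "int x"] p(2) by (metis dvd_diff_right_iff dvd_diffD1 diff_diff_eq2 dvd_diff_commute)
    moreover have "prime (int p)" using T'[OF p(1)] by simp
    ultimately obtain j where "j < d" "int p dvd int x - int b ^ (n ^ j)"
      by (auto simp: prime_dvd_prod_iff)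
    hence "[int x = int (b ^ (n ^ j))] (mod int p)" by (simp add: cong_iff_dvd_diff)
    hence "[x = b ^ (n ^ j)] (mod p)" by (simp only: cong_int_iff)
    thus ?thesis using \<open>j < d\<close> by blast
  qed
  ultimately show ?thesis
    by (rule that[OF f(1) \<open>jacobi_symbol (discriminant f) n1 = 1\<close>])
qed

section \<open>Polynomials modulo a norm from a subfield of the cyclotomic field\<close>

definition zeta :: "nat \<Rightarrow> complex" where
  "zeta l = exp (2 * of_real pi * \<i> / of_nat l)"

lemma zeta_power: "zeta l ^ k = exp (2 * of_real pi * \<i> * of_nat k / of_nat l)"
  by (simp add: zeta_def exp_of_nat_mult[symmetric] mult_ac)

lemma zeta_power_eq_iff: "l > 0 \<Longrightarrow> zeta l ^ j = zeta l ^ k \<longleftrightarrow> [j = k] (mod l)"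
  unfolding zeta_power cong_def by (intro complex_root_unity_eq) simp

lemma zeta_power_eq_1_iff: "l > 0 \<Longrightarrow> zeta l ^ k = 1 \<longleftrightarrow> l dvd k"
  unfolding zeta_power by (intro complex_root_unity_eq_1) simp

lemma zeta_power_self [simp]: "l > 0 \<Longrightarrow> zeta l ^ l = 1"
  by (simp add: zeta_power_eq_1_iff)

lemma sum_zeta_power:
  assumes "l > 0"
  shows "(\<Sum>c<l. (zeta l ^ k) ^ c) = (if l dvd k then of_nat l else 0)"
proof (cases "l dvd k")
  case True
  hence "zeta l ^ k = 1" using assms by (simp add: zeta_power_eq_1_iff)
  thus ?thesis using True by simp
next
  case False
  hence "zeta l ^ k \<noteq> 1" using assms by (simp add: zeta_power_eq_1_iff)
  moreover have "(zeta l ^ k) ^ l = 1"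
    using assms by (simp add: zeta_power_eq_1_iff flip: power_mult)
  ultimately show ?thesis using False by (simp add: geometric_sum)
qed

text \<open>A conjugate family lists the values of one integer polynomial at all powers of a root of
  unity: it represents an element of the ring of cyclotomic integers together with its conjugates
  (and, at exponent \<open>0\<close>, its residue modulo the ramified prime).\<close>

definition conj_family :: "nat \<Rightarrow> (nat \<Rightarrow> complex) \<Rightarrow> bool" where
  "conj_family l \<phi> \<longleftrightarrow> (\<exists>P :: int poly. \<forall>c. \<phi> c = poly (map_poly of_int P) (zeta l ^ c))"

lemma conj_family_poly: "conj_family l (\<lambda>c. poly (map_poly of_int P) (zeta l ^ c))"
  unfolding conj_family_def by blast

lemma conj_family_of_int: "conj_family l (\<lambda>c. of_int a)"
  unfolding conj_family_def by (intro exI[of _ "monom a 0"]) (simp add: map_poly_monom poly_monom)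

lemma conj_family_zeta: "conj_family l (\<lambda>c. zeta l ^ (c * k))"
  unfolding conj_family_def
  by (intro exI[of _ "monom 1 k"]) (simp add: map_poly_monom poly_monom power_mult)

lemma conj_family_add:
  assumes "conj_family l \<phi>" "conj_family l \<psi>"
  shows "conj_family l (\<lambda>c. \<phi> c + \<psi> c)"
proof -
  obtain P Q where "\<forall>c. \<phi> c = poly (map_poly of_int P) (zeta l ^ c)" "\<forall>c. \<psi> c = poly (map_poly of_int Q) (zeta l ^ c)"
    using assms unfolding conj_family_def by blast
  thus ?thesis unfolding conj_family_def by (intro exI[of _ "P + Q"]) (simp add: hom_distribs)
qed

lemma conj_family_mult:
  assumes "conj_family l \<phi>" "conj_family l \<psi>"
  shows "conj_family l (\<lambda>c. \<phi> c * \<psi> c)"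
proof -
  obtain P Q where "\<forall>c. \<phi> c = poly (map_poly of_int P) (zeta l ^ c)" "\<forall>c. \<psi> c = poly (map_poly of_int Q) (zeta l ^ c)"
    using assms unfolding conj_family_def by blast
  thus ?thesis unfolding conj_family_def by (intro exI[of _ "P * Q"]) (simp add: hom_distribs)
qed

lemma conj_family_scale:
  assumes "conj_family l \<phi>"
  shows "conj_family l (\<lambda>c. \<phi> (c * k))"
proof -
  obtain P where "\<forall>c. \<phi> c = poly (map_poly of_int P) (zeta l ^ c)"
    using assms unfolding conj_family_def by blast
  thus ?thesis unfolding conj_family_def
    by (intro exI[of _ "pcompose P (monom 1 k)"])
      (simp add: of_int_hom.map_poly_pcompose poly_pcompose map_poly_monom poly_monom power_mult)
qed

lemma conj_family_diff:
  assumes "conj_family l \<phi>" "conj_family l \<psi>"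
  shows "conj_family l (\<lambda>c. \<phi> c - \<psi> c)"
  using conj_family_add[OF assms(1) conj_family_mult[OF conj_family_of_int[of l "-1"] assms(2)]] by simp

lemma conj_family_sum:
  "(\<And>i. i \<in> A \<Longrightarrow> conj_family l (\<phi> i)) \<Longrightarrow> conj_family l (\<lambda>c. \<Sum>i\<in>A. \<phi> i c)"
proof (induction A rule: infinite_finite_induct)
  case (insert x A)
  thus ?case by (simp add: conj_family_add)
qed (use conj_family_of_int[of l 0] in auto)

lemma conj_family_prod:
  "(\<And>i. i \<in> A \<Longrightarrow> conj_family l (\<phi> i)) \<Longrightarrow> conj_family l (\<lambda>c. \<Prod>i\<in>A. \<phi> i c)"
proof (induction A rule: infinite_finite_induct)
  case (insert x A)
  thus ?case by (simp add: conj_family_mult)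
qed (use conj_family_of_int[of l 1] in auto)

lemma conj_family_cong:
  assumes "conj_family l \<phi>" "l > 0" "[c = c'] (mod l)"
  shows "\<phi> c = \<phi> c'"
proof -
  obtain P where P: "\<And>c. \<phi> c = poly (map_poly of_int P) (zeta l ^ c)"
    using assms(1) unfolding conj_family_def by blast
  thus ?thesis using zeta_power_eq_iff[OF assms(2)] assms(3) by metis
qed

text \<open>Fourier inversion: the coefficient sum over exponents congruent to \<open>1\<close> is \<open>(\<phi> 0 - \<alpha>) / l\<close>.\<close>

lemma conj_family_const_int:
  assumes l: "l > 1" and fam: "conj_family l \<phi>" and const: "\<And>c. \<not> l dvd c \<Longrightarrow> \<phi> c = \<alpha>"
  obtains k m :: int where "\<alpha> = of_int k" "\<phi> 0 = of_int m" "int l dvd k - m"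
proof -
  obtain P :: "int poly" where P: "\<And>c. \<phi> c = poly (map_poly of_int P) (zeta l ^ c)"
    using fam unfolding conj_family_def by blast
  define z where "z = zeta l"
  have zl: "z ^ l = 1" using l by (simp add: z_def)
  define K where "K = {k. k \<le> degree P \<and> l dvd k + (l - 1)}"
  define A where "A = (\<Sum>k\<in>K. coeff P k)"
  define m where "m = poly P 1"
  have fin: "finite K" by (rule finite_subset[of _ "{..degree P}"]) (auto simp: K_def)
  have m: "\<phi> 0 = of_int m" by (simp add: P m_def)
  have "(\<Sum>c<l. \<phi> c * (z ^ c) ^ (l - 1)) = (\<Sum>c<l. \<Sum>k\<le>degree P. of_int (coeff P k) * (z ^ (k + (l - 1))) ^ c)"
  proof (intro sum.cong refl)
    fix c
    have "\<phi> c = (\<Sum>k\<le>degree P. of_int (coeff P k) * (z ^ c) ^ k)"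
      by (simp add: P poly_altdef z_def)
    moreover have "(z ^ c) ^ k * (z ^ c) ^ (l - 1) = (z ^ (k + (l - 1))) ^ c" for k
      by (metis power_add power_mult mult.commute)
    ultimately show "\<phi> c * (z ^ c) ^ (l - 1) = (\<Sum>k\<le>degree P. of_int (coeff P k) * (z ^ (k + (l - 1))) ^ c)"
      by (simp add: sum_distrib_right mult.assoc)
  qed
  also have "\<dots> = (\<Sum>k\<le>degree P. of_int (coeff P k) * (\<Sum>c<l. (z ^ (k + (l - 1))) ^ c))"
    by (subst sum.swap) (simp add: sum_distrib_left)
  also have "\<dots> = (\<Sum>k\<le>degree P. if k \<in> K then of_nat l * of_int (coeff P k) else 0)"
    unfolding z_def using l by (intro sum.cong refl) (subst sum_zeta_power, auto simp: K_def)
  also have "\<dots> = (\<Sum>k\<in>K. of_nat l * of_int (coeff P k))"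
    by (rule sum.mono_neutral_cong_right) (auto simp: K_def)
  also have "\<dots> = of_int (int l * A)" by (simp add: A_def sum_distrib_left)
  finally have 1: "(\<Sum>c<l. \<phi> c * (z ^ c) ^ (l - 1)) = of_int (int l * A)" .
  have "{..<l} = insert 0 {1..<l}" using l by auto
  hence "(\<Sum>c<l. \<phi> c * (z ^ c) ^ (l - 1)) = \<phi> 0 + (\<Sum>c=1..<l. \<phi> c * (z ^ c) ^ (l - 1))" by simp
  also have "(\<Sum>c=1..<l. \<phi> c * (z ^ c) ^ (l - 1)) = (\<Sum>c=1..<l. \<alpha> * (z ^ c) ^ (l - 1))"
  proof (intro sum.cong refl)
    fix c assume "c \<in> {1..<l}"
    hence "\<not> l dvd c" by (auto dest: dvd_imp_le)
    thus "\<phi> c * (z ^ c) ^ (l - 1) = \<alpha> * (z ^ c) ^ (l - 1)" using const by simp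
  qed
  also have "\<dots> = \<alpha> * ((\<Sum>c<l. (z ^ (l - 1)) ^ c) - 1)"
    using \<open>{..<l} = insert 0 {1..<l}\<close> by (simp add: sum_distrib_left mult.commute flip: power_mult)
  also have "(\<Sum>c<l. (z ^ (l - 1)) ^ c) = 0"
    unfolding z_def using l by (subst sum_zeta_power) (auto dest: dvd_imp_le)
  finally have "\<alpha> = of_int (m - int l * A)" using 1 m by (simp add: algebra_simps)
  thus ?thesis using that[of "m - int l * A" m] m by simp
qed

section \<open>The fixed field of the automorphism given by \<open>b\<close>\<close>

lemma prod_shift_cyclic:
  fixes h :: "nat \<Rightarrow> 'a :: comm_monoid_mult"
  assumes "\<And>i. h (i + D) = h i"
  shows "(\<Prod>i<D. h (i + k)) = (\<Prod>i<D. h i)"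
proof (induction k)
  case (Suc k)
  show ?case
  proof (cases D)
    case (Suc D')
    have "(\<Prod>i<D. h (i + Suc k)) = (\<Prod>i<D'. h (Suc i + k)) * h (D' + Suc k)" by (simp add: Suc)
    also have "h (D' + Suc k) = h (0 + k)" using assms[of k] by (simp add: Suc add.commute)
    also have "(\<Prod>i<D'. h (Suc i + k)) * h (0 + k) = (\<Prod>i<D. h (i + k))"
      unfolding Suc by (subst prod.lessThan_Suc_shift) (simp add: mult.commute)
    finally show ?thesis using Suc.IH by simp
  qed simp
qed simp

lemma sum_shift_cyclic:
  fixes h :: "nat \<Rightarrow> 'a :: comm_monoid_add"
  assumes "\<And>i. h (i + D) = h i"
  shows "(\<Sum>i<D. h (i + 1)) = (\<Sum>i<D. h i)"
proof (cases D)
  case (Suc D')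
  have "(\<Sum>i<D. h (i + 1)) = (\<Sum>i<D'. h (Suc i)) + h (D' + 1)" by (simp add: Suc)
  also have "h (D' + 1) = h 0" using assms[of 0] by (simp add: Suc)
  finally show ?thesis unfolding Suc by (subst (2) sum.lessThan_Suc_shift) (simp add: add.commute)
qed simp

locale cyclotomic_subfield =
  fixes l d D g :: nat
  assumes l: "prime l" and dD: "d * D = l - 1" and g: "residue_primroot l g"
begin

definition b :: nat where "b = g ^ D"

lemma l1: "l > 1" using l prime_gt_1_nat by blast
lemma l0: "l > 0" using l1 by simp
lemma d_pos: "d > 0" and D_pos: "D > 0" using dD l1 by (auto intro: Nat.gr0I)

lemma coprime_l_g: "Rings.coprime l g" and ord_g: "ord l g = l - 1"
  using g l by (auto simp: residue_primroot_def totient_prime)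

lemma g_power_cong_iff: "[g ^ i = g ^ j] (mod l) \<longleftrightarrow> [i = j] (mod (l - 1))"
  using order_divides_expdiff[OF coprime_l_g] by (simp add: ord_g)

lemma not_dvd_g: "\<not> l dvd g"
  using coprime_l_g l by (metis coprime_common_divisor dvd_refl not_prime_unit)

lemma not_dvd_mult_g: "\<not> l dvd c \<Longrightarrow> \<not> l dvd c * g ^ i"
  using not_dvd_g l by (auto simp: prime_dvd_mult_iff dest: prime_dvd_power)

lemma g_generator:
  assumes "\<not> l dvd c"
  shows "\<exists>i. [c = g ^ i] (mod l)"
proof -
  have "c mod l \<in> totatives l"
  proof -
    have "c mod l \<noteq> 0" using assms by (simp add: dvd_eq_mod_eq_0)
    moreover have "c mod l < l" using l0 by simp
    ultimately show ?thesis using l by (simp add: totatives_prime)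
  qed
  hence "c mod l \<in> (\<lambda>i. g ^ i mod l) ` {..<totient l}"
    by (simp only: bij_betw_imp_surj_on[OF residue_primroot_is_generator[OF l1 g]])
  thus ?thesis by (auto simp: cong_def)
qed

lemma b_power: "b ^ j = g ^ (D * j)" by (simp add: b_def power_mult)

lemma b_period: "[b ^ (j + d) = b ^ j] (mod l)"
  unfolding b_power g_power_cong_iff dD[symmetric] by (simp add: cong_def algebra_simps)

lemma b_power_cong_iff: "[b ^ i = b ^ j] (mod l) \<longleftrightarrow> [i = j] (mod d)"
proof -
  have "[D * i = D * j] (mod (D * d)) \<longleftrightarrow> [i = j] (mod d)"
    using D_pos by (simp add: cong_def mult_mod_right[symmetric])
  thus ?thesis unfolding b_power g_power_cong_iff using dD by (simp add: mult.commute)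
qed

lemma not_dvd_mult_b: "\<not> l dvd c \<Longrightarrow> \<not> l dvd c * b ^ j"
  unfolding b_power by (rule not_dvd_mult_g)

lemma invariant_family_const:
  assumes fam: "conj_family l \<phi>" and inv: "\<And>c. \<not> l dvd c \<Longrightarrow> \<phi> (c * g) = \<phi> c" and c: "\<not> l dvd c"
  shows "\<phi> c = \<phi> 1"
proof -
  have "\<phi> (g ^ i) = \<phi> 1" for i
  proof (induction i)
    case (Suc i)
    have "\<not> l dvd g ^ i" using not_dvd_mult_g[of 1 i] l1 by simp
    from inv[OF this] show ?case using Suc by (simp add: mult.commute)
  qed simp
  thus ?thesis using g_generator[OF c] conj_family_cong[OF fam l0] by metis
qed

text \<open>Invariance under the generator g leaves one common value at all conjugates, which must
  be an integer. The comparison with exponent 0, where a family is easy to evaluate, is how norms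
  are computed modulo l.\<close>

lemma invariant_family_int:
  assumes fam: "conj_family l \<phi>" and inv: "\<And>c. \<not> l dvd c \<Longrightarrow> \<phi> (c * g) = \<phi> c"
  obtains k m :: int where "\<And>c. \<not> l dvd c \<Longrightarrow> \<phi> c = of_int k" "\<phi> 0 = of_int m" "int l dvd k - m"
proof -
  have "\<phi> c = \<phi> 1" if "\<not> l dvd c" for c using invariant_family_const[OF fam inv that] .
  from conj_family_const_int[OF l1 fam this] obtain k m
    where "\<phi> 1 = of_int k" "\<phi> 0 = of_int m" "int l dvd k - m" by metis
  thus ?thesis using that[of k m] invariant_family_const[OF fam inv] by simp
qed

text \<open>Divisibility of integers descends from the cyclotomic integers: the quotient is constant
  along its conjugates and thus an integer.\<close>

lemma family_int_eq:
  fixes x y :: int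
  assumes "conj_family l \<phi>" "\<And>c. \<not> l dvd c \<Longrightarrow> of_int x = of_int y * \<phi> c" "y \<noteq> 0"
  shows "y dvd x"
proof -
  have "\<phi> c = of_int x / of_int y" if "\<not> l dvd c" for c using assms(2)[OF that] assms(3) by simp
  from conj_family_const_int[OF l1 assms(1) this] obtain k where "of_int x / of_int y = (of_int k :: complex)" by metis
  hence "(of_int x :: complex) = of_int (y * k)" using assms(3) by (simp add: field_simps)
  hence "x = y * k" by (simp only: of_int_eq_iff)
  thus ?thesis by simp
qed

lemma zeta_b_period: "zeta l ^ (c * b ^ (j + d)) = zeta l ^ (c * b ^ j)"
  unfolding zeta_power_eq_iff[OF l0] by (intro cong_mult cong_refl b_period)

text \<open>The conjugates of an element that generates the fixed field of the automorphism \<open>\<zeta> \<mapsto> \<zeta> ^ b\<close>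
  for all but finitely many \<open>t\<close>: it is the norm of \<open>t - \<zeta>\<close> to that field.\<close>

definition th :: "int \<Rightarrow> nat \<Rightarrow> complex" where
  "th t c = (\<Prod>j<d. of_int t - zeta l ^ (c * b ^ j))"

lemma th_family: "conj_family l (th t)"
  unfolding th_def
  by (intro conj_family_prod conj_family_diff conj_family_of_int conj_family_zeta)

lemma th_mult_b: "th t (c * b) = th t c"
  using prod_shift_cyclic[of "\<lambda>j. of_int t - zeta l ^ (c * b ^ j)" d 1] zeta_b_period[of c]
  by (simp add: th_def mult.assoc)

lemma th_period: "th t (c * g ^ (i + D)) = th t (c * g ^ i)"
  using th_mult_b[of t "c * g ^ i"] by (simp add: b_def power_add mult_ac)

text \<open>Up to sign the discriminant of the D conjugates of \<open>th\<close>. Pairs are indexed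
  by a start i and a nonzero cyclic shift k, which makes the invariance under g a cyclic shift of
  the outer product.\<close>

definition disc_family :: "int \<Rightarrow> nat \<Rightarrow> complex" where
  "disc_family t c = (\<Prod>i<D. \<Prod>k\<in>{1..<D}. th t (c * g ^ i) - th t (c * g ^ (i + k)))"

lemma disc_family_family: "conj_family l (disc_family t)"
  unfolding disc_family_def
  by (intro conj_family_prod conj_family_diff conj_family_scale[OF th_family])

lemma shift_family:
  assumes "\<And>c i. \<phi> (c * g ^ (i + D)) = (\<phi> (c * g ^ i) :: complex)"
  shows "(\<Prod>i<D. \<phi> ((c * g) * g ^ i)) = (\<Prod>i<D. \<phi> (c * g ^ i))"
  using prod_shift_cyclic[of "\<lambda>i. \<phi> (c * g ^ i)" D 1, OF assms] by (simp add: mult.assoc)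

lemma disc_family_invariant: "disc_family t (c * g) = disc_family t c"
proof -
  define \<phi> where "\<phi> = (\<lambda>c. \<Prod>k\<in>{1..<D}. th t c - th t (c * g ^ k))"
  have "\<phi> (c * g ^ (i + D)) = \<phi> (c * g ^ i)" for c i
  proof -
    have "th t (c * g ^ (i + D) * g ^ k) = th t (c * g ^ i * g ^ k)" for k
      using th_period[of t c "i + k"] by (simp add: power_add mult_ac)
    thus ?thesis unfolding \<phi>_def th_period by simp
  qed
  from shift_family[of \<phi>, OF this] show ?thesis
    by (simp add: \<phi>_def disc_family_def power_add mult.assoc)
qed

text \<open>Before t is inserted, the D conjugates are polynomials whose root sets are different
  cosets of the powers of b. They are pairwise distinct, so only finitely many t annihilate the
  product of their differences.\<close>

lemma disc_family_nonzero: "\<exists>t. disc_family t 1 \<noteq> 0"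
proof -
  define F where "F = (\<lambda>c. \<Prod>j<d. [:- (zeta l ^ (c * b ^ j)), 1:])"
  have F: "poly (F c) (of_int t) = th t c" for c t
    by (simp add: F_def th_def poly_prod)
  have neq: "F (g ^ i) \<noteq> F (g ^ (i + k))" if k: "k \<in> {1..<D}" for i k
  proof
    assume eq: "F (g ^ i) = F (g ^ (i + k))"
    have "poly (F (g ^ i)) (zeta l ^ (g ^ i)) = 0"
      unfolding F_def poly_prod using d_pos by (auto intro!: prod_zero bexI[of _ 0])
    hence "poly (F (g ^ (i + k))) (zeta l ^ (g ^ i)) = 0" by (simp only: eq)
    then obtain j where j: "zeta l ^ (g ^ i) = zeta l ^ (g ^ (i + k) * b ^ j)"
      by (auto simp: F_def poly_prod)
    hence "[g ^ i = g ^ (i + k + D * j)] (mod l)"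
      by (simp only: zeta_power_eq_iff[OF l0] b_power power_add)
    hence "[i + 0 = i + (k + D * j)] (mod (l - 1))" by (simp only: g_power_cong_iff add.assoc add_0_right)
    hence "[0 = k + D * j] (mod (l - 1))" by (simp only: cong_add_lcancel_nat)
    hence "[0 = k + D * j] (mod D)" using dD by (metis cong_dvd_modulus_nat dvd_triv_right)
    hence "D dvd k" by (simp add: cong_def dvd_eq_mod_eq_0)
    thus False using k by (auto dest: dvd_imp_le)
  qed
  define R where "R = (\<Prod>i<D. \<Prod>k\<in>{1..<D}. F (g ^ i) - F (g ^ (i + k)))"
  have "R \<noteq> 0" unfolding R_def using neq by (auto simp: prod_zero_iff)
  hence "finite {x. poly R x = 0}" by (rule poly_roots_finite)
  moreover have "infinite (range (of_int :: int \<Rightarrow> complex))"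
    using infinite_UNIV_int by (simp add: finite_image_iff inj_on_def)
  ultimately obtain t where t: "poly R (of_int t) \<noteq> 0"
    by (metis (mono_tags, lifting) finite_subset image_subsetI mem_Collect_eq rangeE subsetI)
  have "poly R (of_int t) = disc_family t 1"
    by (simp add: R_def disc_family_def poly_prod F)
  thus ?thesis using t by metis
qed

end

section \<open>The element \<open>gam\<close>, its norm and its approximate idempotent\<close>

locale norm_form = cyclotomic_subfield +
  fixes t E0 M' u :: int
  assumes E0: "\<And>c. \<not> l dvd c \<Longrightarrow> disc_family t c = of_int E0"
begin

text \<open>The norm of \<open>gam\<close> is the first factor of the cofactor. With \<open>u = 1\<close> modulo \<open>M'\<close> it is
  \<open>1\<close> modulo \<open>M'\<close>, and its residue modulo \<open>l\<close> is controlled by \<open>u\<close>.\<close>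

definition gam :: "nat \<Rightarrow> complex" where "gam c = of_int u - of_int M' * th t c"

lemma gam_family: "conj_family l gam"
  unfolding gam_def
  by (intro conj_family_diff conj_family_mult conj_family_of_int th_family)

lemma gam_period: "gam (c * g ^ (i + D)) = gam (c * g ^ i)"
  by (simp only: gam_def th_period)

definition norm_family :: "nat \<Rightarrow> complex" where "norm_family c = (\<Prod>i<D. gam (c * g ^ i))"

lemma norm_family_family: "conj_family l norm_family"
  unfolding norm_family_def by (intro conj_family_prod conj_family_scale[OF gam_family])

lemma norm_family_invariant: "norm_family (c * g) = norm_family c"
  unfolding norm_family_def by (rule shift_family[OF gam_period])

text \<open>The element \<open>om\<close> is \<open>E\<close> modulo \<open>gam\<close> and \<open>0\<close> modulo the other conjugates of
  \<open>gam\<close>. As \<open>E\<close> is a unit modulo the norm, \<open>om\<close> serves as an idempotent that projects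
  to the residue ring of \<open>gam\<close>: traces of multiples of \<open>om\<close> yield integer representatives.\<close>

definition X :: "nat \<Rightarrow> complex" where
  "X c = (\<Prod>k\<in>{1..<D}. of_int M' * (th t c - th t (c * g ^ k)))"

definition E :: int where "E = M' ^ ((D - 1) * D) * E0"

definition om :: "nat \<Rightarrow> complex" where
  "om c = (\<Prod>i\<in>{1..<D}. X (c * g ^ i)) * (\<Prod>k\<in>{1..<D}. gam (c * g ^ k))"

lemma X_family: "conj_family l X"
  unfolding X_def
  by (intro conj_family_prod conj_family_diff conj_family_mult conj_family_of_int
      conj_family_scale[OF th_family] th_family)

lemma om_family: "conj_family l om"
  unfolding om_def
  by (intro conj_family_prod conj_family_mult conj_family_scale[OF X_family] conj_family_scale[OF gam_family])

lemma X_period: "X (c * g ^ (i + D)) = X (c * g ^ i)"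
proof -
  have "th t (c * g ^ (i + D) * g ^ k) = th t (c * g ^ i * g ^ k)" for k
    using th_period[of t c "i + k"] by (simp add: power_add mult_ac)
  thus ?thesis unfolding X_def th_period by simp
qed

lemma om_period: "om (c * g ^ (i + D)) = om (c * g ^ i)"
proof -
  have "gam (c * g ^ (i + D) * g ^ k) = gam (c * g ^ i * g ^ k)" for k
    using gam_period[of c "i + k"] by (simp add: power_add mult_ac)
  moreover have "X (c * g ^ (i + D) * g ^ k) = X (c * g ^ i * g ^ k)" for k
    using X_period[of c "i + k"] by (simp add: power_add mult_ac)
  ultimately show ?thesis unfolding om_def by simp
qed

lemma split_prod: "(\<Prod>i<D. h i) = h 0 * (\<Prod>i\<in>{1..<D}. h i)" for h :: "nat \<Rightarrow> complex"
proof -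
  have "{..<D} = insert 0 {1..<D}" using D_pos by auto
  thus ?thesis by simp
qed

lemma prod_X: "\<not> l dvd c \<Longrightarrow> (\<Prod>i<D. X (c * g ^ i)) = of_int E"
proof -
  assume c: "\<not> l dvd c"
  have "(\<Prod>i<D. X (c * g ^ i)) = of_int M' ^ ((D - 1) * D) * disc_family t c"
    by (simp add: X_def disc_family_def prod.distrib power_mult power_add mult.assoc)
  thus ?thesis using E0[OF c] by (simp add: E_def)
qed

lemma gam_om: "gam c * om c = norm_family c * (\<Prod>i\<in>{1..<D}. X (c * g ^ i))"
  unfolding norm_family_def om_def split_prod by simp

text \<open>Membership in the ideal generated by \<open>gam\<close> and \<open>N\<close>. Exponents divisible by \<open>l\<close>
  do not correspond to conjugates.\<close>

definition modulo :: "int \<Rightarrow> (nat \<Rightarrow> complex) \<Rightarrow> bool" where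
  "modulo N \<phi> \<longleftrightarrow> (\<exists>\<alpha> \<beta>. conj_family l \<alpha> \<and> conj_family l \<beta> \<and>
     (\<forall>c. \<not> l dvd c \<longrightarrow> \<phi> c = gam c * \<alpha> c + of_int N * \<beta> c))"

lemma modulo_0: "modulo N (\<lambda>c. 0)"
  unfolding modulo_def using conj_family_of_int[of l 0]
  by (intro exI[of _ "\<lambda>c. 0"]) auto

lemma modulo_add:
  assumes "modulo N \<phi>" "modulo N \<psi>"
  shows "modulo N (\<lambda>c. \<phi> c + \<psi> c)"
proof -
  obtain \<alpha> \<beta> \<alpha>' \<beta>' where *: "conj_family l \<alpha>" "conj_family l \<beta>" "conj_family l \<alpha>'" "conj_family l \<beta>'"
    "\<And>c. \<not> l dvd c \<Longrightarrow> \<phi> c = gam c * \<alpha> c + of_int N * \<beta> c"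
    "\<And>c. \<not> l dvd c \<Longrightarrow> \<psi> c = gam c * \<alpha>' c + of_int N * \<beta>' c"
    using assms unfolding modulo_def by blast
  have "conj_family l (\<lambda>c. \<alpha> c + \<alpha>' c)" "conj_family l (\<lambda>c. \<beta> c + \<beta>' c)"
    using * conj_family_add by auto
  moreover have "\<forall>c. \<not> l dvd c \<longrightarrow> \<phi> c + \<psi> c = gam c * (\<alpha> c + \<alpha>' c) + of_int N * (\<beta> c + \<beta>' c)"
    using * by (simp add: algebra_simps)
  ultimately show ?thesis unfolding modulo_def
    by (intro exI[of _ "\<lambda>c. \<alpha> c + \<alpha>' c"] exI[of _ "\<lambda>c. \<beta> c + \<beta>' c"] conjI)
qed

lemma modulo_mult:
  assumes "modulo N \<phi>" "conj_family l \<psi>"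
  shows "modulo N (\<lambda>c. \<psi> c * \<phi> c)"
proof -
  obtain \<alpha> \<beta> where *: "conj_family l \<alpha>" "conj_family l \<beta>"
    "\<And>c. \<not> l dvd c \<Longrightarrow> \<phi> c = gam c * \<alpha> c + of_int N * \<beta> c"
    using assms unfolding modulo_def by blast
  have "conj_family l (\<lambda>c. \<psi> c * \<alpha> c)" "conj_family l (\<lambda>c. \<psi> c * \<beta> c)"
    using * assms(2) conj_family_mult by auto
  moreover have "\<forall>c. \<not> l dvd c \<longrightarrow> \<psi> c * \<phi> c = gam c * (\<psi> c * \<alpha> c) + of_int N * (\<psi> c * \<beta> c)"
    using * by (simp add: algebra_simps)
  ultimately show ?thesis unfolding modulo_def
    by (intro exI[of _ "\<lambda>c. \<psi> c * \<alpha> c"] exI[of _ "\<lambda>c. \<psi> c * \<beta> c"] conjI)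
qed

lemma modulo_cong:
  assumes "modulo N \<phi>" "\<And>c. \<not> l dvd c \<Longrightarrow> \<phi> c = \<psi> c"
  shows "modulo N \<psi>"
  using assms unfolding modulo_def by simp

lemma modulo_diff: "modulo N \<phi> \<Longrightarrow> modulo N \<psi> \<Longrightarrow> modulo N (\<lambda>c. \<phi> c - \<psi> c)"
  using modulo_add[of N \<phi> "\<lambda>c. of_int (- 1) * \<psi> c"] modulo_mult[OF _ conj_family_of_int[of l "-1"], of N \<psi>]
  by simp

lemma modulo_gam: "conj_family l \<alpha> \<Longrightarrow> modulo N (\<lambda>c. gam c * \<alpha> c)"
  unfolding modulo_def using conj_family_of_int[of l 0] by (intro exI[of _ \<alpha>] exI[of _ "\<lambda>c. 0"]) auto

lemma modulo_N: "conj_family l \<beta> \<Longrightarrow> modulo N (\<lambda>c. of_int N * \<beta> c)"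
  unfolding modulo_def using conj_family_of_int[of l 0] by (intro exI[of _ "\<lambda>c. 0"] exI[of _ \<beta>]) auto

text \<open>Modulo \<open>gam c\<close> every other conjugate \<open>gam (c * g ^ k)\<close> equals \<open>M' * (th c - th (c * g ^ k))\<close>.\<close>

lemma om_eq: "\<exists>\<kappa>. conj_family l \<kappa> \<and> (\<forall>c. \<not> l dvd c \<longrightarrow> om c = of_int E + gam c * \<kappa> c)"
proof -
  have "\<exists>\<kappa>. conj_family l \<kappa> \<and> (\<forall>c. (\<Prod>k\<in>A. gam (c * g ^ k)) =
      (\<Prod>k\<in>A. of_int M' * (th t c - th t (c * g ^ k))) + gam c * \<kappa> c)" if "finite A" for A
    using that
  proof induction
    case empty
    show ?case using conj_family_of_int[of l 0] by (intro exI[of _ "\<lambda>c. 0"]) auto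
  next
    case (insert k A)
    define h where "h = (\<lambda>c. \<Prod>k\<in>A. gam (c * g ^ k))"
    define h' where "h' = (\<lambda>k c. of_int M' * (th t c - th t (c * g ^ k)))"
    obtain \<kappa> where \<kappa>: "conj_family l \<kappa>" "\<And>c. h c = (\<Prod>k\<in>A. h' k c) + gam c * \<kappa> c"
      using insert.IH by (auto simp: h_def h'_def)
    have "conj_family l h" unfolding h_def by (intro conj_family_prod conj_family_scale[OF gam_family])
    moreover have "conj_family l (h' k)" unfolding h'_def
      by (intro conj_family_diff conj_family_mult conj_family_of_int conj_family_scale[OF th_family] th_family)
    ultimately have "conj_family l (\<lambda>c. h c + h' k c * \<kappa> c)"
      using \<kappa>(1) by (intro conj_family_add conj_family_mult)
    moreover have "gam (c * g ^ k) * h c = h' k c * (\<Prod>k\<in>A. h' k c) + gam c * (h c + h' k c * \<kappa> c)" for c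
    proof -
      have "gam (c * g ^ k) = gam c + h' k c" by (simp add: gam_def h'_def algebra_simps)
      hence "gam (c * g ^ k) * h c = h' k c * h c + gam c * h c" by (simp add: algebra_simps)
      also have "h' k c * h c = h' k c * (\<Prod>k\<in>A. h' k c) + gam c * (h' k c * \<kappa> c)"
        by (subst \<kappa>(2)) (simp add: algebra_simps)
      finally show ?thesis by (simp add: algebra_simps)
    qed
    ultimately show ?case using insert.hyps unfolding h_def h'_def
      by (intro exI[of _ "\<lambda>c. h c + h' k c * \<kappa> c"]) (simp add: h_def h'_def)
  qed
  from this[of "{1..<D}"] obtain \<kappa> where \<kappa>: "conj_family l \<kappa>"
    "\<And>c. (\<Prod>k\<in>{1..<D}. gam (c * g ^ k)) = X c + gam c * \<kappa> c"
    unfolding X_def by auto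
  define Y where "Y = (\<lambda>c. \<Prod>i\<in>{1..<D}. X (c * g ^ i))"
  have Y: "conj_family l Y" unfolding Y_def by (intro conj_family_prod conj_family_scale[OF X_family])
  have "om c = of_int E + gam c * (Y c * \<kappa> c)" if "\<not> l dvd c" for c
  proof -
    have "om c = Y c * X c + gam c * (Y c * \<kappa> c)"
      unfolding om_def Y_def \<kappa>(2) by (simp add: algebra_simps)
    also have "Y c * X c = (\<Prod>i<D. X (c * g ^ i))" unfolding split_prod Y_def by simp
    finally show ?thesis using prod_X[OF that] by simp
  qed
  thus ?thesis using conj_family_mult[OF Y \<kappa>(1)] by (intro exI[of _ "\<lambda>c. Y c * \<kappa> c"]) simp
qed

text \<open>Among the factors of \<open>om (c * g ^ i)\<close> the one with shift D - i is
  \<open>gam c\<close> again, since \<open>g ^ D = b\<close> fixes \<open>gam\<close>.\<close>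

lemma om_conjugate:
  assumes "i \<in> {1..<D}"
  shows "\<exists>\<kappa>. conj_family l \<kappa> \<and> (\<forall>c. om (c * g ^ i) = gam c * \<kappa> c)"
proof -
  define \<kappa> where "\<kappa> = (\<lambda>c. (\<Prod>j\<in>{1..<D}. X (c * g ^ i * g ^ j)) * (\<Prod>k\<in>{1..<D} - {D - i}. gam (c * g ^ i * g ^ k)))"
  have "conj_family l (\<lambda>c. X (c * g ^ i * g ^ j))" "conj_family l (\<lambda>c. gam (c * g ^ i * g ^ j))" for j
    using conj_family_scale[OF X_family, of "g ^ i * g ^ j"] conj_family_scale[OF gam_family, of "g ^ i * g ^ j"]
    by (simp_all add: mult.assoc)
  hence "conj_family l \<kappa>" unfolding \<kappa>_def by (intro conj_family_mult conj_family_prod)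
  moreover have "om (c * g ^ i) = gam c * \<kappa> c" for c
  proof -
    have "gam (c * g ^ i * g ^ (D - i)) = gam c"
      using gam_period[of c 0] assms by (simp add: mult.assoc flip: power_add)
    moreover have "(\<Prod>k\<in>{1..<D}. gam (c * g ^ i * g ^ k)) =
        gam (c * g ^ i * g ^ (D - i)) * (\<Prod>k\<in>{1..<D} - {D - i}. gam (c * g ^ i * g ^ k))"
      using assms by (intro prod.remove) auto
    ultimately show ?thesis by (simp add: om_def \<kappa>_def)
  qed
  ultimately show ?thesis by blast
qed

end

section \<open>The Frobenius map on cyclotomic integers\<close>

lemma binomial_prime_mod:
  fixes x y :: "'a :: comm_ring_1"
  assumes "prime q"
  shows "\<exists>r. (x + y) ^ q = x ^ q + y ^ q + of_nat q * r"
proof -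
  have q1: "q > 1" using assms prime_gt_1_nat by blast
  have "\<exists>r. \<forall>k\<in>{1..<q}. q choose k = q * r k"
  proof (rule bchoice, intro ballI)
    fix k assume "k \<in> {1..<q}"
    hence "q dvd q choose k" using assms by (intro dvd_choose_prime) auto
    thus "\<exists>r. q choose k = q * r" by (auto elim: dvdE)
  qed
  then obtain r where r: "\<forall>k\<in>{1..<q}. q choose k = q * r k" by blast
  have split: "{..q} = insert 0 (insert q {1..<q})" using q1 by auto
  have "(x + y) ^ q = (\<Sum>k\<le>q. of_nat (q choose k) * x ^ k * y ^ (q - k))" by (rule binomial_ring)
  also have "\<dots> = y ^ q + (x ^ q + (\<Sum>k\<in>{1..<q}. of_nat (q choose k) * x ^ k * y ^ (q - k)))"
    unfolding split using q1 by (subst sum.insert, simp, simp, subst sum.insert) auto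
  also have "(\<Sum>k\<in>{1..<q}. of_nat (q choose k) * x ^ k * y ^ (q - k)) =
      of_nat q * (\<Sum>k\<in>{1..<q}. of_nat (r k) * x ^ k * y ^ (q - k))"
    unfolding sum_distrib_left using r by (intro sum.cong) (auto simp: mult_ac)
  finally show ?thesis by (intro exI[of _ "\<Sum>k\<in>{1..<q}. of_nat (r k) * x ^ k * y ^ (q - k)"]) (simp add: algebra_simps)
qed

lemma int_power_prime_mod:
  fixes a :: int
  assumes q: "prime q"
  shows "int q dvd a ^ q - a"
proof (cases "int q dvd a")
  case True
  thus ?thesis using dvd_trans[OF True dvd_power[of q a]] prime_gt_0_nat[OF q] by (simp add: dvd_diff)
next
  case False
  define r where "r = nat (a mod int q)"
  have r: "int r = a mod int q" using prime_gt_0_nat[OF q] by (simp add: r_def)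
  have ar: "[a = int r] (mod int q)" unfolding r by (simp add: cong_def)
  have "[r ^ (q ^ 1) = r] (mod q)" by (rule cong_pow_prime_power[OF q])
  hence "[int (r ^ q) = int r] (mod int q)" by (simp only: cong_int_iff power_one_right)
  hence "[int r ^ q = int r] (mod int q)" by simp
  hence "[a ^ q = a] (mod int q)"
    using cong_pow[OF ar, of q] ar by (meson cong_sym cong_trans)
  thus ?thesis by (simp add: cong_iff_dvd_diff)
qed

lemma int_poly_power_prime:
  fixes P :: "int poly"
  assumes q: "prime q"
  shows "\<exists>R. P ^ q = pcompose P (monom 1 q) + smult (int q) R"
proof (induction P rule: pCons_induct)
  case 0
  show ?case using prime_gt_0_nat[OF q] by (intro exI[of _ 0]) (simp add: power_0_left)
next
  case (pCons a p)
  obtain R where R: "p ^ q = pcompose p (monom 1 q) + smult (int q) R" using pCons.IH by blast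
  obtain S where S: "([:a:] + monom 1 1 * p) ^ q = [:a:] ^ q + (monom 1 1 * p) ^ q + of_nat q * S"
    using binomial_prime_mod[OF q] by blast
  obtain c where c: "a ^ q - a = int q * c" using int_power_prime_mod[OF q, of a] by (elim dvdE)
  have 1: "pCons a p = [:a:] + monom 1 1 * p" by (simp add: monom_Suc)
  have 2: "[:a:] ^ q = [:a:] + smult (int q) [:c:]"
  proof -
    have "a ^ q = a + int q * c" using c by simp
    thus ?thesis by (simp add: poly_const_pow)
  qed
  have 3: "(monom 1 1 * p) ^ q = monom 1 q * pcompose p (monom 1 q) + smult (int q) (monom 1 q * R)"
    by (simp add: power_mult_distrib monom_power R algebra_simps)
  have 4: "pcompose (pCons a p) (monom 1 q) = [:a:] + monom 1 q * pcompose p (monom 1 q)"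
    by (simp add: pcompose_pCons)
  have 5: "of_nat q * S = smult (int q) S" by (simp add: of_nat_poly)
  show ?case
    unfolding 4 by (subst 1, subst S, unfold 2 3 5)
      (intro exI[of _ "[:c:] + monom 1 q * R + S"], simp add: smult_add_right algebra_simps)
qed

text \<open>Modulo q the q-th power is the Galois action c to c * q. This is the only link between
  arithmetic modulo a prime and the exponents of the root of unity.\<close>

lemma conj_family_power_prime:
  assumes q: "prime q" and "conj_family l \<phi>"
  obtains \<kappa> where "conj_family l \<kappa>" "\<And>c. \<phi> c ^ q = \<phi> (c * q) + of_int (int q) * \<kappa> c"
proof -
  obtain P where P: "\<And>c. \<phi> c = poly (map_poly of_int P) (zeta l ^ c)"
    using assms(2) unfolding conj_family_def by blast
  obtain R where R: "P ^ q = pcompose P (monom 1 q) + smult (int q) R"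
    using int_poly_power_prime[OF q] by blast
  have "\<phi> c ^ q = \<phi> (c * q) + of_int (int q) * poly (map_poly of_int R) (zeta l ^ c)" for c
  proof -
    have "\<phi> c ^ q = poly (map_poly of_int (P ^ q)) (zeta l ^ c)" by (simp add: P hom_distribs)
    also have "\<dots> = poly (map_poly of_int P) ((zeta l ^ c) ^ q) + of_int (int q) * poly (map_poly of_int R) (zeta l ^ c)"
      unfolding R by (simp add: hom_distribs of_int_hom.map_poly_pcompose poly_pcompose map_poly_monom poly_monom)
    finally show ?thesis by (simp add: P power_mult)
  qed
  thus ?thesis using that conj_family_poly by blast
qed

section \<open>The residue ring of \<open>gam\<close> and a divisor N of its norm\<close>

locale norm_mod = norm_form +
  fixes m0 N :: int
  assumes norm_m0: "\<And>c. \<not> l dvd c \<Longrightarrow> norm_family c = of_int m0" and m0_nz: "m0 \<noteq> 0"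
    and N_pos: "N > 0" and N_dvd: "N dvd m0" and N_E: "Rings.coprime N E" and N_l: "Rings.coprime N (int l)"
begin

lemma sum_split: "(\<Sum>i<D. h i) = h 0 + (\<Sum>i\<in>{1..<D}. h i)" for h :: "nat \<Rightarrow> complex"
proof -
  have "{..<D} = insert 0 {1..<D}" using D_pos by auto
  thus ?thesis by simp
qed

text \<open>All conjugates of \<open>om\<close> except the first are multiples of
  \<open>gam c\<close>, and the first is E modulo \<open>gam c\<close>. A trace weighted with
  \<open>om\<close> therefore returns E times the element itself in the residue ring.\<close>

lemma weighted_sum_eq:
  assumes "conj_family l \<phi>"
  shows "\<exists>\<kappa>. conj_family l \<kappa> \<and> (\<forall>c. \<not> l dvd c \<longrightarrow>
    (\<Sum>i<D. \<phi> (c * g ^ i) * om (c * g ^ i)) = of_int E * \<phi> c + gam c * \<kappa> c)"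
proof -
  obtain \<kappa>0 where 0: "conj_family l \<kappa>0" "\<And>c. \<not> l dvd c \<Longrightarrow> om c = of_int E + gam c * \<kappa>0 c"
    using om_eq by blast
  have "\<forall>i\<in>{1..<D}. \<exists>\<kappa>. conj_family l \<kappa> \<and> (\<forall>c. om (c * g ^ i) = gam c * \<kappa> c)"
    using om_conjugate by blast
  from bchoice[OF this] obtain \<kappa> where \<kappa>: "\<forall>i\<in>{1..<D}. conj_family l (\<kappa> i) \<and> (\<forall>c. om (c * g ^ i) = gam c * \<kappa> i c)" ..
  define \<kappa>' where "\<kappa>' = (\<lambda>c. \<phi> c * \<kappa>0 c + (\<Sum>i\<in>{1..<D}. \<phi> (c * g ^ i) * \<kappa> i c))"
  have "conj_family l \<kappa>'"
    unfolding \<kappa>'_def using 0(1) \<kappa>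
    by (intro conj_family_add conj_family_mult conj_family_sum conj_family_scale assms) auto
  moreover have "(\<Sum>i<D. \<phi> (c * g ^ i) * om (c * g ^ i)) = of_int E * \<phi> c + gam c * \<kappa>' c" if "\<not> l dvd c" for c
  proof -
    have "(\<Sum>i\<in>{1..<D}. \<phi> (c * g ^ i) * om (c * g ^ i)) = (\<Sum>i\<in>{1..<D}. gam c * (\<phi> (c * g ^ i) * \<kappa> i c))"
      using \<kappa> by (intro sum.cong refl) (simp add: mult_ac)
    thus ?thesis unfolding sum_split \<kappa>'_def using 0(2)[OF that]
      by (simp add: sum_distrib_left algebra_simps)
  qed
  ultimately show ?thesis by (intro exI[of _ \<kappa>']) simp
qed

lemma weighted_sum_invariant:
  assumes "\<And>c. \<not> l dvd c \<Longrightarrow> \<phi> (c * b) = \<phi> c" and c: "\<not> l dvd c"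
  shows "(\<Sum>i<D. \<phi> ((c * g) * g ^ i) * om ((c * g) * g ^ i)) = (\<Sum>i<D. \<phi> (c * g ^ i) * om (c * g ^ i))"
proof -
  have *: "\<phi> (c * g ^ (i + D)) * om (c * g ^ (i + D)) = \<phi> (c * g ^ i) * om (c * g ^ i)" for i
  proof -
    have "\<phi> (c * g ^ (i + D)) = \<phi> (c * g ^ i)"
      using assms(1)[OF not_dvd_mult_g[OF c, of i]] by (simp add: b_def power_add mult_ac)
    thus ?thesis by (simp only: om_period)
  qed
  show ?thesis
    using sum_shift_cyclic[of "\<lambda>i. \<phi> (c * g ^ i) * om (c * g ^ i)" D, OF *] by (simp add: mult.assoc)
qed

lemma weighted_sum_int:
  assumes fam: "conj_family l \<phi>" and inv: "\<And>c. \<not> l dvd c \<Longrightarrow> \<phi> (c * b) = \<phi> c"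
  obtains B where "\<And>c. \<not> l dvd c \<Longrightarrow> (\<Sum>i<D. \<phi> (c * g ^ i) * om (c * g ^ i)) = of_int B"
proof -
  have "conj_family l (\<lambda>c. \<Sum>i<D. \<phi> (c * g ^ i) * om (c * g ^ i))"
    by (intro conj_family_sum conj_family_mult conj_family_scale fam om_family)
  from invariant_family_int[OF this weighted_sum_invariant[of \<phi>, OF inv]]
  obtain k where "\<And>c. \<not> l dvd c \<Longrightarrow> (\<Sum>i<D. \<phi> (c * g ^ i) * om (c * g ^ i)) = of_int k" by metis
  thus ?thesis by (rule that)
qed

text \<open>The integer \<Omega> - E is a multiple of \<open>gam\<close>, so taking norms shows that
  m0 divides its D-th power. A prime common to N and \<Omega> would then divide E, against
  \<open>N_E\<close>.\<close>

lemma exists_trace_weight: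
  obtains \<Omega> where "\<And>c. \<not> l dvd c \<Longrightarrow> (\<Sum>i<D. om (c * g ^ i)) = of_int \<Omega>" "Rings.coprime N \<Omega>"
proof -
  have one: "conj_family l (\<lambda>c. 1)" using conj_family_of_int[of l 1] by simp
  obtain \<Omega> where \<Omega>: "\<And>c. \<not> l dvd c \<Longrightarrow> (\<Sum>i<D. 1 * om (c * g ^ i)) = of_int \<Omega>"
    using weighted_sum_int[OF one] by auto
  obtain \<kappa> where \<kappa>: "conj_family l \<kappa>"
    "\<And>c. \<not> l dvd c \<Longrightarrow> (\<Sum>i<D. 1 * om (c * g ^ i)) = of_int E * 1 + gam c * \<kappa> c"
    using weighted_sum_eq[OF one] by blast
  have diff: "of_int (\<Omega> - E) = gam c * \<kappa> c" if "\<not> l dvd c" for c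
    using \<Omega>[OF that] \<kappa>(2)[OF that] by simp
  have "m0 dvd (\<Omega> - E) ^ D"
  proof (rule family_int_eq[OF _ _ m0_nz])
    show "conj_family l (\<lambda>c. \<Prod>i<D. \<kappa> (c * g ^ i))"
      by (intro conj_family_prod conj_family_scale \<kappa>)
    fix c assume c: "\<not> l dvd c"
    have "(of_int ((\<Omega> - E) ^ D) :: complex) = (\<Prod>i<D. of_int (\<Omega> - E))" by simp
    also have "\<dots> = (\<Prod>i<D. gam (c * g ^ i) * \<kappa> (c * g ^ i))"
      by (intro prod.cong refl diff not_dvd_mult_g c)
    also have "\<dots> = norm_family c * (\<Prod>i<D. \<kappa> (c * g ^ i))" by (simp add: prod.distrib norm_family_def)
    finally show "of_int ((\<Omega> - E) ^ D) = of_int m0 * (\<Prod>i<D. \<kappa> (c * g ^ i))" by (simp only: norm_m0[OF c])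
  qed
  hence dvd: "N dvd (\<Omega> - E) ^ D" using N_dvd dvd_trans by blast
  have "gcd N \<Omega> = 1"
  proof (rule ccontr)
    assume "gcd N \<Omega> \<noteq> 1"
    hence "\<not> is_unit (gcd N \<Omega>)" by simp
    moreover have "gcd N \<Omega> \<noteq> 0" using N_pos by simp
    ultimately obtain q where q: "prime q" "q dvd gcd N \<Omega>" using prime_divisor_exists by blast
    hence "q dvd (\<Omega> - E) ^ D" using dvd dvd_trans by (meson gcd_dvd1)
    hence "q dvd \<Omega> - E" using q prime_dvd_power by blast
    moreover have "q dvd \<Omega>" "q dvd N" using q by auto
    ultimately have "q dvd E" by (metis dvd_diff_right_iff dvd_diff add_diff_cancel_left' diff_diff_eq2 minus_diff_eq dvd_minus_iff)
    thus False using \<open>q dvd N\<close> N_E q(1) coprime_common_divisor not_prime_unit by blast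
  qed
  hence "Rings.coprime N \<Omega>" by (simp only: coprime_iff_gcd_eq_1)
  thus ?thesis using that \<Omega> by simp
qed

text \<open>Z/N embeds into the residue ring. Multiplying an integer a of the ideal by
  \<open>om\<close> turns \<open>gam\<close> into a multiple of its norm, hence of N; the trace then
  gives \<open>N dvd a * \<Omega>\<close>, and \<Omega> is a unit modulo N.\<close>

lemma modulo_of_int_iff: "modulo N (\<lambda>c. of_int a) \<longleftrightarrow> N dvd a"
proof
  assume "N dvd a"
  then obtain k where "a = N * k" by (elim dvdE)
  thus "modulo N (\<lambda>c. of_int a)" using modulo_N[OF conj_family_of_int[of l k]] by simp
next
  assume "modulo N (\<lambda>c. of_int a)"
  then obtain \<alpha> \<beta> where ab: "conj_family l \<alpha>" "conj_family l \<beta>"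
    "\<And>c. \<not> l dvd c \<Longrightarrow> of_int a = gam c * \<alpha> c + of_int N * \<beta> c"
    unfolding modulo_def by blast
  obtain \<Omega> where \<Omega>: "\<And>c. \<not> l dvd c \<Longrightarrow> (\<Sum>i<D. om (c * g ^ i)) = of_int \<Omega>" "Rings.coprime N \<Omega>"
    using exists_trace_weight by blast
  obtain k where k: "m0 = N * k" using N_dvd by (elim dvdE)
  define Y where "Y = (\<lambda>c. \<Prod>i\<in>{1..<D}. X (c * g ^ i))"
  have Y: "conj_family l Y" unfolding Y_def by (intro conj_family_prod conj_family_scale X_family)
  define \<kappa> where "\<kappa> = (\<lambda>c. of_int k * Y c * \<alpha> c + \<beta> c * om c)"
  have \<kappa>: "conj_family l \<kappa>"
    unfolding \<kappa>_def by (intro conj_family_add conj_family_mult conj_family_of_int Y ab om_family)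
  have eq: "of_int a * om c = of_int N * \<kappa> c" if c: "\<not> l dvd c" for c
  proof -
    have "of_int a * om c = (gam c * om c) * \<alpha> c + of_int N * (\<beta> c * om c)"
      unfolding ab(3)[OF c] by (simp add: algebra_simps)
    also have "gam c * om c = of_int N * of_int k * Y c"
      unfolding gam_om norm_m0[OF c] Y_def k by simp
    finally show ?thesis by (simp add: \<kappa>_def algebra_simps)
  qed
  have "N dvd a * \<Omega>"
  proof (rule family_int_eq)
    show "conj_family l (\<lambda>c. \<Sum>i<D. \<kappa> (c * g ^ i))" by (intro conj_family_sum conj_family_scale \<kappa>)
    fix c assume c: "\<not> l dvd c"
    have "of_int (a * \<Omega>) = (\<Sum>i<D. of_int a * om (c * g ^ i))"
      unfolding sum_distrib_left[symmetric] \<Omega>(1)[OF c] by simp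
    also have "\<dots> = (\<Sum>i<D. of_int N * \<kappa> (c * g ^ i))"
      by (intro sum.cong refl eq not_dvd_mult_g c)
    finally show "of_int (a * \<Omega>) = of_int N * (\<Sum>i<D. \<kappa> (c * g ^ i))" by (simp add: sum_distrib_left)
  qed (use N_pos in simp)
  thus "N dvd a" using \<Omega>(2) by (simp add: coprime_dvd_mult_left_iff)
qed

text \<open>The weighted trace of an element fixed by b is an integer equal to E times the element
  in the residue ring, and E can be inverted modulo N.\<close>

lemma modulo_representative:
  assumes fam: "conj_family l \<phi>" and inv: "\<And>c. \<not> l dvd c \<Longrightarrow> \<phi> (c * b) = \<phi> c"
  shows "\<exists>a. modulo N (\<lambda>c. of_int a - \<phi> c)"
proof -
  obtain B where B: "\<And>c. \<not> l dvd c \<Longrightarrow> (\<Sum>i<D. \<phi> (c * g ^ i) * om (c * g ^ i)) = of_int B"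
    using weighted_sum_int[OF fam inv] by blast
  obtain \<kappa> where \<kappa>: "conj_family l \<kappa>"
    "\<And>c. \<not> l dvd c \<Longrightarrow> (\<Sum>i<D. \<phi> (c * g ^ i) * om (c * g ^ i)) = of_int E * \<phi> c + gam c * \<kappa> c"
    using weighted_sum_eq[OF fam] by blast
  have "Rings.coprime E N" using N_E by (simp add: ac_simps)
  from cong_solve_coprime_int[OF this] obtain w where "[E * w = 1] (mod N)" by auto
  then obtain z where "E * w - 1 = N * z" by (auto simp: cong_iff_dvd_diff elim: dvdE)
  hence z: "E * w = 1 + N * z" by simp
  have "modulo N (\<lambda>c. gam c * (of_int w * \<kappa> c) + of_int N * (of_int z * \<phi> c))"
    by (intro modulo_add modulo_gam modulo_N conj_family_mult conj_family_of_int \<kappa> fam)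
  moreover have "gam c * (of_int w * \<kappa> c) + of_int N * (of_int z * \<phi> c) = of_int (w * B) - \<phi> c" if c: "\<not> l dvd c" for c
  proof -
    have "of_int B = of_int E * \<phi> c + gam c * \<kappa> c" using B[OF c] \<kappa>(2)[OF c] by simp
    hence "of_int (w * B) = of_int (E * w) * \<phi> c + gam c * (of_int w * \<kappa> c)" by (simp add: algebra_simps)
    thus ?thesis unfolding z by (simp add: algebra_simps)
  qed
  ultimately have "modulo N (\<lambda>c. of_int (w * B) - \<phi> c)" by (rule modulo_cong)
  thus ?thesis by blast
qed

end

text \<open>A cyclic shift moves one point past d - 1 others, so the Vandermonde product picks up
  the sign of a d-cycle.\<close>

lemma prod_differences_cyclic_shift:
  fixes z :: "nat \<Rightarrow> 'a :: comm_ring_1"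
  assumes "z d = z 0" "d > 0"
  shows "(\<Prod>j<d. \<Prod>i<j. z (Suc i) - z (Suc j)) = (-1) ^ (d - 1) * (\<Prod>j<d. \<Prod>i<j. z i - z j)"
proof -
  obtain e where d: "d = Suc e" using assms(2) by (cases d) auto
  define P where "P = (\<Prod>j<e. \<Prod>i<j. z (Suc i) - z (Suc j))"
  have "(\<Prod>j<d. \<Prod>i<j. z (Suc i) - z (Suc j)) = P * (\<Prod>i<e. z (Suc i) - z 0)"
    using assms(1) by (simp add: P_def d mult.commute)
  also have "(\<Prod>i<e. z (Suc i) - z 0) = (\<Prod>i<e. (-1) * (z 0 - z (Suc i)))" by simp
  also have "\<dots> = (-1) ^ e * (\<Prod>i<e. z 0 - z (Suc i))" by (subst prod.distrib) simp
  finally have 1: "(\<Prod>j<d. \<Prod>i<j. z (Suc i) - z (Suc j)) = (-1) ^ e * (P * (\<Prod>i<e. z 0 - z (Suc i)))"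
    by (simp add: mult_ac)
  have "(\<Prod>j<d. \<Prod>i<j. z i - z j) = (\<Prod>j<e. \<Prod>i<Suc j. z i - z (Suc j))"
    unfolding d by (subst prod.lessThan_Suc_shift) simp
  also have "\<dots> = (\<Prod>j<e. (z 0 - z (Suc j)) * (\<Prod>i<j. z (Suc i) - z (Suc j)))"
    by (subst prod.lessThan_Suc_shift) simp
  also have "\<dots> = P * (\<Prod>i<e. z 0 - z (Suc i))" by (simp add: prod.distrib P_def mult.commute)
  finally show ?thesis using 1 by (simp add: d)
qed

section \<open>The square root of the discriminant and the Jacobi symbol\<close>

context norm_form
begin

lemma modulo_dvd: "N' dvd N \<Longrightarrow> modulo N \<phi> \<Longrightarrow> modulo N' \<phi>"
proof -
  assume "N' dvd N" "modulo N \<phi>"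
  from this(1) obtain k where k: "N = N' * k" by (elim dvdE)
  obtain \<alpha> \<beta> where *: "conj_family l \<alpha>" "conj_family l \<beta>"
    "\<And>c. \<not> l dvd c \<Longrightarrow> \<phi> c = gam c * \<alpha> c + of_int N * \<beta> c"
    using \<open>modulo N \<phi>\<close> unfolding modulo_def by blast
  have "modulo N' (\<lambda>c. gam c * \<alpha> c + of_int N' * (of_int k * \<beta> c))"
    by (intro modulo_add modulo_gam modulo_N conj_family_mult conj_family_of_int *)
  thus ?thesis by (rule modulo_cong) (simp add: * k mult.assoc)
qed

lemma modulo_power_diff:
  assumes "modulo N (\<lambda>c. \<phi> c - \<psi> c)" "conj_family l \<phi>" "conj_family l \<psi>"
  shows "modulo N (\<lambda>c. \<phi> c ^ e - \<psi> c ^ e)"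
proof -
  have power: "conj_family l (\<lambda>c. \<eta> c ^ i)" if "conj_family l \<eta>" for \<eta> i
    using conj_family_prod[of "{..<i}" l "\<lambda>_. \<eta>"] that by simp
  have "conj_family l (\<lambda>c. slope e (\<phi> c) (\<psi> c))"
    unfolding slope_def by (intro conj_family_sum conj_family_mult power assms)
  from modulo_mult[OF assms(1) this] show ?thesis
    by (rule modulo_cong) (simp add: slope_mult mult.commute)
qed

text \<open>A square root of the discriminant of the polynomial with roots \<open>\<zeta> ^ (c * b ^ j)\<close>. The
  action of Frobenius on it determines the Jacobi symbol.\<close>

definition delta :: "nat \<Rightarrow> complex" where
  "delta c = (\<Prod>j<d. \<Prod>i<j. zeta l ^ (c * b ^ i) - zeta l ^ (c * b ^ j))"

lemma delta_family: "conj_family l delta"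
  unfolding delta_def by (intro conj_family_prod conj_family_diff conj_family_zeta)

lemma delta_mult_b: "delta (c * b) = (-1) ^ (d - 1) * delta c"
proof -
  have "zeta l ^ (c * b ^ d) = zeta l ^ (c * b ^ 0)" using zeta_b_period[of c 0] by simp
  from prod_differences_cyclic_shift[of "\<lambda>i. zeta l ^ (c * b ^ i)", OF this d_pos]
  show ?thesis by (simp add: delta_def mult.assoc)
qed

lemma delta_mult_b_power: "delta (c * b ^ r) = (-1) ^ (r * (d - 1)) * delta c"
proof (induction r)
  case (Suc r)
  have "delta (c * b ^ Suc r) = (-1) ^ (d - 1) * delta (c * b ^ r)"
    using delta_mult_b[of "c * b ^ r"] by (simp add: mult_ac)
  thus ?case by (simp add: Suc power_add)
qed simp

end

context norm_mod
begin

text \<open>Modulo q the power \<open>gam c ^ q\<close> equals the conjugate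
  \<open>gam (c * q)\<close>, so this conjugate lies in the ideal of \<open>gam c\<close> and q. If
  it were a different conjugate \<open>gam (c * g ^ k)\<close>, the difference of the two, a factor
  of E, would put E into the ideal, against coprimality. Hence q is a power of b modulo l.\<close>

lemma prime_residue:
  assumes q: "prime q" "N = int q"
  shows "\<exists>r. [q = b ^ r] (mod l)"
proof -
  have "\<not> l dvd q"
  proof
    assume "l dvd q"
    hence "l = q" using l q primes_dvd_imp_eq by blast
    thus False using N_l q l by (simp add: prime_gt_1_nat)
  qed
  then obtain i where i: "[q = g ^ i] (mod l)" using g_generator by blast
  define k where "k = i mod D"
  have thk: "th t (c * q) = th t (c * g ^ k)" for c
  proof -
    have "th t (c * g ^ (k + D * m)) = th t (c * g ^ k)" for m
    proof (induction m)
      case (Suc m)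
      show ?case using th_period[of t c "k + D * m"] Suc by (simp add: algebra_simps)
    qed simp
    from this[of "i div D"] have "th t (c * g ^ i) = th t (c * g ^ k)" by (simp add: k_def)
    moreover have "th t (c * q) = th t (c * g ^ i)"
      by (intro conj_family_cong[OF th_family l0] cong_mult cong_refl i)
    ultimately show ?thesis by simp
  qed
  obtain \<kappa> where \<kappa>: "conj_family l \<kappa>" "\<And>c. gam c ^ q = gam (c * q) + of_int (int q) * \<kappa> c"
    using conj_family_power_prime[OF q(1) gam_family] by blast
  have power: "conj_family l (\<lambda>c. gam c ^ (q - 1))"
    using conj_family_prod[of "{..<q - 1}" l "\<lambda>_. gam"] gam_family by simp
  have q0: "q > 0" using q(1) prime_gt_0_nat by blast
  have diff: "modulo N (\<lambda>c. of_int M' * (th t c - th t (c * g ^ k)))"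
  proof (rule modulo_cong)
    show "modulo N (\<lambda>c. (gam c * gam c ^ (q - 1) - of_int N * \<kappa> c) - gam c * 1)"
      using conj_family_of_int[of l 1] by (intro modulo_diff modulo_gam modulo_N power \<kappa>) simp
    fix c
    have "gam c * gam c ^ (q - 1) = gam c ^ q" using q0 by (simp flip: power_Suc)
    hence "(gam c * gam c ^ (q - 1) - of_int N * \<kappa> c) - gam c * 1 = gam (c * q) - gam c"
      by (simp add: \<kappa>(2) q(2))
    also have "\<dots> = of_int M' * (th t c - th t (c * g ^ k))" by (simp add: gam_def thk algebra_simps)
    finally show "(gam c * gam c ^ (q - 1) - of_int N * \<kappa> c) - gam c * 1 =
      of_int M' * (th t c - th t (c * g ^ k))" .
  qed
  have "k = 0"
  proof (rule ccontr)
    assume "k \<noteq> 0"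
    hence k: "k \<in> {1..<D}" using D_pos by (simp add: k_def)
    define R where "R = (\<lambda>c. (\<Prod>i\<in>{1..<D}. X (c * g ^ i)) *
      (\<Prod>j\<in>{1..<D} - {k}. of_int M' * (th t c - th t (c * g ^ j))))"
    have "conj_family l R"
      unfolding R_def by (intro conj_family_mult conj_family_prod conj_family_scale[OF X_family]
          conj_family_of_int conj_family_diff conj_family_scale[OF th_family] th_family)
    from modulo_mult[OF diff this] have "modulo N (\<lambda>c. of_int E)"
    proof (rule modulo_cong)
      fix c assume c: "\<not> l dvd c"
      have "X c = of_int M' * (th t c - th t (c * g ^ k)) *
          (\<Prod>j\<in>{1..<D} - {k}. of_int M' * (th t c - th t (c * g ^ j)))"
        unfolding X_def using k by (intro prod.remove) auto
      moreover have "of_int E = X c * (\<Prod>i\<in>{1..<D}. X (c * g ^ i))"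
        using prod_X[OF c] unfolding split_prod by simp
      ultimately show "R c * (of_int M' * (th t c - th t (c * g ^ k))) = of_int E"
        by (simp add: R_def mult_ac)
    qed
    hence "N dvd E" by (simp only: modulo_of_int_iff)
    hence "is_unit N" by (rule coprime_common_divisor[OF N_E dvd_refl])
    thus False using q by auto
  qed
  hence "i = D * (i div D)" unfolding k_def by (metis add.right_neutral mult_div_mod_eq)
  thus ?thesis using i unfolding b_power by metis
qed

text \<open>Euler's criterion, with a = \<open>delta\<close>^2 in the residue ring: the Frobenius of
  q acts on \<open>delta\<close> as the r-th power of the shift by b, hence by the sign
  \<open>(-1) ^ (r * (d - 1))\<close>.\<close>

lemma Legendre_eq:
  assumes q: "prime q" "odd q" "N = int q" and r: "[q = b ^ r] (mod l)"
    and a: "modulo N (\<lambda>c. of_int a - delta c ^ 2)" and qa: "\<not> int q dvd a"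
  shows "Legendre a (int q) = (-1) ^ (r * (d - 1))"
proof -
  define \<epsilon> :: int where "\<epsilon> = (-1) ^ (r * (d - 1))"
  have q2: "q > 2" using q prime_ge_2_nat[of q] by (cases "q = 2") auto
  define h where "h = (q - 1) div 2"
  have h: "2 * Suc h = Suc q" using q q2 by (auto simp: h_def elim!: oddE)
  obtain \<kappa> where \<kappa>: "conj_family l \<kappa>" "\<And>c. delta c ^ q = delta (c * q) + of_int (int q) * \<kappa> c"
    using conj_family_power_prime[OF q(1) delta_family] by blast
  have \<delta>2: "conj_family l (\<lambda>c. delta c ^ 2)"
    unfolding power2_eq_square by (intro conj_family_mult delta_family)
  \<comment> \<open>The q-th power of \<open>delta\<close> is multiplied by \<open>delta\<close>
    once more, so that only powers of its square occur. The statement becomes one about integers,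
    where the extra factor a cancels.\<close>
  have "modulo N (\<lambda>c. (of_int a ^ Suc h - (delta c ^ 2) ^ Suc h) + delta c * (of_int N * \<kappa> c) -
      of_int \<epsilon> * (of_int a - delta c ^ 2))"
    by (intro modulo_diff modulo_add modulo_power_diff modulo_mult modulo_N a \<kappa> delta_family
        conj_family_of_int \<delta>2)
  hence "modulo N (\<lambda>c. of_int (a ^ Suc h - \<epsilon> * a))"
  proof (rule modulo_cong)
    fix c
    have "delta (c * q) = delta (c * b ^ r)"
      by (intro conj_family_cong[OF delta_family l0] cong_mult cong_refl r)
    also have "\<dots> = of_int \<epsilon> * delta c" by (simp add: delta_mult_b_power \<epsilon>_def)
    finally have "delta c * (of_int N * \<kappa> c) = delta c * delta c ^ q - of_int \<epsilon> * delta c ^ 2"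
      by (simp add: \<kappa>(2) q(3) algebra_simps power2_eq_square)
    also have "delta c * delta c ^ q = (delta c ^ 2) ^ Suc h"
      unfolding power_mult[symmetric] h by simp
    finally show "(of_int a ^ Suc h - (delta c ^ 2) ^ Suc h) + delta c * (of_int N * \<kappa> c) -
      of_int \<epsilon> * (of_int a - delta c ^ 2) = of_int (a ^ Suc h - \<epsilon> * a)"
      by (simp add: algebra_simps)
  qed
  hence "N dvd a ^ Suc h - \<epsilon> * a" by (simp only: modulo_of_int_iff)
  hence "int q dvd a * (a ^ h - \<epsilon>)" by (simp add: q(3) algebra_simps)
  hence 1: "int q dvd a ^ h - \<epsilon>" using q(1) qa by (simp add: prime_dvd_mult_iff)
  have "[Legendre a (int q) = a ^ h] (mod int q)"
    using euler_criterion[of "q" a] q q2 by (simp add: h_def)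
  hence "int q dvd Legendre a (int q) - a ^ h" by (simp add: cong_iff_dvd_diff)
  from dvd_add[OF this 1] have *: "int q dvd Legendre a (int q) - \<epsilon>" by simp
  have "Legendre a (int q) \<in> {1, -1}" using qa by (simp add: Legendre_def cong_0_iff)
  moreover have "\<epsilon> \<in> {1, -1}" unfolding \<epsilon>_def by (cases "even (r * (d - 1))") auto
  ultimately show ?thesis
    using * q2 zdvd_imp_le[of "int q" 2] unfolding \<epsilon>_def[symmetric] by auto
qed

end

context norm_mod
begin

lemma norm_mod_dvd: "int q dvd N \<Longrightarrow> q > 0 \<Longrightarrow> norm_mod l d D g t E0 M' u m0 (int q)"
  using norm_m0 m0_nz N_dvd N_E N_l coprime_divisors[of "int q" N E E] coprime_divisors[of "int q" N "int l" "int l"]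
  by unfold_locales (auto intro: dvd_trans)

text \<open>Every prime of N' is some b^r, and the exponents add up to an R with b^R = N' = b modulo
  l, so R = 1 modulo d. For even d this makes R odd, and for odd d the sign is 1 anyway. As
  \<open>prime_residue\<close> and \<open>Legendre_eq\<close> require a prime modulus, the locale is
  reinterpreted at each q.\<close>

lemma jacobi_symbol_eq:
  assumes N: "N = int N'" "odd N'" "[N' = b] (mod l)"
    and a: "modulo N (\<lambda>c. of_int a - delta c ^ 2)" and cop: "Rings.coprime a N"
  shows "jacobi_symbol a N' = (-1) ^ (d - 1)"
proof -
  have N'0: "N' > 0" using N_pos N by simp
  have "\<exists>R. [prod_mset A = b ^ R] (mod l) \<and> (\<Prod>p\<in>#A. Legendre a (int p)) = (-1) ^ (R * (d - 1))"
    if "A \<subseteq># prime_factorization N'" for A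
    using that
  proof (induction A)
    case empty
    show ?case by (intro exI[of _ 0]) simp
  next
    case (add q A)
    obtain R where R: "[prod_mset A = b ^ R] (mod l)" "(\<Prod>p\<in>#A. Legendre a (int p)) = (-1) ^ (R * (d - 1))"
      using add by (meson subset_mset.dual_order.trans mset_subset_eq_add_right mset_subset_eq_insertD subset_mset.less_imp_le)
    have "q \<in># prime_factorization N'" using add.prems by (meson mset_subset_eq_insertD)
    hence q: "prime q" "q dvd N'" by (auto simp: in_prime_factors_iff)
    have qN: "int q dvd N" using q N by simp
    interpret q: norm_mod l d D g t E0 M' u m0 "int q"
      using norm_mod_dvd[OF qN] q prime_gt_0_nat by blast
    have "odd q" using q N(2) dvd_trans by blast
    obtain r where r: "[q = b ^ r] (mod l)" using q.prime_residue[OF q(1)] by blast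
    have "\<not> int q dvd a"
    proof
      assume "int q dvd a"
      hence "is_unit (int q)" by (rule coprime_common_divisor[OF cop _ qN])
      thus False using q(1) by auto
    qed
    hence "Legendre a (int q) = (-1) ^ (r * (d - 1))"
      using q.Legendre_eq[OF q(1) \<open>odd q\<close> refl r] modulo_dvd[OF qN a] by blast
    moreover have "[q * prod_mset A = b ^ r * b ^ R] (mod l)" by (intro cong_mult r R)
    moreover have "(-1 :: int) ^ ((r + R) * (d - 1)) = (-1) ^ (r * (d - 1)) * (-1) ^ (R * (d - 1))"
      by (simp only: add_mult_distrib power_add)
    ultimately show ?case using R(2)
      by (intro exI[of _ "r + R"]) (simp add: power_add)
  qed
  from this[of "prime_factorization N'"] obtain R where
    R: "[N' = b ^ R] (mod l)" "jacobi_symbol a N' = (-1) ^ (R * (d - 1))"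
    using N'0 by (auto simp: jacobi_symbol_def prod_mset_prime_factorization_nat)
  have "[b ^ R = b ^ 1] (mod l)" using cong_trans[OF cong_sym[OF R(1)] N(3)] by simp
  hence *: "[R = 1] (mod d)" by (simp only: b_power_cong_iff)
  show ?thesis
  proof (cases "even d")
    case True
    hence "[R = 1] (mod 2)" using * cong_dvd_modulus_nat by blast
    hence "odd R" by (simp add: cong_def odd_iff_mod_2_eq_one)
    thus ?thesis using True d_pos R(2) by simp
  next
    case False
    thus ?thesis using R(2) by simp
  qed
qed

text \<open>For a nontrivial l-th root of unity y, multiplying the sum over k < l of 1 + y + ... +
  y^(k - 1) by 1 - y gives the sum of the 1 - y^k, which is l. So root differences divide l and are
  units modulo N.\<close>

lemma modulo_zeta_difference_unit:
  assumes "\<not> [i = j] (mod l)"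
  obtains P :: "int poly" where
    "\<And>c. \<not> l dvd c \<Longrightarrow> (zeta l ^ (c * i) - zeta l ^ (c * j)) * poly (map_poly of_int P) (zeta l ^ c) = of_nat l"
proof -
  \<comment> \<open>A natural number congruent to j - i modulo l; likewise (l - 1) * i stands for
    -i.\<close>
  define e where "e = j + (l - 1) * i"
  have ie: "i + e = j + l * i" using l0 by (cases l) (simp_all add: e_def)
  have le: "\<not> l dvd e"
  proof
    assume "l dvd e"
    hence "[i + e = i] (mod l)" by (simp add: cong_def mod_add_right_eq[symmetric] dvd_eq_mod_eq_0 mod_simps)
    moreover have "[i + e = j] (mod l)" unfolding ie by (simp add: cong_def)
    ultimately show False using assms by (meson cong_sym cong_trans)
  qed
  define P :: "int poly" where "P = monom 1 ((l - 1) * i) * (\<Sum>k<l. \<Sum>s<k. monom 1 (e * s))"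
  have "(zeta l ^ (c * i) - zeta l ^ (c * j)) * poly (map_poly of_int P) (zeta l ^ c) = of_nat l" if c: "\<not> l dvd c" for c
  proof -
    define z where "z = zeta l ^ c"
    define y where "y = z ^ e"
    have zl: "z ^ l = 1" using l0 by (simp add: z_def zeta_power_eq_1_iff flip: power_mult)
    have zj: "z ^ j = z ^ i * y"
    proof -
      have "z ^ i * y = z ^ j * (z ^ l) ^ i" unfolding y_def by (simp only: power_add[symmetric] power_mult[symmetric] ie)
      thus ?thesis by (simp add: zl)
    qed
    have zi: "z ^ i * z ^ ((l - 1) * i) = 1"
    proof -
      have "i + (l - 1) * i = l * i" using l0 by (cases l) simp_all
      hence "z ^ i * z ^ ((l - 1) * i) = (z ^ l) ^ i" by (simp only: power_add[symmetric] power_mult[symmetric])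
      thus ?thesis by (simp add: zl)
    qed
    have y: "(\<Sum>k<l. y ^ k) = 0"
    proof -
      have "\<not> l dvd c * e" using c le l by (simp add: prime_dvd_mult_iff)
      thus ?thesis using sum_zeta_power[OF l0, of "c * e"] by (simp add: y_def z_def power_mult)
    qed
    have "poly (map_poly of_int P) z = z ^ ((l - 1) * i) * (\<Sum>k<l. \<Sum>s<k. y ^ s)"
      by (simp add: P_def y_def hom_distribs map_poly_monom poly_monom poly_sum power_mult)
    hence "(z ^ i - z ^ j) * poly (map_poly of_int P) z = (z ^ i * z ^ ((l - 1) * i)) * (\<Sum>k<l. (1 - y) * (\<Sum>s<k. y ^ s))"
      by (simp add: zj algebra_simps sum_distrib_left sum_distrib_right sum_subtractf)
    also have "\<dots> = (\<Sum>k<l. 1 - y ^ k)" unfolding zi one_diff_power_eq[symmetric] by simp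
    also have "\<dots> = of_nat l" by (simp add: sum_subtractf y)
    finally show ?thesis by (simp add: z_def power_mult)
  qed
  thus ?thesis by (rule that)
qed

text \<open>Conjugate families are functions and have zero divisors, whereas
  \<open>frobenius_roots\<close> asks for an integral domain. So integer polynomials represent them,
  and J collects those whose family lies in the ideal of \<open>gam\<close> and N. As n = b modulo
  l, the power map sends each root of unity exactly to the next one.\<close>

lemma nonsplit_factor:
  assumes n: "[n = b] (mod l)" and N: "N = int N'" "odd N'" "[N' = b] (mod l)"
  obtains f where "cyclic_mod n d N f" "jacobi_symbol (discriminant f) N' = (-1) ^ (d - 1)"
proof -
  define ev where "ev = (\<lambda>c (P :: int poly). poly (map_poly of_int P) (zeta l ^ c))"
  define J where "J = {P. modulo N (\<lambda>c. ev c P)}"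
  define \<rho> where "\<rho> = (\<lambda>j. monom (1 :: int) (b ^ j))"
  have ev: "ev c (P + Q) = ev c P + ev c Q" "ev c (P - Q) = ev c P - ev c Q" "ev c (P * Q) = ev c P * ev c Q"
    "ev c (P ^ i) = ev c P ^ i" "ev c 1 = 1" "ev c 0 = 0" for c P Q i
    by (simp_all add: ev_def hom_distribs)
  have ev_int: "ev c (of_int a) = of_int a" for c a
  proof -
    have "(of_int a :: int poly) = monom a 0" by (simp add: of_int_poly monom_0)
    thus ?thesis by (simp add: ev_def map_poly_monom poly_monom)
  qed
  have ev\<rho>: "ev c (\<rho> j) = zeta l ^ (c * b ^ j)" for c j
    by (simp add: ev_def \<rho>_def map_poly_monom poly_monom power_mult)
  have fam: "conj_family l (\<lambda>c. ev c P)" for P unfolding ev_def by (rule conj_family_poly)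
  have JI: "P \<in> J" if "\<And>c. \<not> l dvd c \<Longrightarrow> ev c P = 0" for P
    unfolding J_def mem_Collect_eq by (rule modulo_cong[OF modulo_0]) (simp add: that)
  have J: "ring_ideal J"
    unfolding ring_ideal_def J_def using modulo_0 modulo_add modulo_mult[OF _ fam] by (simp add: ev)
  have of_int: "of_int a \<in> J \<longleftrightarrow> N dvd a" for a
    by (simp add: J_def ev_int modulo_of_int_iff)
  interpret frobenius_roots J N n d \<rho>
  proof
    show "\<rho> j ^ n - \<rho> (Suc j) \<in> J" for j
    proof (rule JI)
      fix c
      have "[c * b ^ j * n = c * b ^ j * b] (mod l)" by (intro cong_mult cong_refl n)
      thus "ev c (\<rho> j ^ n - \<rho> (Suc j)) = 0"
        unfolding ev ev\<rho> power_mult[symmetric] using zeta_power_eq_iff[OF l0] by (simp add: mult_ac)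
    qed
    show "\<rho> (j + d) - \<rho> j \<in> J" for j
      by (rule JI) (simp only: ev ev\<rho> zeta_b_period diff_self)
    show "\<exists>v. (\<rho> i - \<rho> j) * v - 1 \<in> J" if ij: "i < d" "j < d" "i \<noteq> j" for i j
    proof -
      have "\<not> [b ^ i = b ^ j] (mod l)" unfolding b_power_cong_iff using ij by (simp add: cong_def)
      then obtain P :: "int poly" where P: "\<And>c. \<not> l dvd c \<Longrightarrow> (zeta l ^ (c * b ^ i) - zeta l ^ (c * b ^ j)) *
          poly (map_poly of_int P) (zeta l ^ c) = of_nat l"
        using modulo_zeta_difference_unit by blast
      have "Rings.coprime (int l) N" using N_l by (simp add: ac_simps)
      from cong_solve_coprime_int[OF this] obtain w where "[int l * w = 1] (mod N)" by auto
      hence w: "int l * w - 1 \<in> {a. N dvd a}" by (simp add: cong_iff_dvd_diff)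
      have "modulo N (\<lambda>c. of_int (int l * w - 1))" using w by (simp only: modulo_of_int_iff mem_Collect_eq)
      hence "(\<rho> i - \<rho> j) * (P * of_int w) - 1 \<in> J"
        unfolding J_def mem_Collect_eq
      proof (rule modulo_cong)
        fix c assume "\<not> l dvd c"
        from P[OF this] show "of_int (int l * w - 1) = ev c ((\<rho> i - \<rho> j) * (P * of_int w) - 1)"
          unfolding ev ev_int ev\<rho> mult.assoc[symmetric] by (simp add: ev_def)
      qed
      thus ?thesis by blast
    qed
    show "\<exists>v. \<rho> j * v - 1 \<in> J" for j
    proof (intro exI[of _ "monom 1 ((l - 1) * b ^ j)"] JI)
      fix c
      have "b ^ j + (l - 1) * b ^ j = l * b ^ j" using l0 by (cases l) simp_all
      hence e: "\<rho> j * monom 1 ((l - 1) * b ^ j) = monom 1 (l * b ^ j)"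
        by (simp only: \<rho>_def mult_monom mult_1)
      have "(zeta l ^ c) ^ (l * b ^ j) = 1"
        using l0 by (simp add: zeta_power_eq_1_iff flip: power_mult)
      thus "ev c (\<rho> j * monom 1 ((l - 1) * b ^ j) - 1) = 0"
        unfolding e ev by (simp add: ev_def map_poly_monom poly_monom)
    qed
    show "\<exists>a. of_int a - coeff (\<Prod>j<d. [:- \<rho> j, 1:]) k \<in> J" for k
    proof -
      define C where "C = coeff (\<Prod>j<d. [:- \<rho> j, 1:]) k"
      have C: "ev c C = coeff (\<Prod>j<d. [:- (zeta l ^ (c * b ^ j)), 1:]) k" for c
      proof -
        interpret h: comm_ring_hom "ev c"
          by unfold_locales (simp_all add: ev)
        interpret hp: map_poly_comm_ring_hom "ev c" ..
        have "ev c C = coeff (map_poly (ev c) (\<Prod>j<d. [:- \<rho> j, 1:])) k" by (simp add: C_def)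
        also have "map_poly (ev c) (\<Prod>j<d. [:- \<rho> j, 1:]) = (\<Prod>j<d. map_poly (ev c) [:- \<rho> j, 1:])"
          by (rule hp.hom_prod)
        also have "\<dots> = (\<Prod>j<d. [:- (zeta l ^ (c * b ^ j)), 1:])"
          by (intro prod.cong refl) (simp add: h.map_poly_pCons_hom h.hom_uminus ev\<rho> ev)
        finally show ?thesis .
      qed
      \<comment> \<open>Passing from c to c * b rotates the roots, so each coefficient is fixed by b
        and has an integer representative.\<close>
      have "ev (c * b) C = ev c C" for c
        using prod_shift_cyclic[of "\<lambda>j. [:- (zeta l ^ (c * b ^ j)), 1:]" d 1] zeta_b_period[of c]
        by (simp add: C mult.assoc)
      from modulo_representative[OF fam this] show ?thesis
        unfolding J_def C_def[symmetric] by (simp add: ev ev_int)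
    qed
  qed (use J of_int N_pos d_pos in auto)
  obtain f where f: "cyclic_mod n d N f" "of_int (discriminant f) - (\<Prod>j<d. \<Prod>i<j. (\<rho> i - \<rho> j)\<^sup>2) \<in> J"
    using exists_cyclic_mod by blast
  have "modulo N (\<lambda>c. ev c (of_int (discriminant f) - (\<Prod>j<d. \<Prod>i<j. (\<rho> i - \<rho> j)\<^sup>2)))"
    using f(2) by (simp add: J_def)
  hence "modulo N (\<lambda>c. of_int (discriminant f) - delta c ^ 2)"
  proof (rule modulo_cong)
    fix c
    interpret h: comm_ring_hom "ev c"
      by unfold_locales (simp_all add: ev)
    show "ev c (of_int (discriminant f) - (\<Prod>j<d. \<Prod>i<j. (\<rho> i - \<rho> j)\<^sup>2)) = of_int (discriminant f) - delta c ^ 2"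
      by (simp add: h.hom_prod ev ev_int ev\<rho> delta_def prod_power_distrib)
  qed
  moreover have "Rings.coprime (discriminant f) N" using f(1) by (simp add: cyclic_mod_def)
  ultimately have "jacobi_symbol (discriminant f) N' = (-1) ^ (d - 1)"
    by (rule jacobi_symbol_eq[OF N])
  thus ?thesis using that f(1) by blast
qed

end

section \<open>Choice of the norm\<close>

context cyclotomic_subfield
begin

lemma th_0: "th t 0 = of_int ((t - 1) ^ d)"
  by (simp add: th_def)

lemma prod_one_plus_multiple:
  fixes y :: "'i \<Rightarrow> nat \<Rightarrow> complex"
  assumes "finite A" "\<And>i. i \<in> A \<Longrightarrow> conj_family l (y i)"
  shows "\<exists>\<kappa>. conj_family l \<kappa> \<and> (\<forall>c. (\<Prod>i\<in>A. 1 + of_int m * y i c) = 1 + of_int m * \<kappa> c)"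
  using assms
proof induction
  case empty
  show ?case using conj_family_of_int[of l 0] by (intro exI[of _ "\<lambda>c. 0"]) auto
next
  case (insert i A)
  obtain \<kappa> where \<kappa>: "conj_family l \<kappa>" "\<And>c. (\<Prod>i\<in>A. 1 + of_int m * y i c) = 1 + of_int m * \<kappa> c"
    using insert.IH insert.prems by auto
  have "conj_family l (\<lambda>c. y i c + \<kappa> c + of_int m * (y i c * \<kappa> c))"
    using insert.prems \<kappa>(1) by (intro conj_family_add conj_family_mult conj_family_of_int) auto
  moreover have "(\<Prod>i\<in>insert i A. 1 + of_int m * y i c) = 1 + of_int m * (y i c + \<kappa> c + of_int m * (y i c * \<kappa> c))" for c
    using insert.hyps by (simp add: \<kappa>(2) algebra_simps)
  ultimately show ?case by (intro exI[of _ "\<lambda>c. y i c + \<kappa> c + of_int m * (y i c * \<kappa> c)"]) simp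
qed

text \<open>The conjugates may be complex, so positivity is not seen factorwise. Each factor is u up
  to a relative error 1 / (2 * D), so the product differs from u^D by a relative error of at most
  exp (1 / 2) - 1, which is below 1.\<close>

lemma positive_if_near_power:
  fixes z :: "nat \<Rightarrow> complex" and u m :: int
  assumes eq: "(\<Prod>i<D. of_int u - z i) = of_int m" and u: "u > 0"
    and z: "\<And>i. i < D \<Longrightarrow> 2 * real D * norm (z i) \<le> of_int u"
  shows "m > 0"
proof -
  define x where "x = (\<lambda>i. - z i / of_int u)"
  define P where "P = (\<Prod>i<D. 1 + x i)"
  have xn: "norm (x i) \<le> 1 / (2 * real D)" if "i < D" for i
  proof -
    have "norm (x i) = norm (z i) / of_int u" using u by (simp add: x_def norm_divide)
    also have "\<dots> \<le> 1 / (2 * real D)" using z[OF that] u D_pos by (simp add: field_simps)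
    finally show ?thesis .
  qed
  have "norm (P - 1) \<le> (\<Prod>i<D. 1 + norm (x i)) - 1"
    unfolding P_def by (rule norm_prod_minus1_le_prod_minus1)
  also have "(\<Prod>i<D. 1 + norm (x i)) \<le> (\<Prod>i<D. exp (1 / (2 * real D)))"
  proof (rule prod_mono)
    fix i assume "i \<in> {..<D}"
    hence "1 + norm (x i) \<le> 1 + 1 / (2 * real D)" using xn by simp
    also have "\<dots> \<le> exp (1 / (2 * real D))" by (rule exp_ge_add_one_self)
    finally show "0 \<le> 1 + norm (x i) \<and> 1 + norm (x i) \<le> exp (1 / (2 * real D))" by (simp add: add_nonneg_nonneg)
  qed
  also have "(\<Prod>i<D. exp (1 / (2 * real D))) = exp (1 / 2)"
    using D_pos by (simp add: exp_of_nat_mult[symmetric])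
  also have "exp (1 / 2 :: real) - 1 < 1"
  proof -
    have "exp (1 / 2 :: real) ^ 2 = exp 1" by (simp flip: exp_of_nat_mult)
    also have "\<dots> < 2 ^ 2" using exp_le by simp
    finally have "exp (1 / 2 :: real) < 2" by (rule power_less_imp_less_base) simp
    thus ?thesis by simp
  qed
  finally have "norm (P - 1) < 1" by simp
  hence "\<bar>Re (P - 1)\<bar> < 1" using abs_Re_le_cmod[of "P - 1"] by linarith
  hence ReP: "Re P > 0" by simp
  have "of_int m = (\<Prod>i<D. of_int u * (1 + x i))"
    unfolding eq[symmetric] using u by (intro prod.cong) (auto simp: x_def field_simps)
  also have "\<dots> = of_int (u ^ D) * P" by (simp add: prod.distrib P_def)
  finally have "Re (of_int m) = of_int (u ^ D) * Re P" by simp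
  hence "of_int m = of_int (u ^ D) * Re P" by simp
  moreover have "(of_int (u ^ D) :: real) > 0" using u by simp
  ultimately have "(of_int m :: real) > 0" using ReP by simp
  thus ?thesis by simp
qed

text \<open>As t is fixed before M', the constant C depends on neither M' nor m. It exceeds
  \<open>E0\<close> and 2 in absolute value; being 1 modulo all primes up to C other than l, and b
  modulo l, the norm is odd and coprime to E.\<close>

lemma exists_norm_number:
  obtains C :: nat where
    "\<And>M'. M' > 0 \<Longrightarrow> \<not> l dvd M' \<Longrightarrow> (\<And>p. prime p \<Longrightarrow> p \<le> C \<Longrightarrow> p \<noteq> l \<Longrightarrow> p dvd M') \<Longrightarrow>
      \<exists>m>0. m \<le> (C * M') ^ D \<and> odd m \<and> [m = 1] (mod M') \<and> [m = b] (mod l) \<and>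
        (\<forall>N n. N dvd m \<longrightarrow> [N = b] (mod l) \<longrightarrow> [n = b] (mod l) \<longrightarrow>
          (\<exists>f. cyclic_mod n d (int N) f \<and> jacobi_symbol (discriminant f) N = (-1) ^ (d - 1)))"
proof -
  obtain t where t: "disc_family t 1 \<noteq> 0" using disc_family_nonzero by blast
  obtain E0 where E0: "\<And>c. \<not> l dvd c \<Longrightarrow> disc_family t c = of_int E0"
    using invariant_family_int[OF disc_family_family disc_family_invariant] by metis
  have E0_nz: "E0 \<noteq> 0" using t E0[of 1] l1 by auto
  define T where "T = nat \<lceil>Max ((\<lambda>i. norm (th t (g ^ i))) ` {..<D})\<rceil>"
  have T: "norm (th t (g ^ i)) \<le> real T" if "i < D" for i
  proof -
    have "norm (th t (g ^ i)) \<le> Max ((\<lambda>i. norm (th t (g ^ i))) ` {..<D})" using that by (intro Max_ge) auto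
    also have "\<dots> \<le> real T" unfolding T_def by (rule real_nat_ceiling_ge)
    finally show ?thesis .
  qed
  define K where "K = 2 * D * T + 1"
  define C where "C = nat \<bar>E0\<bar> + 2 * l * (K + 1) + 2"
  have "\<exists>m>0. m \<le> (C * M') ^ D \<and> odd m \<and> [m = 1] (mod M') \<and> [m = b] (mod l) \<and>
        (\<forall>N n. N dvd m \<longrightarrow> [N = b] (mod l) \<longrightarrow> [n = b] (mod l) \<longrightarrow>
          (\<exists>f. cyclic_mod n d (int N) f \<and> jacobi_symbol (discriminant f) N = (-1) ^ (d - 1)))"
    if M': "M' > 0" "\<not> l dvd M'" "\<And>p. prime p \<Longrightarrow> p \<le> C \<Longrightarrow> p \<noteq> l \<Longrightarrow> p dvd M'" for M'
  proof -
    \<comment> \<open>At exponent 0 the norm is \<open>(u - M' * (t - 1) ^ d) ^ D\<close>. This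
      residue of u modulo l turns the base into g, hence the norm into
      \<open>g ^ D = b\<close>.\<close>
    define a where "a = nat ((int M' * (t - 1) ^ d + int g) mod int l)"
    have a: "int a = (int M' * (t - 1) ^ d + int g) mod int l" using l0 by (simp add: a_def)
    have copM: "Rings.coprime M' l"
      using prime_imp_coprime[OF l M'(2)] by (simp add: ac_simps)
    obtain u0 where u0: "u0 < M' * l" "[u0 = 1] (mod M')" "[u0 = a] (mod l)"
      using binary_chinese_remainder_unique_nat[OF copM, of 1 a] M'(1) l0 by auto
    \<comment> \<open>The added multiple of M' * l keeps both residues and makes u at least 2 * D
      times as large as every conjugate of \<open>M' * th t\<close>, so that the norm is
      positive.\<close>
    define w where "w = u0 + M' * l * K"
    define u where "u = int w"
    have wM: "[w = 1] (mod M')"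
    proof -
      have "[u0 + M' * (l * K) = u0] (mod M')" by (simp add: cong_def)
      thus ?thesis using u0(2) unfolding w_def by (simp only: mult.assoc) (rule cong_trans)
    qed
    have wl: "[w = a] (mod l)"
    proof -
      have "[u0 + l * (M' * K) = u0] (mod l)" by (simp add: cong_def)
      thus ?thesis using u0(3) unfolding w_def by (simp only: mult.assoc mult.left_commute[of M']) (rule cong_trans)
    qed
    interpret norm_form l d D g t E0 "int M'" u
      by unfold_locales (rule E0)
    obtain m0 r where m0: "\<And>c. \<not> l dvd c \<Longrightarrow> norm_family c = of_int m0" and
      r: "norm_family 0 = of_int r" "int l dvd m0 - r"
      using invariant_family_int[OF norm_family_family norm_family_invariant] by metis
    have one: "\<not> l dvd 1" using l1 by simp
    have w0: "w > 0" using M' l0 by (simp add: w_def K_def)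
    have m0_pos: "m0 > 0"
    proof (rule positive_if_near_power)
      show "(\<Prod>i<D. of_int u - of_int (int M') * th t (g ^ i)) = of_int m0"
        using m0[OF one] by (simp add: norm_family_def gam_def)
      show "u > 0" using w0 by (simp add: u_def)
      fix i assume i: "i < D"
      have "2 * real D * norm (of_int (int M') * th t (g ^ i)) \<le> 2 * real D * (real M' * real T)"
        using T[OF i] by (intro mult_left_mono) (auto simp: norm_mult intro!: mult_left_mono)
      also have "\<dots> = real (M' * 1 * (2 * D * T))" by simp
      also have "\<dots> \<le> real (M' * l * K)"
        unfolding of_nat_le_iff using l0 by (intro mult_mono) (auto simp: K_def)
      also have "\<dots> \<le> of_int u" by (simp add: u_def w_def)
      finally show "2 * real D * norm (of_int (int M') * th t (g ^ i)) \<le> of_int u" .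
    qed
    define m where "m = nat m0"
    have m: "int m = m0" using m0_pos by (simp add: m_def)
    have mb: "[m = b] (mod l)"
    proof -
      have "of_int r = (\<Prod>i<D. of_int u - of_int (int M') * th t 0)"
        using r(1) by (simp add: norm_family_def gam_def)
      also have "\<dots> = of_int ((u - int M' * (t - 1) ^ d) ^ D)" by (simp add: th_0)
      finally have "r = (u - int M' * (t - 1) ^ d) ^ D" by (simp only: of_int_eq_iff)
      moreover have "[u - int M' * (t - 1) ^ d = int g] (mod int l)"
      proof -
        have "[int w = int a] (mod int l)" using wl by (simp only: cong_int_iff)
        hence "[u = int M' * (t - 1) ^ d + int g] (mod int l)" unfolding u_def a by (simp add: cong_def)
        from cong_diff[OF this cong_refl[of "int M' * (t - 1) ^ d"]] show ?thesis by simp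
      qed
      ultimately have "[r = int g ^ D] (mod int l)" by (simp add: cong_pow)
      moreover have "[m0 = r] (mod int l)" using r(2) by (simp add: cong_iff_dvd_diff)
      ultimately have "[int m = int b] (mod int l)" unfolding m b_def by (metis cong_trans of_nat_power)
      thus ?thesis by (simp only: cong_int_iff)
    qed
    have m1: "[m = 1] (mod M')"
    proof -
      have "[int w = int 1] (mod int M')" using wM by (simp only: cong_int_iff)
      then obtain z where "u - 1 = int M' * z" by (auto simp: u_def cong_iff_dvd_diff elim: dvdE)
      hence "u = 1 + int M' * z" by simp
      hence "(of_int u :: complex) = of_int (1 + int M' * z)" by (rule arg_cong)
      hence z: "(of_int u :: complex) = 1 + of_int (int M') * of_int z" by simp
      have gam_eq: "gam c = 1 + of_int (int M') * (of_int z - th t c)" for c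
        unfolding gam_def z by (simp add: algebra_simps)
      have fam: "conj_family l (\<lambda>c. of_int z - th t (c * g ^ i))" for i
        by (intro conj_family_diff conj_family_of_int conj_family_scale[OF th_family])
      obtain \<kappa> where \<kappa>: "conj_family l \<kappa>"
        "\<And>c. (\<Prod>i<D. 1 + of_int (int M') * (of_int z - th t (c * g ^ i))) = 1 + of_int (int M') * \<kappa> c"
        using prod_one_plus_multiple[of "{..<D}" "\<lambda>i c. of_int z - th t (c * g ^ i)" "int M'"] fam by auto
      have "int M' dvd m0 - 1"
      proof (rule family_int_eq[OF \<kappa>(1)])
        fix c assume c: "\<not> l dvd c"
        have "of_int m0 = (\<Prod>i<D. 1 + of_int (int M') * (of_int z - th t (c * g ^ i)))"
          using m0[OF c] unfolding norm_family_def gam_eq by simp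
        thus "of_int (m0 - 1) = of_int (int M') * \<kappa> c" unfolding \<kappa>(2) by simp
      qed (use M' in simp)
      hence "[int m = int 1] (mod int M')" by (simp add: m cong_iff_dvd_diff)
      thus ?thesis by (simp only: cong_int_iff)
    qed
    have not_dvd_b: "\<not> l dvd b" using not_dvd_mult_b[of 1 1] l1 by simp
    have lm: "\<not> l dvd m" using not_dvd_b cong_dvd_iff[OF mb] by blast
    have pm: "\<not> p dvd m" if p: "prime p" "p \<le> C" for p
    proof (cases "p = l")
      case False
      hence "p dvd M'" using M'(3) p by blast
      hence "[m = 1] (mod p)" using cong_dvd_modulus_nat[OF m1] by blast
      thus ?thesis using p(1) cong_dvd_iff not_prime_unit by blast
    qed (use lm in simp)
    have copE: "Rings.coprime (int m) E" "Rings.coprime (int m) (int l)"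
    proof -
      have "Rings.coprime m (nat \<bar>E0\<bar>)"
      proof (rule coprime_natI)
        fix p assume p: "prime p" "p dvd m" "p dvd nat \<bar>E0\<bar>"
        have "p \<le> nat \<bar>E0\<bar>" using p(3) E0_nz by (intro dvd_imp_le) auto
        hence "p \<le> C" by (simp add: C_def)
        thus False using pm p by blast
      qed
      hence "Rings.coprime (int m) (int (nat \<bar>E0\<bar>))" by (simp only: coprime_int_iff)
      hence 1: "Rings.coprime (int m) E0" by simp
      have "Rings.coprime m M'" using m1 cong_imp_coprime[OF cong_sym[OF m1]] by simp
      hence "Rings.coprime (int m) (int M')" by (simp only: coprime_int_iff)
      thus "Rings.coprime (int m) E" using 1 by (simp add: E_def)
      have "Rings.coprime m l" using prime_imp_coprime[OF l lm] by (simp add: ac_simps)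
      thus "Rings.coprime (int m) (int l)" by (simp only: coprime_int_iff)
    qed
    have "odd m" using pm[of 2] by (simp add: C_def)
    moreover have "m \<le> (C * M') ^ D"
    proof -
      have "real m = norm (of_int m0 :: complex)" using m0_pos by (simp add: m_def)
      also have "\<dots> = (\<Prod>i<D. norm (of_int u - of_int (int M') * th t (g ^ i)))"
        using m0[OF one] by (simp add: norm_family_def gam_def prod_norm)
      also have "\<dots> \<le> (\<Prod>i<D. real (C * M'))"
      proof (rule prod_mono)
        fix i assume "i \<in> {..<D}"
        hence i: "i < D" by simp
        have "norm (of_int u - of_int (int M') * th t (g ^ i)) \<le> norm (of_int u :: complex) + norm (of_int (int M') * th t (g ^ i))"
          by (rule norm_triangle_ineq4)
        also have "\<dots> \<le> real w + real M' * real T"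
          using T[OF i] by (intro add_mono) (auto simp: norm_mult u_def intro!: mult_left_mono)
        also have "\<dots> = real (w + M' * T)" by simp
        also have "\<dots> \<le> real (C * M')"
        proof -
          have "T \<le> 2 * D * T" using D_pos by simp
          also have "\<dots> \<le> 1 * K" by (simp add: K_def)
          also have "\<dots> \<le> l * K" using l0 by (intro mult_right_mono) auto
          finally have "M' * T \<le> M' * (l * K)" by (intro mult_left_mono) auto
          moreover have "w \<le> M' * (l * (K + 1))" using u0(1) by (simp add: w_def algebra_simps)
          moreover have "M' * (2 * l * (K + 1)) = M' * (l * (K + 1)) + M' * (l * K) + M' * l"
            by (simp add: algebra_simps)
          ultimately have "w + M' * T \<le> M' * (2 * l * (K + 1))" by linarith
          also have "\<dots> \<le> C * M'" unfolding mult.commute[of M'] by (intro mult_right_mono) (simp_all add: C_def)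
          finally show ?thesis by (simp only: of_nat_le_iff)
        qed
        finally show "0 \<le> norm (of_int u - of_int (int M') * th t (g ^ i)) \<and>
          norm (of_int u - of_int (int M') * th t (g ^ i)) \<le> real (C * M')" by simp
      qed
      also have "\<dots> = real ((C * M') ^ D)" by simp
      finally show ?thesis by (simp only: of_nat_le_iff)
    qed
    moreover have "\<exists>f. cyclic_mod n d (int N) f \<and> jacobi_symbol (discriminant f) N = (-1) ^ (d - 1)"
      if N: "N dvd m" "[N = b] (mod l)" "[n = b] (mod l)" for N n
    proof -
      have N0: "N > 0" using N(1) m0_pos m by (auto intro!: Nat.gr0I)
      have NM: "int N dvd int m" using N(1) by simp
      interpret norm_mod l d D g t E0 "int M'" u m0 "int N"
      proof
        show "Rings.coprime (int N) E" using copE(1) NM coprime_divisors dvd_refl by blast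
        show "Rings.coprime (int N) (int l)" using copE(2) NM coprime_divisors dvd_refl by blast
      qed (use m0 m0_pos N0 NM m in auto)
      have "odd N" using \<open>odd m\<close> N(1) dvd_trans by blast
      from nonsplit_factor[OF N(3) refl this N(2)] show ?thesis by metis
    qed
    ultimately show ?thesis using mb m1 m0_pos m by (intro exI[of _ m]) auto
  qed
  thus ?thesis by (rule that)
qed

end

section \<open>Pseudoprimes with a given split part\<close>

text \<open>A maximal subset of \<open>G\<close> without two elements of one orbit reaches all of
  \<open>G\<close> by at most d powers of each element. The residues outside \<open>G\<close> are
  roots of a^r = 1, at most r <= (p - 1) / 2 in number because l >= 2.\<close>

lemma orbit_transversal:
  fixes p l n d :: nat
  assumes p: "prime p" and l: "prime l" and pl: "[p = 1] (mod l)" and d: "d \<ge> 1" and n: "n > 0"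
    and nd: "[n ^ d = 1] (mod (p - 1))"
  obtains R where "R \<subseteq> {1..<p}" "\<And>a. a \<in> R \<Longrightarrow> \<not> [a ^ ((p - 1) div l) = 1] (mod p)"
    "\<And>x y j. x \<in> R \<Longrightarrow> y \<in> R \<Longrightarrow> j < d \<Longrightarrow> [y = x ^ (n ^ j)] (mod p) \<Longrightarrow> x = y"
    "(real p - 1) / (2 * real d) \<le> real (card R)"
proof -
  define r where "r = (p - 1) div l"
  define G where "G = {a\<in>{1..<p}. \<not> [a ^ r = 1] (mod p)}"
  define indep where "indep = (\<lambda>R. \<forall>x\<in>R. \<forall>y\<in>R. \<forall>j<d. [y = x ^ (n ^ j)] (mod p) \<longrightarrow> x = y)"
  have p1: "p > 1" and l2: "l \<ge> 2" using p l prime_gt_1_nat prime_ge_2_nat by blast+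
  have "l dvd p - 1" using pl p1 by (simp add: cong_altdef_nat)
  hence rl: "p - 1 = l * r" by (simp add: r_def)
  have r0: "r > 0" using rl p1 by (cases r) auto
  have "2 * r \<le> p - 1" unfolding rl using l2 by simp
  have finG: "finite G" by (simp add: G_def)
  have Gp: "a < p" "\<not> p dvd a" if "a \<in> G" for a using that by (auto simp: G_def dest: dvd_imp_le)
  have "card {1..<p} \<le> card G + card {a\<in>{..<p}. [a ^ r = 1] (mod p)}"
    by (intro order_trans[OF card_mono card_Un_le]) (auto simp: G_def)
  moreover have "card {a\<in>{..<p}. [a ^ r = 1] (mod p)} \<le> r"
    using roots_mod_prime_bound[OF p r0, of 1] by simp
  ultimately have cardG: "p - 1 \<le> 2 * card G" using \<open>2 * r \<le> p - 1\<close> by simp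
  have "finite {R \<in> Pow G. indep R}" using finG by simp
  moreover have "{R \<in> Pow G. indep R} \<noteq> {}" by (auto simp: indep_def intro!: exI[of _ "{}"])
  ultimately obtain R where R: "R \<in> {R \<in> Pow G. indep R}"
    and max: "\<And>R'. R' \<in> {R \<in> Pow G. indep R} \<Longrightarrow> R \<le> R' \<Longrightarrow> R = R'"
    using finite_has_maximal[of "{R \<in> Pow G. indep R}"] by metis
  have RG: "R \<subseteq> G" and ind: "indep R" using R by auto
  have finR: "finite R" using RG finG finite_subset by blast
  have cover: "\<exists>x\<in>R. \<exists>j<d. [a = x ^ (n ^ j)] (mod p)" if a: "a \<in> G" for a
  proof (cases "a \<in> R")
    case True
    thus ?thesis using d by (intro bexI[of _ a] exI[of _ 0]) auto
  next
    case False
    hence "\<not> indep (insert a R)" using max[of "insert a R"] RG a by auto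
    then obtain x y j where xy: "x \<in> insert a R" "y \<in> insert a R" "j < d" "[y = x ^ (n ^ j)] (mod p)" "x \<noteq> y"
      unfolding indep_def by blast
    consider "x \<in> R" "y \<in> R" | "x \<in> R" "y = a" | "x = a" "y \<in> R" using xy by blast
    thus ?thesis
    proof cases
      case 1
      thus ?thesis using ind xy unfolding indep_def by blast
    next
      case 2
      thus ?thesis using xy by blast
    next
      case 3
      have "j \<noteq> 0"
      proof
        assume "j = 0"
        hence "[y = a] (mod p)" using xy 3 by simp
        moreover have "y < p" "a < p" using Gp 3 RG a by auto
        ultimately show False using xy(5) 3 by (simp add: cong_def)
      qed
      \<comment> \<open>The relation is reversible: since n^d = 1 modulo p - 1, the power n^(d - j)
        undoes n^j.\<close>
      have "[y ^ (n ^ (d - j)) = (a ^ (n ^ j)) ^ (n ^ (d - j))] (mod p)"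
        using xy(4) 3 by (intro cong_pow) simp
      also have "(a ^ (n ^ j)) ^ (n ^ (d - j)) = a ^ (n ^ d)"
        using xy(3) by (simp flip: power_mult power_add)
      also have "[a ^ (n ^ d) = a] (mod p)"
        using fermat_theorem[OF p Gp(2)[OF a]] nd n by (intro cong_power_eq_self) auto
      finally have "[a = y ^ (n ^ (d - j))] (mod p)" by (rule cong_sym)
      moreover have "d - j < d" using \<open>j \<noteq> 0\<close> xy(3) by simp
      ultimately show ?thesis using 3 by blast
    qed
  qed
  have "G \<subseteq> (\<Union>x\<in>R. (\<lambda>j. x ^ (n ^ j) mod p) ` {..<d})"
  proof
    fix a assume a: "a \<in> G"
    obtain x j where "x \<in> R" "j < d" "[a = x ^ (n ^ j)] (mod p)" using cover[OF a] by blast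
    moreover from this have "a = x ^ (n ^ j) mod p" using Gp(1)[OF a] by (simp add: cong_def)
    ultimately show "a \<in> (\<Union>x\<in>R. (\<lambda>j. x ^ (n ^ j) mod p) ` {..<d})" by blast
  qed
  hence "card G \<le> card (\<Union>x\<in>R. (\<lambda>j. x ^ (n ^ j) mod p) ` {..<d})" using finR by (intro card_mono) auto
  also have "\<dots> \<le> (\<Sum>x\<in>R. card ((\<lambda>j. x ^ (n ^ j) mod p) ` {..<d}))" by (rule card_UN_le[OF finR])
  also have "\<dots> \<le> (\<Sum>x\<in>R. d)" by (intro sum_mono order_trans[OF card_image_le]) auto
  finally have "card G \<le> card R * d" by simp
  hence "p - 1 \<le> 2 * d * card R" using cardG by (simp add: mult_ac)
  hence "real (p - 1) \<le> real (2 * d * card R)" by (simp only: of_nat_le_iff)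
  hence "(real p - 1) / (2 * real d) \<le> real (card R)" using p1 d by (simp add: field_simps of_nat_diff)
  thus ?thesis using RG ind unfolding G_def r_def indep_def by (intro that[of R]) blast+
qed

text \<open>Used to move those primes of the norm that are 1 modulo l to the split part, so that the
  two parts of n are coprime.\<close>

lemma split_by_prime_property:
  fixes m :: nat
  assumes "m > 0"
  shows "\<exists>a c. m = a * c \<and> (\<forall>q. prime q \<longrightarrow> q dvd a \<longrightarrow> P q) \<and> (\<forall>q. prime q \<longrightarrow> q dvd c \<longrightarrow> \<not> P q)"
  using assms
proof (induction m rule: prime_divisors_induct)
  case (unit x)
  thus ?case by (intro exI[of _ 1]) auto
next
  case (factor p x)
  then obtain a c where ac: "x = a * c" "\<forall>q. prime q \<longrightarrow> q dvd a \<longrightarrow> P q" "\<forall>q. prime q \<longrightarrow> q dvd c \<longrightarrow> \<not> P q"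
    by auto
  show ?case
  proof (cases "P p")
    case True
    have "\<forall>q. prime q \<longrightarrow> q dvd p * a \<longrightarrow> P q"
      using ac(2) True factor(1) by (metis prime_dvd_mult_iff primes_dvd_imp_eq)
    thus ?thesis using ac by (intro exI[of _ "p * a"] exI[of _ c]) simp
  next
    case False
    have "\<forall>q. prime q \<longrightarrow> q dvd p * c \<longrightarrow> \<not> P q"
      using ac(3) False factor(1) by (metis prime_dvd_mult_iff primes_dvd_imp_eq)
    thus ?thesis using ac by (intro exI[of _ a] exI[of _ "p * c"]) simp
  qed
qed simp

lemma cong_1_if_prime_divisors:
  fixes m l :: nat
  assumes "m > 0" "\<And>q. prime q \<Longrightarrow> q dvd m \<Longrightarrow> [q = 1] (mod l)"
  shows "[m = 1] (mod l)"
  using assms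
proof (induction m rule: prime_divisors_induct)
  case (factor p x)
  have "[p * x = 1 * 1] (mod l)" using factor by (intro cong_mult) auto
  thus ?case by simp
qed auto

text \<open>One orbit representative is chosen for each p in T, and the Chinese remainder theorem
  glues the choices into one polynomial. The roots modulo p of that polynomial form the orbit of the
  chosen representative, so distinct choices from the transversals give distinct
  polynomials.\<close>

lemma frobenius_count_ge:
  fixes n1 N l n d :: nat and T :: "nat set"
  assumes n: "n = n1 * N" "odd n" "n > 1" and cop: "Rings.coprime n1 N"
    and l: "prime l" and ql: "\<And>q. prime q \<Longrightarrow> q dvd n1 \<Longrightarrow> [q = 1] (mod l)" and d: "d \<ge> 1"
    and nd: "[n ^ d = 1] (mod l)" and ni: "\<And>i. 0 < i \<Longrightarrow> i < d \<Longrightarrow> \<not> [n ^ i = 1] (mod l)"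
    and T: "finite T" "\<And>q. q \<in> T \<Longrightarrow> prime q \<and> q dvd n1 \<and> [n ^ d = 1] (mod (q - 1))"
    and f2: "cyclic_mod n d (int N) f2" "jacobi_symbol (discriminant f2) N = (-1) ^ (d - 1)"
    and \<sigma>: "\<sigma> permutes {1..d}" "cyclic_on \<sigma> {1..d}"
  shows "(\<Prod>p\<in>T. (real p - 1) / (2 * real d)) \<le> real (frobenius_count d \<sigma> n)"
proof -
  have "n1 * N > 0" using n(1,3) by linarith
  hence n1: "n1 > 0" and N0: "N > 0" by simp_all
  have n0: "n > 0" using n(3) by simp
  define good where "good = (\<lambda>p R. R \<subseteq> {1..<p} \<and> (\<forall>a\<in>R. \<not> [a ^ ((p - 1) div l) = 1] (mod p)) \<and>
    (\<forall>x\<in>R. \<forall>y\<in>R. \<forall>j<d. [y = x ^ (n ^ j)] (mod p) \<longrightarrow> x = y) \<and> (real p - 1) / (2 * real d) \<le> real (card R))"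
  have "\<forall>p\<in>T. \<exists>R. good p R"
  proof
    fix p assume "p \<in> T"
    hence p: "prime p" "p dvd n1" "[n ^ d = 1] (mod (p - 1))" using T(2) by blast+
    show "\<exists>R. good p R"
    proof (rule orbit_transversal[OF p(1) l ql[OF p(1,2)] d n0 p(3)])
      fix R assume R: "R \<subseteq> {1..<p}" "\<And>a. a \<in> R \<Longrightarrow> \<not> [a ^ ((p - 1) div l) = 1] (mod p)"
        "\<And>x y j. x \<in> R \<Longrightarrow> y \<in> R \<Longrightarrow> j < d \<Longrightarrow> [y = x ^ (n ^ j)] (mod p) \<Longrightarrow> x = y"
        "(real p - 1) / (2 * real d) \<le> real (card R)"
      have "good p R" unfolding good_def
        by (intro conjI ballI allI impI R(1,2,4)) (assumption | erule R(3), assumption+)+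
      thus ?thesis by blast
    qed
  qed
  from bchoice[OF this] obtain R where R: "\<forall>p\<in>T. good p (R p)" ..
  note Rp = bspec[OF R, unfolded good_def]
  note R1 = Rp[THEN conjunct1] and R2 = Rp[THEN conjunct2, THEN conjunct1]
    and R3 = Rp[THEN conjunct2, THEN conjunct2, THEN conjunct1]
    and R4 = Rp[THEN conjunct2, THEN conjunct2, THEN conjunct2]
  define hit where "hit = (\<lambda>r f. monic_mod (int n) f \<and> cyclic_mod n d (int n) f \<and>
      jacobi_symbol (discriminant f) n = (-1) ^ (d - 1) \<and>
      (\<forall>p\<in>T. int p dvd poly f (int (r p)) \<and>
        (\<forall>x. int p dvd poly f (int x) \<longrightarrow> (\<exists>j<d. [x = r p ^ (n ^ j)] (mod p)))))"
  have "\<exists>f. hit r f" if r: "r \<in> PiE T R" for r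
  proof -
    have rp: "r p \<in> R p" if "p \<in> T" for p using r that by (auto simp: PiE_def)
    obtain c where c: "\<forall>q\<in>T. [c = r q] (mod q)"
      using chinese_remainder_primes[OF T(1), of r] T(2) by blast
    have Tc: "[n ^ d = 1] (mod (q - 1)) \<and> \<not> q dvd c \<and> \<not> [c ^ ((q - 1) div l) = 1] (mod q)" if q: "q \<in> T" for q
    proof -
      have cr: "[c = r q] (mod q)" using c q by blast
      have "r q \<in> {1..<q}" using R1[OF q] rp[OF q] by (rule subsetD)
      have nr: "\<not> [r q ^ ((q - 1) div l) = 1] (mod q)" using R2[OF q] rp[OF q] by (rule bspec)
      have "\<not> q dvd r q" using \<open>r q \<in> {1..<q}\<close> by (auto dest: dvd_imp_le)
      hence "\<not> q dvd c" using cong_dvd_iff[OF cr] by blast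
      moreover have "\<not> [c ^ ((q - 1) div l) = 1] (mod q)"
        using nr cong_pow[OF cr, of "(q - 1) div l"] by (meson cong_sym cong_trans)
      ultimately show ?thesis using T(2)[OF q] by blast
    qed
    obtain f1 where f1: "cyclic_mod n d (int n1) f1" "jacobi_symbol (discriminant f1) n1 = 1"
      "\<And>p. p \<in> T \<Longrightarrow> int p dvd poly f1 (int c)"
      "\<And>p x. p \<in> T \<Longrightarrow> int p dvd poly f1 (int x) \<Longrightarrow> \<exists>j<d. [x = c ^ (n ^ j)] (mod p)"
      by (rule split_factor[OF n1 l ql n0 d nd ni Tc]) (use T(2) in blast)+
    have copi: "Rings.coprime (int n1) (int N)" using cop by (simp only: coprime_int_iff)
    have "n1 * N > 1" using n(1,3) by simp
    hence "int n1 * int N > 1" by (simp flip: of_nat_mult)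
    from cyclic_mod_crt[OF copi this f1(1) f2(1)] obtain f where
      f: "cyclic_mod n d (int n1 * int N) f" "monic_mod (int n1 * int N) f"
      "\<And>k. int n1 dvd coeff f k - coeff f1 k" "\<And>k. int N dvd coeff f k - coeff f2 k" by blast
    have nn: "int n1 * int N = int n" by (simp add: n)
    have degs: "degree f = degree f1" "degree f = degree f2" using f(1) f1(1) f2(1) by (auto simp: cyclic_mod_def)
    have "jacobi_symbol (discriminant f) n = jacobi_symbol (discriminant f) n1 * jacobi_symbol (discriminant f) N"
      unfolding n(1) by (rule jacobi_symbol_mult[OF n1 N0])
    also have "jacobi_symbol (discriminant f) n1 = jacobi_symbol (discriminant f1) n1"
      by (intro jacobi_symbol_cong discriminant_cong_mod degs f(3) n1)
    also have "jacobi_symbol (discriminant f) N = jacobi_symbol (discriminant f2) N"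
      by (intro jacobi_symbol_cong discriminant_cong_mod degs f(4) N0)
    finally have jac: "jacobi_symbol (discriminant f) n = (-1) ^ (d - 1)" using f1(2) f2(2) by simp
    have ff1: "int p dvd poly f x \<longleftrightarrow> int p dvd poly f1 x" if "p \<in> T" for p x
    proof -
      have J: "ring_ideal {x. int p dvd x}" by (auto simp: ring_ideal_def)
      have "int p dvd int n1" using T(2)[OF that] by simp
      hence "poly f x - poly f1 x \<in> {x. int p dvd x}"
        by (intro ring_ideal_poly_coeff_diff[OF J]) (blast intro: dvd_trans f(3))
      hence "[poly f x = poly f1 x] (mod int p)" by (simp add: cong_iff_dvd_diff)
      thus ?thesis by (rule cong_dvd_iff)
    qed
    have "int p dvd poly f (int (r p))" if p: "p \<in> T" for p
    proof -
      have "[c = r p] (mod p)" using c p by blast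
      hence "[int c = int (r p)] (mod int p)" by (simp only: cong_int_iff)
      hence "int c - int (r p) \<in> {x. int p dvd x}" by (simp add: cong_iff_dvd_diff)
      hence "poly f1 (int c) - poly f1 (int (r p)) \<in> {x. int p dvd x}"
        by (intro ring_ideal_poly_diff) (auto simp: ring_ideal_def)
      hence "[poly f1 (int c) = poly f1 (int (r p))] (mod int p)" by (simp add: cong_iff_dvd_diff)
      thus ?thesis using f1(3)[OF p] ff1[OF p] cong_dvd_iff by blast
    qed
    moreover have "\<exists>j<d. [x = r p ^ (n ^ j)] (mod p)" if p: "p \<in> T" "int p dvd poly f (int x)" for p x
    proof -
      obtain j where j: "j < d" "[x = c ^ (n ^ j)] (mod p)" using f1(4)[OF p(1)] p(2) ff1[OF p(1)] by blast
      have "[c ^ (n ^ j) = r p ^ (n ^ j)] (mod p)" using c p(1) by (intro cong_pow) blast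
      thus ?thesis using j cong_trans by blast
    qed
    ultimately show ?thesis using f(1,2) jac unfolding nn hit_def by blast
  qed
  hence "\<forall>r\<in>PiE T R. \<exists>f. hit r f" by blast
  from bchoice[OF this] obtain F where F: "\<forall>r\<in>PiE T R. hit r (F r)" ..
  have "inj_on F (PiE T R)"
  proof (rule inj_onI)
    fix r r' assume r: "r \<in> PiE T R" and r': "r' \<in> PiE T R" and eq: "F r = F r'"
    show "r = r'"
    proof (rule PiE_ext[OF r r'])
      fix p assume p: "p \<in> T"
      have "int p dvd poly (F r) (int (r' p))" using F r' p unfolding hit_def eq by blast
      moreover have "\<forall>x. int p dvd poly (F r) (int x) \<longrightarrow> (\<exists>j<d. [x = r p ^ (n ^ j)] (mod p))"
        using F r p unfolding hit_def by blast
      ultimately obtain j where "j < d" "[r' p = r p ^ (n ^ j)] (mod p)" by blast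
      moreover have "r p \<in> R p" "r' p \<in> R p" using r r' p by (auto simp: PiE_def)
      ultimately show "r p = r' p" using R3[OF p] by blast
    qed
  qed
  hence "card (PiE T R) = card (F ` PiE T R)" by (simp add: card_image)
  also have "\<dots> \<le> frobenius_count d \<sigma> n"
    by (rule card_le_frobenius_count[OF n(3,2) d \<sigma>]) (use F in \<open>auto simp: hit_def\<close>)
  finally have le: "(\<Prod>p\<in>T. real (card (R p))) \<le> real (frobenius_count d \<sigma> n)"
    unfolding card_PiE[OF T(1)] of_nat_prod[symmetric] of_nat_le_iff .
  have "(\<Prod>p\<in>T. (real p - 1) / (2 * real d)) \<le> (\<Prod>p\<in>T. real (card (R p)))"
  proof (rule prod_mono)
    fix p assume p: "p \<in> T"
    have "real p \<ge> 1" using T(2)[OF p] prime_ge_1_nat[of p] by simp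
    thus "0 \<le> (real p - 1) / (2 * real d) \<and> (real p - 1) / (2 * real d) \<le> real (card (R p))"
      using R4[OF p] by auto
  qed
  thus ?thesis using le by (rule order_trans)
qed

text \<open>The constant C is independent of M and T: the cofactor is bounded by a fixed power of M
  alone. The congruence on the product of T is what disposes of the primes up to 6 * l.\<close>

lemma exists_small_cofactor:
  fixes l d :: nat
  assumes l: "prime l" and d: "d \<ge> 1" and ld: "[l = 1] (mod d)"
    and \<sigma>: "\<sigma> permutes {1..d}" "cyclic_on \<sigma> {1..d}"
  obtains C :: nat where "\<And>M T. M > 0 \<Longrightarrow> l dvd M \<Longrightarrow> (\<And>p. prime p \<Longrightarrow> p \<le> C \<Longrightarrow> p dvd M) \<Longrightarrow>
    finite T \<Longrightarrow> T \<noteq> {} \<Longrightarrow>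
    (\<And>p. p \<in> T \<Longrightarrow> prime p \<and> [p = 1] (mod l) \<and> (p - 1) dvd M \<and> \<not> p dvd M) \<Longrightarrow>
    [\<Prod>T = 1] (mod fact (6 * l)) \<Longrightarrow>
    \<exists>m>0. m \<le> (C * M) ^ C \<and> odd (\<Prod>T * m) \<and>
      (\<Prod>p\<in>T. (real p - 1) / (2 * real d)) \<le> real (frobenius_count d \<sigma> (\<Prod>T * m))"
proof -
  have l1: "l > 1" using l prime_gt_1_nat by blast
  obtain g where g: "residue_primroot l g" using prime_primitive_root_exists[OF _ l] l1 by auto
  have "d dvd l - 1" using ld l1 by (simp add: cong_altdef_nat)
  then obtain D where "l - 1 = d * D" by (elim dvdE)
  hence D: "d * D = l - 1" by simp
  interpret cyclotomic_subfield l d D g by unfold_locales (rule l D g)+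
  obtain C0 :: nat where C0: "\<And>M'. M' > 0 \<Longrightarrow> \<not> l dvd M' \<Longrightarrow> (\<And>p. prime p \<Longrightarrow> p \<le> C0 \<Longrightarrow> p \<noteq> l \<Longrightarrow> p dvd M') \<Longrightarrow>
      \<exists>m>0. m \<le> (C0 * M') ^ D \<and> odd m \<and> [m = 1] (mod M') \<and> [m = b] (mod l) \<and>
        (\<forall>N n. N dvd m \<longrightarrow> [N = b] (mod l) \<longrightarrow> [n = b] (mod l) \<longrightarrow>
          (\<exists>f. cyclic_mod n d (int N) f \<and> jacobi_symbol (discriminant f) N = (-1) ^ (d - 1)))"
    using exists_norm_number by blast
  define C where "C = C0 + l + D + 6 * l"
  have "\<exists>m>0. m \<le> (C * M) ^ C \<and> odd (\<Prod>T * m) \<and>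
      (\<Prod>p\<in>T. (real p - 1) / (2 * real d)) \<le> real (frobenius_count d \<sigma> (\<Prod>T * m))"
    if M: "M > 0" "l dvd M" "\<And>p. prime p \<Longrightarrow> p \<le> C \<Longrightarrow> p dvd M" and T: "finite T" "T \<noteq> {}"
      and Tp: "\<And>p. p \<in> T \<Longrightarrow> prime p \<and> [p = 1] (mod l) \<and> (p - 1) dvd M \<and> \<not> p dvd M"
      and T1: "[\<Prod>T = 1] (mod fact (6 * l))" for M T
  proof -
    define s where "s = \<Prod>T"
    have s0: "s > 0" unfolding s_def using Tp by (intro prod_pos) (auto intro: prime_gt_0_nat)
    have s_primes: "q \<in> T" if "prime q" "q dvd s" for q
    proof -
      have "prime_factors s = T" unfolding s_def
        by (rule prime_factors_prod_primes[OF T(1)]) (use Tp in blast)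
      moreover have "q \<in> prime_factors s" unfolding in_prime_factors_iff using that s0 by blast
      ultimately show ?thesis by (simp only:)
    qed
    have sl: "[s = 1] (mod l)"
      by (rule cong_1_if_prime_divisors[OF s0]) (use s_primes Tp in blast)
    define k where "k = multiplicity l M"
    obtain M' where M': "M = l ^ k * M'" "\<not> l dvd M'"
      unfolding k_def using multiplicity_decompose'[of M l] M(1) l by (metis less_irrefl not_prime_unit)
    have k0: "k > 0"
    proof (rule Nat.gr0I)
      assume "k = 0"
      thus False using M' M(2) by simp
    qed
    have M'0: "M' > 0" using M' M(1) by (auto intro!: Nat.gr0I)
    have pM': "p dvd M'" if "prime p" "p dvd M" "p \<noteq> l" for p
    proof -
      have "p dvd l ^ k \<or> p dvd M'" using that M'(1) by (simp add: prime_dvd_mult_iff)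
      moreover have "\<not> p dvd l ^ k" using that(1,3) l primes_dvd_imp_eq prime_dvd_power by blast
      ultimately show ?thesis by blast
    qed
    have "\<exists>m>0. m \<le> (C0 * M') ^ D \<and> odd m \<and> [m = 1] (mod M') \<and> [m = b] (mod l) \<and>
        (\<forall>N n. N dvd m \<longrightarrow> [N = b] (mod l) \<longrightarrow> [n = b] (mod l) \<longrightarrow>
          (\<exists>f. cyclic_mod n d (int N) f \<and> jacobi_symbol (discriminant f) N = (-1) ^ (d - 1)))"
    proof (rule C0[OF M'0 M'(2)])
      fix p assume "prime p" "p \<le> C0" "p \<noteq> l"
      thus "p dvd M'" using M(3)[of p] pM' by (simp add: C_def)
    qed
    then obtain m0 where m0: "m0 > 0" "m0 \<le> (C0 * M') ^ D" "odd m0" "[m0 = 1] (mod M')" "[m0 = b] (mod l)"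
      and m0f: "\<And>N n. N dvd m0 \<Longrightarrow> [N = b] (mod l) \<Longrightarrow> [n = b] (mod l) \<Longrightarrow>
          \<exists>f. cyclic_mod n d (int N) f \<and> jacobi_symbol (discriminant f) N = (-1) ^ (d - 1)"
      by blast
    have not_dvd_b: "\<not> l dvd b" using not_dvd_mult_b[of 1 1] l1 by simp
    have copl: "Rings.coprime x l" if "\<not> l dvd x" for x
      using prime_imp_coprime[OF l that] by (simp add: ac_simps)
    have coplk: "Rings.coprime M' (l ^ k)" using copl[OF M'(2)] by simp
    \<comment> \<open>A Teichmueller-like lift of b: still b modulo l, but with d-th power 1 modulo
      l^k, where l^k is the full power of l in M.\<close>
    define B where "B = b ^ (l ^ k)"
    have Bb: "[B = b] (mod l)" unfolding B_def by (rule cong_pow_prime_power[OF l])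
    have Bd: "[B ^ d = 1] (mod l ^ k)"
    proof -
      have "Rings.coprime g (l ^ k)" using copl[OF not_dvd_g] by simp
      from euler_theorem[OF this] have "[g ^ (l ^ (k - 1) * (l - 1)) = 1] (mod l ^ k)"
        using totient_prime_power[OF l k0] by simp
      from cong_pow[OF this, of l] have "[g ^ (l ^ (k - 1) * (l - 1) * l) = 1] (mod l ^ k)"
        by (simp flip: power_mult)
      moreover have "l ^ (k - 1) * (l - 1) * l = D * l ^ k * d"
        unfolding D[symmetric] power_minus_mult[OF k0, symmetric] by (simp only: mult_ac)
      ultimately show ?thesis unfolding B_def b_def by (simp flip: power_mult)
    qed
    \<comment> \<open>The class intended for n modulo M. It makes n^d = 1 modulo M, hence modulo
      each p - 1, and retains n = b modulo l, so that the order modulo l stays d.\<close>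
    obtain tt where tt: "[tt = 1] (mod M')" "[tt = B] (mod l ^ k)"
      using binary_chinese_remainder_nat[OF coplk] by blast
    have ttb: "[tt = b] (mod l)"
      using cong_trans[OF cong_dvd_modulus_nat[OF tt(2), of l] Bb] k0 by (simp add: dvd_power)
    have ttd: "[tt ^ d = 1] (mod M)"
    proof -
      have "[tt ^ d = 1] (mod M')" using cong_pow[OF tt(1), of d] by simp
      moreover have "[tt ^ d = 1] (mod l ^ k)" using cong_trans[OF cong_pow[OF tt(2)] Bd] .
      ultimately have "[tt ^ d = 1] (mod (M' * l ^ k))" by (rule coprime_cong_mult_nat[OF _ _ coplk])
      thus ?thesis by (simp add: M'(1) mult.commute)
    qed
    have unit_s: "\<not> p dvd s * m0" if p: "prime p" "p dvd M" for p
    proof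
      assume "p dvd s * m0"
      hence "p dvd s \<or> p dvd m0" using p by (simp add: prime_dvd_mult_iff)
      moreover have "\<not> p dvd s" using s_primes p Tp by blast
      moreover have "\<not> p dvd m0"
      proof (cases "p = l")
        case True
        thus ?thesis using not_dvd_b cong_dvd_iff[OF m0(5)] by blast
      next
        case False
        hence "[m0 = 1] (mod p)" using cong_dvd_modulus_nat[OF m0(4) pM'] p by blast
        thus ?thesis using p(1) cong_dvd_iff not_prime_unit by blast
      qed
      ultimately show False by blast
    qed
    have "Rings.coprime (s * m0) M" by (rule coprime_natI) (use unit_s in blast)
    from cong_solve_coprime_nat[OF this] obtain w where w: "[(s * m0) * w = 1] (mod M)" by auto
    define \<tau> where "\<tau> = w * tt"
    have \<tau>: "[(s * m0) * \<tau> = tt] (mod M)"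
      using cong_mult[OF w cong_refl[of tt]] by (simp add: \<tau>_def mult.assoc)
    have tt_unit: "\<not> p dvd tt" if p: "prime p" "p dvd M" for p
    proof
      assume "p dvd tt"
      hence "p dvd tt ^ d" using d by (simp add: dvd_power_iff_le dvd_trans[OF _ dvd_power])
      hence "p dvd 1" using cong_dvd_iff[OF cong_dvd_modulus_nat[OF ttd p(2)]] by blast
      thus False using p(1) by auto
    qed
    have "Rings.coprime \<tau> M"
    proof (rule coprime_natI)
      fix p assume p: "prime p" "p dvd \<tau>" "p dvd M"
      hence "p dvd tt" using cong_dvd_iff[OF cong_dvd_modulus_nat[OF \<tau> p(3)]] by (simp add: dvd_mult)
      thus False using tt_unit p by blast
    qed
    moreover have "[\<tau> = 1] (mod p)" if p: "prime p" "p dvd M" "p \<le> 6 * l" for p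
    proof -
      have "[s = 1] (mod p)" unfolding s_def
        by (rule cong_dvd_modulus_nat[OF T1]) (use p prime_ge_1_nat[OF p(1)] in \<open>auto intro: dvd_fact\<close>)
      \<comment> \<open>Modulo a small prime p the norm and the target class share the residue c,
        and s is 1. Hence \<tau> is 1 modulo p, as the construction from slopes demands.\<close>
      define c where "c = (if p = l then b else 1)"
      have m0c: "[m0 = c] (mod p)" and ttc: "[tt = c] (mod p)"
        using m0(4,5) tt(1) ttb cong_dvd_modulus_nat[OF m0(4) pM'[OF p(1,2)]] cong_dvd_modulus_nat[OF tt(1) pM'[OF p(1,2)]]
        by (auto simp: c_def)
      have "[(s * m0) * \<tau> = (1 * c) * \<tau>] (mod p)" by (intro cong_mult cong_refl m0c) fact
      moreover have "[(s * m0) * \<tau> = c * 1] (mod p)"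
        using cong_trans[OF cong_dvd_modulus_nat[OF \<tau> p(2)] ttc] by simp
      ultimately have "[c * \<tau> = c * 1] (mod p)" by (simp only: mult_1) (meson cong_sym cong_trans)
      moreover have "\<not> p dvd c" using cong_dvd_iff[OF ttc] tt_unit[OF p(1,2)] by blast
      hence "Rings.coprime c p" using prime_imp_coprime[OF p(1)] by (simp add: ac_simps)
      ultimately show ?thesis using cong_mult_lcancel_nat by blast
    qed
    ultimately obtain m' where m': "[m' = \<tau>] (mod M)" "m' > 0" "m' \<le> (l * M ^ (2 * l)) ^ 3"
      "\<And>q. prime q \<Longrightarrow> q dvd m' \<Longrightarrow> [q = 1] (mod l)"
      by (rule residue_class_meets_split_numbers[OF l M(1,2)]) blast+
    \<comment> \<open>Primes of the norm that are 1 modulo l join the split part. Their product is 1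
      modulo l, so the rest N is still b modulo l.\<close>
    obtain m1 N where split: "m0 = m1 * N" "\<forall>q. prime q \<longrightarrow> q dvd m1 \<longrightarrow> [q = 1] (mod l)"
      "\<forall>q. prime q \<longrightarrow> q dvd N \<longrightarrow> \<not> [q = 1] (mod l)"
      using split_by_prime_property[OF m0(1), of "\<lambda>q. [q = 1] (mod l)"] by blast
    have m1: "m1 > 0" using split(1) m0(1) by (auto intro!: Nat.gr0I)
    define m where "m = m0 * m'"
    define n where "n = s * m"
    define n1 where "n1 = s * m' * m1"
    have n1N: "n = n1 * N" by (simp add: n_def m_def n1_def split(1))
    have n1_primes: "[q = 1] (mod l)" if "prime q" "q dvd n1" for q
      using that s_primes Tp m'(4) split(2) by (auto simp: n1_def prime_dvd_mult_iff)
    have cop: "Rings.coprime n1 N" by (rule coprime_natI) (use n1_primes split(3) in blast)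
    have "n1 > 0" using s0 m' m1 by (simp add: n1_def)
    hence n1l: "[n1 = 1] (mod l)" by (rule cong_1_if_prime_divisors) (use n1_primes in blast)
    have "[m1 = 1] (mod l)" using cong_1_if_prime_divisors[OF m1] split(2) by blast
    from cong_mult[OF this cong_refl[of N]] have "[m0 = N] (mod l)" by (simp add: split(1))
    hence Nb: "[N = b] (mod l)" using m0(5) by (meson cong_sym cong_trans)
    have nb: "[n = b] (mod l)" using cong_mult[OF n1l Nb] by (simp add: n1N)
    have "[n = tt] (mod M)"
    proof -
      have "[(s * m0) * m' = (s * m0) * \<tau>] (mod M)" by (intro cong_mult cong_refl m')
      thus ?thesis using cong_trans[OF _ \<tau>] by (simp add: n_def m_def mult.assoc)
    qed
    hence nd: "[n ^ d = 1] (mod M)" using cong_trans[OF cong_pow ttd] by blast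
    have ni: "\<not> [n ^ i = 1] (mod l)" if "0 < i" "i < d" for i
    proof
      assume "[n ^ i = 1] (mod l)"
      hence "[b ^ i = b ^ 0] (mod l)" using cong_pow[OF nb, of i] by (simp only: power_0) (meson cong_sym cong_trans)
      hence "[i = 0] (mod d)" by (simp only: b_power_cong_iff)
      thus False using that by (simp add: cong_def)
    qed
    have odd_split: "odd x" if "\<And>q. prime q \<Longrightarrow> q dvd x \<Longrightarrow> [q = 1] (mod l)" for x :: nat
    proof
      assume "even x"
      hence "[2 = 1] (mod l)" using that[of 2] by simp
      hence "[1 + 1 = 1 + 0] (mod l)" by (simp only: one_add_one add_0_right)
      hence "[1 = 0] (mod l)" by (simp only: cong_add_lcancel_nat)
      thus False using l1 by (simp add: cong_def)
    qed
    have "odd n1" by (rule odd_split) (rule n1_primes)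
    moreover have "odd N" using m0(3) split(1) by simp
    ultimately have oddn: "odd n" by (simp add: n1N)
    have "n > 1"
    proof -
      obtain p where p: "p \<in> T" using T(2) by blast
      have "p dvd n" unfolding n_def s_def using p T(1) by (intro dvd_mult2 dvd_prodI)
      moreover have "n > 0" using oddn by (auto intro!: Nat.gr0I)
      ultimately have "p \<le> n" by (simp add: dvd_imp_le)
      thus ?thesis using Tp[OF p] prime_gt_1_nat[of p] by simp
    qed
    obtain f2 where f2: "cyclic_mod n d (int N) f2" "jacobi_symbol (discriminant f2) N = (-1) ^ (d - 1)"
      using m0f[OF _ Nb nb] split(1) by auto
    have "(\<Prod>p\<in>T. (real p - 1) / (2 * real d)) \<le> real (frobenius_count d \<sigma> n)"
    proof (rule frobenius_count_ge[OF n1N oddn \<open>n > 1\<close> cop l n1_primes d _ ni T(1) _ f2 \<sigma>])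
      show "[n ^ d = 1] (mod l)" by (rule cong_dvd_modulus_nat[OF nd M(2)])
      fix q assume q: "q \<in> T"
      have "q dvd n1" unfolding n1_def s_def using q T(1) by (intro dvd_mult2 dvd_prodI)
      thus "prime q \<and> q dvd n1 \<and> [n ^ d = 1] (mod (q - 1))"
        using Tp[OF q] cong_dvd_modulus_nat[OF nd] by blast
    qed
    moreover have "m \<le> (C * M) ^ C"
    proof -
      have CM: "C * M \<ge> 1" using M(1) l1 by (simp add: C_def)
      have M'M: "M' \<le> M" using M'(1) l1 by simp
      have 1: "(C0 * M') ^ D \<le> (C * M) ^ D" using M'M by (intro power_mono mult_mono) (simp_all add: C_def)
      have "l * M ^ (2 * l) \<le> C ^ (2 * l) * M ^ (2 * l)"
      proof (intro mult_right_mono)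
        have "l \<le> C ^ 1" by (simp add: C_def)
        also have "\<dots> \<le> C ^ (2 * l)" using l1 by (intro power_increasing) (simp_all add: C_def)
        finally show "l \<le> C ^ (2 * l)" .
      qed simp
      hence "(l * M ^ (2 * l)) ^ 3 \<le> ((C * M) ^ (2 * l)) ^ 3" by (intro power_mono) (simp_all add: power_mult_distrib)
      also have "\<dots> = (C * M) ^ (6 * l)" by (simp flip: power_mult)
      finally have "m \<le> (C * M) ^ D * (C * M) ^ (6 * l)"
        unfolding m_def using m0(2) m'(3) 1 by (intro mult_mono) auto
      also have "\<dots> = (C * M) ^ (D + 6 * l)" by (simp add: power_add)
      also have "\<dots> \<le> (C * M) ^ C" using CM by (intro power_increasing) (simp_all add: C_def)
      finally show ?thesis .
    qed
    ultimately show ?thesis using oddn m0(1) m'(2) unfolding n_def s_def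
      by (intro exI[of _ m]) (simp add: m_def)
  qed
  thus ?thesis by (rule that)
qed

section \<open>The least common multiple of an initial interval\<close>

text \<open>The argument of Erdos: for n = 2 * k + 1 the primes above k + 1 divide the binomial
  coefficient of n over k, which occurs twice in a row with sum 2 * 4^k.\<close>

lemma primorial_le: "\<Prod>{p::nat. prime p \<and> p \<le> n} \<le> 4 ^ n"
proof (induction n rule: less_induct)
  case (less n)
  have fin: "finite {p::nat. prime p \<and> p \<le> k}" for k by (rule finite_subset[of _ "{..k}"]) auto
  consider "n \<le> 1" | "n = 2" | "n > 2" "even n" | "n > 2" "odd n" by linarith
  thus ?case
  proof cases
    case 1
    hence "{p::nat. prime p \<and> p \<le> n} = {}" by (auto dest: prime_gt_1_nat)
    thus ?thesis by (simp only: prod.empty) simp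
  next
    case 2
    hence "{p::nat. prime p \<and> p \<le> n} = {2}" using 2 by (auto dest: prime_ge_2_nat)
    thus ?thesis using 2 by (simp only:) simp
  next
    case 3
    hence "\<not> prime n" using prime_odd_nat[of n] by blast
    hence eq: "{p::nat. prime p \<and> p \<le> n} = {p. prime p \<and> p \<le> n - 1}"
      by (intro Collect_cong) (metis Suc_leI diff_le_self le_antisym le_diff_conv not_less order_trans Suc_eq_plus1)
    have "\<Prod>{p::nat. prime p \<and> p \<le> n} \<le> 4 ^ (n - 1)" unfolding eq using 3 by (intro less.IH) simp
    also have "\<dots> \<le> 4 ^ n" by (intro power_increasing) auto
    finally show ?thesis .
  next
    case 4
    then obtain k where k: "n = 2 * k + 1" by (elim oddE)
    define Q where "Q = {p::nat. prime p \<and> k + 1 < p \<and> p \<le> n}"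
    have finQ: "finite Q" unfolding Q_def by (rule finite_subset[OF _ fin[of n]]) auto
    have "Q \<subseteq> prime_factors (n choose k)"
    proof
      fix p assume p: "p \<in> Q"
      have "fact k * fact (n - k) * (n choose k) = (fact n :: nat)" by (rule binomial_fact_lemma) (simp add: k)
      moreover have "p dvd fact n" using p prime_ge_1_nat[of p] by (intro dvd_fact) (auto simp: Q_def)
      ultimately have "p dvd fact k * fact (n - k) * (n choose k)" by simp
      moreover have "\<not> p dvd fact k" "\<not> p dvd fact (n - k)"
        using p prime_dvd_fact_iff[of p k] prime_dvd_fact_iff[of p "n - k"] by (auto simp: Q_def k simp del: fact_Suc)
      ultimately have "p dvd (n choose k)" using p by (auto simp: Q_def prime_dvd_mult_iff)
      thus "p \<in> prime_factors (n choose k)" using p by (auto simp: Q_def prime_factors_dvd k)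
    qed
    hence "\<Prod>Q dvd \<Prod>(prime_factors (n choose k))" by (intro prod_dvd_prod_subset) auto
    also have "\<dots> dvd (n choose k)" by (rule prod_prime_factors_dvd) (simp add: k)
    finally have "\<Prod>Q dvd (n choose k)" .
    hence "\<Prod>Q \<le> (n choose k)" by (rule dvd_imp_le) (simp add: k)
    also have "\<dots> \<le> 4 ^ k"
    proof -
      have "2 * (n choose k) = (n choose k) + (n choose (n - k))" using binomial_symmetric[of k n] k by simp
      also have "\<dots> = (\<Sum>i\<in>{k, n - k}. n choose i)" by (subst sum.insert) (auto simp: k)
      also have "\<dots> \<le> (\<Sum>i\<le>n. n choose i)" by (rule sum_mono2) (auto simp: k)
      also have "\<dots> = 2 * 4 ^ k" unfolding choose_row_sum by (simp add: k power_mult)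
      finally show ?thesis by simp
    qed
    finally have Q: "\<Prod>Q \<le> 4 ^ k" .
    have "{p. prime p \<and> p \<le> n} = {p. prime p \<and> p \<le> k + 1} \<union> Q" by (auto simp: Q_def k)
    hence "\<Prod>{p. prime p \<and> p \<le> n} = \<Prod>{p. prime p \<and> p \<le> k + 1} * \<Prod>Q"
      using fin finQ by (simp only:) (rule prod.union_disjoint, auto simp: Q_def)
    also have "\<dots> \<le> 4 ^ (k + 1) * 4 ^ k" using Q less.IH[of "k + 1"] 4 k by (intro mult_mono) auto
    also have "\<dots> = 4 ^ n" by (simp add: k mult_2 power_add)
    finally show ?thesis .
  qed
qed

lemma Lcm_Suc_interval: "Lcm {1..Suc n} = lcm (Suc n) (Lcm {1..n})"
  unfolding atLeastAtMostSuc_conv[of 1 n, OF le_add1[of 1 n, unfolded plus_1_eq_Suc]] by (rule Lcm_insert)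

lemma Lcm_interval_pos: "Lcm {1..n::nat} > 0"
  by (intro Nat.gr0I) (auto simp: Lcm_0_iff)

lemma prime_power_multiplicity_Lcm_le:
  assumes "prime p" "n > 0"
  shows "p ^ multiplicity p (Lcm {1..n}) \<le> (n::nat)"
  using assms(2)
proof (induction n)
  case (Suc n)
  have "multiplicity p (lcm (Suc n) (Lcm {1..n})) = max (multiplicity p (Suc n)) (multiplicity p (Lcm {1..n}))"
    using Lcm_interval_pos[of n] by (intro multiplicity_lcm) (use assms(1) in auto)
  moreover have "p ^ multiplicity p (Suc n) \<le> Suc n" by (intro dvd_imp_le multiplicity_dvd) simp
  moreover have "p ^ multiplicity p (Lcm {1..n}) \<le> Suc n" using Suc.IH by (cases "n = 0") auto
  ultimately show ?case unfolding Lcm_Suc_interval by (simp add: max_def)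
qed simp

lemma prime_dvd_Lcm_interval_iff:
  assumes "prime p"
  shows "p dvd Lcm {1..n} \<longleftrightarrow> p \<le> (n::nat)"
proof
  assume "p \<le> n"
  thus "p dvd Lcm {1..n}" using prime_ge_1_nat[OF assms] by (intro dvd_Lcm) auto
next
  assume *: "p dvd Lcm {1..n}"
  have "p > 1" using prime_gt_1_nat[OF assms] .
  have "multiplicity p (Lcm {1..n}) > 0"
    using * Lcm_interval_pos[of n] assms by (simp add: prime_multiplicity_gt_zero_iff)
  moreover have "n > 0" using * assms by (intro Nat.gr0I) auto
  moreover from calculation have "p ^ 1 \<le> p ^ multiplicity p (Lcm {1..n})"
    using \<open>p > 1\<close> by (intro power_increasing) auto
  ultimately show "p \<le> n" using prime_power_multiplicity_Lcm_le[OF assms, of n] by simp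
qed

text \<open>Only primes up to the square root of \<^term>\<open>n\<close> occur to a power higher than the first.\<close>

lemma Lcm_interval_le:
  assumes n: "n > 0"
  shows "real (Lcm {1..n}) \<le> real n powr sqrt n * 4 ^ n"
proof -
  define M where "M = Lcm {1..n}"
  have M: "M > 0" unfolding M_def by (rule Lcm_interval_pos)
  define A where "A = {p \<in> prime_factors M. p ^ 2 \<le> n}"
  define B where "B = {p \<in> prime_factors M. \<not> p ^ 2 \<le> n}"
  have fin: "finite A" "finite B" by (auto simp: A_def B_def)
  have mult: "p ^ multiplicity p M \<le> n" if "p \<in> prime_factors M" for p
    unfolding M_def using that n by (intro prime_power_multiplicity_Lcm_le) auto
  have "M = (\<Prod>p\<in>prime_factors M. p ^ multiplicity p M)" using M by (simp add: prime_factorization_nat[symmetric])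
  also have "prime_factors M = A \<union> B" by (auto simp: A_def B_def)
  also have "(\<Prod>p\<in>A \<union> B. p ^ multiplicity p M) = (\<Prod>p\<in>A. p ^ multiplicity p M) * (\<Prod>p\<in>B. p ^ multiplicity p M)"
    using fin by (intro prod.union_disjoint) (auto simp: A_def B_def)
  finally have M_eq: "M = (\<Prod>p\<in>A. p ^ multiplicity p M) * (\<Prod>p\<in>B. p ^ multiplicity p M)" .
  have "(\<Prod>p\<in>B. p ^ multiplicity p M) \<le> \<Prod>B"
  proof (rule prod_mono)
    fix p assume p: "p \<in> B"
    hence "p ^ multiplicity p M < p ^ 2" using mult[of p] by (auto simp: B_def)
    moreover have "p > 1" using p prime_gt_1_nat[of p] by (auto simp: B_def)
    ultimately have "multiplicity p M \<le> 1" by simp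
    hence "p ^ multiplicity p M \<le> p ^ 1" using \<open>p > 1\<close> by (intro power_increasing) auto
    thus "0 \<le> p ^ multiplicity p M \<and> p ^ multiplicity p M \<le> p" by simp
  qed
  also have "\<Prod>B \<le> \<Prod>{p. prime p \<and> p \<le> n}"
  proof (rule dvd_imp_le)
    have "finite {p::nat. prime p \<and> p \<le> n}" by (rule finite_subset[of _ "{..n}"]) auto
    thus "\<Prod>B dvd \<Prod>{p. prime p \<and> p \<le> n}"
      by (rule prod_dvd_prod_subset)
        (auto simp del: One_nat_def simp: B_def M_def in_prime_factors_iff prime_dvd_Lcm_interval_iff)
    show "\<Prod>{p::nat. prime p \<and> p \<le> n} > 0" by (intro prod_pos) (auto intro: prime_gt_0_nat)
  qed
  also have "\<dots> \<le> 4 ^ n" by (rule primorial_le)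
  finally have B: "real (\<Prod>p\<in>B. p ^ multiplicity p M) \<le> real (4 ^ n)" by (rule of_nat_mono)
  have "(\<Prod>p\<in>A. p ^ multiplicity p M) \<le> (\<Prod>p\<in>A. n)"
    by (rule prod_mono) (use mult in \<open>auto simp: A_def\<close>)
  hence "real (\<Prod>p\<in>A. p ^ multiplicity p M) \<le> real (n ^ card A)" unfolding prod_constant by (rule of_nat_mono)
  also have "\<dots> = real n powr real (card A)" using n by (simp add: powr_realpow)
  also have "\<dots> \<le> real n powr sqrt n"
  proof (rule powr_mono)
    have "A \<subseteq> {1..nat \<lfloor>sqrt n\<rfloor>}"
    proof
      fix p assume p: "p \<in> A"
      hence "real (p ^ 2) \<le> real n" unfolding A_def by (intro of_nat_mono) simp
      hence "real p \<le> sqrt n" by (intro real_le_rsqrt) simp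
      moreover have "p > 0" using p by (auto simp: A_def intro: prime_gt_0_nat)
      ultimately show "p \<in> {1..nat \<lfloor>sqrt n\<rfloor>}" by (simp add: le_nat_floor)
    qed
    hence "card A \<le> card {1..nat \<lfloor>sqrt n\<rfloor>}" by (intro card_mono) auto
    hence "card A \<le> nat \<lfloor>sqrt n\<rfloor>" by simp
    thus "real (card A) \<le> sqrt n" by (meson of_nat_floor of_nat_mono order_trans real_sqrt_ge_zero of_nat_0_le_iff)
  qed (use n in auto)
  finally have A: "real (\<Prod>p\<in>A. p ^ multiplicity p M) \<le> real n powr sqrt n" .
  have "real M = real (\<Prod>p\<in>A. p ^ multiplicity p M) * real (\<Prod>p\<in>B. p ^ multiplicity p M)"
    using arg_cong[OF M_eq, of real] by (simp only: of_nat_mult)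
  also have "\<dots> \<le> real n powr sqrt n * real (4 ^ n)" by (rule mult_mono[OF A B]) (simp_all only: of_nat_0_le_iff powr_ge_zero)
  finally show ?thesis by (simp add: M_def)
qed

lemma lcm_bound_eq: "lcm_bound x = Lcm {1..nat \<lfloor>ln x / ln (ln x)\<rfloor>}"
proof -
  have "{k :: nat. k > 0 \<and> real k \<le> ln x / ln (ln x)} = {1..nat \<lfloor>ln x / ln (ln x)\<rfloor>}"
    by (auto simp: le_nat_floor Suc_le_eq) (metis le_nat_iff le_floor_iff of_int_of_nat_eq nat_0_iff not_le order_less_le_trans of_nat_0_less_iff nat_le_0 le_nat_iff int_nat_eq nless_le)
  thus ?thesis by (simp add: lcm_bound_def)
qed

text \<open>With y = ln x / ln (ln x) the logarithm of \<open>lcm_bound x\<close> is O(y), which is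
  o(ln x). So any fixed power of it is x^o(1).\<close>

lemma eventually_lcm_bound_le:
  fixes C :: nat and \<delta> :: real
  assumes "C > 0" "\<delta> > 0"
  shows "\<forall>\<^sub>F x in at_top. real ((C * lcm_bound x) ^ C) \<le> x powr \<delta>"
proof -
  define c where "c = real C"
  have c: "c > 0" using assms(1) by (simp add: c_def)
  define y where "y = (\<lambda>x::real. ln x / ln (ln x))"
  have "\<forall>\<^sub>F x in at_top. c * (ln c + sqrt (y x) * ln (y x) + y x * ln 4) \<le> \<delta> * ln x"
    unfolding y_def using c assms(2) by real_asymp
  moreover have "\<forall>\<^sub>F x in at_top. y x \<ge> 1" unfolding y_def by real_asymp
  moreover have "\<forall>\<^sub>F x in at_top. x > (0::real)" by (rule eventually_gt_at_top)
  ultimately show ?thesis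
  proof eventually_elim
    case (elim x)
    define n where "n = nat \<lfloor>y x\<rfloor>"
    have n: "n > 0" "real n \<le> y x" using elim(2) by (auto simp: n_def le_nat_floor Suc_le_eq)
    have M: "real (lcm_bound x) \<le> y x powr sqrt (y x) * 4 powr y x"
    proof -
      have "real (lcm_bound x) \<le> real n powr sqrt n * 4 ^ n"
        unfolding lcm_bound_eq n_def y_def by (rule Lcm_interval_le) (use n(1) in \<open>simp add: n_def y_def\<close>)
      also have "4 ^ n = 4 powr real n" by (simp add: powr_realpow)
      also have "real n powr sqrt n * 4 powr real n \<le> y x powr sqrt (y x) * 4 powr y x"
        using n elim(2) by (intro mult_mono powr_mono_both powr_mono) auto
      finally show ?thesis .
    qed
    have "real ((C * lcm_bound x) ^ C) = (c * real (lcm_bound x)) ^ C" by (simp add: c_def)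
    also have "\<dots> \<le> (c * (y x powr sqrt (y x) * 4 powr y x)) ^ C" using M c by (intro power_mono mult_left_mono) auto
    also have "\<dots> = exp (c * (ln c + sqrt (y x) * ln (y x) + y x * ln 4))"
    proof -
      have "c * (y x powr sqrt (y x) * 4 powr y x) = exp (ln c + sqrt (y x) * ln (y x) + y x * ln 4)"
        using c elim(2) by (simp add: powr_def exp_add)
      thus ?thesis by (simp add: c_def exp_of_nat_mult)
    qed
    also have "\<dots> \<le> exp (\<delta> * ln x)" using elim(1) by simp
    also have "\<dots> = x powr \<delta>" using elim(3) by (simp add: powr_def)
    finally show ?case .
  qed
qed

section \<open>Summation over products of primes\<close>

text \<open>Different T may produce the same n. But n and the cofactor \<mu> T determine the product
  of T, hence T, and there are at most B cofactors; so the overcount is at most B.\<close>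

lemma sum_frobenius_count_ge:
  fixes P :: "nat set" and B k d :: nat and Z R x :: real
  assumes P: "finite P" "\<And>p. p \<in> P \<Longrightarrow> prime p \<and> real p \<le> Z \<and> R \<le> real p"
    and R: "R \<ge> 1" and k: "k \<ge> 2"
    and m: "\<And>T. T \<subseteq> P \<Longrightarrow> card T = k \<Longrightarrow> \<exists>m>0. m \<le> B \<and> odd (\<Prod>T * m) \<and>
      (\<Prod>p\<in>T. (real p - 1) / (2 * real d)) \<le> real (frobenius_count d \<sigma> (\<Prod>T * m))"
    and x: "Z ^ k * real B < x"
  shows "real (card P choose k) * ((R - 1) / (2 * real d)) ^ k \<le>
    real (\<Sum>n | odd n \<and> n > 1 \<and> \<not> prime n \<and> real n < x. frobenius_count d \<sigma> n) * real B"
proof -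
  define TT where "TT = {T. T \<subseteq> P \<and> card T = k}"
  define S where "S = {n. odd n \<and> n > 1 \<and> \<not> prime n \<and> real n < x}"
  have finTT: "finite TT" using P(1) by (simp add: TT_def)
  have finS: "finite S"
  proof (rule finite_subset)
    show "S \<subseteq> {..nat \<lceil>x\<rceil>}" by (auto simp: S_def) linarith
  qed simp
  have finT: "finite T" if "T \<in> TT" for T using that P(1) by (auto simp: TT_def intro: finite_subset)
  have "\<forall>T\<in>TT. \<exists>m>0. m \<le> B \<and> odd (\<Prod>T * m) \<and>
      (\<Prod>p\<in>T. (real p - 1) / (2 * real d)) \<le> real (frobenius_count d \<sigma> (\<Prod>T * m))"
    using m by (simp add: TT_def)
  from bchoice[OF this] obtain \<mu> where
    \<mu>': "\<forall>T\<in>TT. \<mu> T > 0 \<and> \<mu> T \<le> B \<and> odd (\<Prod>T * \<mu> T) \<and>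
      (\<Prod>p\<in>T. (real p - 1) / (2 * real d)) \<le> real (frobenius_count d \<sigma> (\<Prod>T * \<mu> T))" ..
  have \<mu>: "\<mu> T > 0" "\<mu> T \<le> B" "odd (\<Prod>T * \<mu> T)"
      "(\<Prod>p\<in>T. (real p - 1) / (2 * real d)) \<le> real (frobenius_count d \<sigma> (\<Prod>T * \<mu> T))"
    if "T \<in> TT" for T using bspec[OF \<mu>' that] by linarith+
  define \<phi> where "\<phi> T = \<Prod>T * \<mu> T" for T
  have \<phi>S: "\<phi> T \<in> S" if T: "T \<in> TT" for T
  proof -
    have pos: "\<phi> T > 0" using \<mu>(3)[OF T] unfolding \<phi>_def by (intro Nat.gr0I) auto
    have "card T > 1" using T k by (simp add: TT_def)
    \<comment> \<open>Two different prime divisors make n composite; this is the use of k >=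
      2.\<close>
    then obtain p q where pq: "p \<in> T" "q \<in> T" "p \<noteq> q"
      by (metis One_nat_def card_le_Suc0_iff_eq finT[OF T] not_le)
    have primes: "prime p" "prime q" using pq T P(2) by (auto simp: TT_def)
    have dvd: "r dvd \<phi> T" if "r \<in> T" for r unfolding \<phi>_def using that finT[OF T] by (intro dvd_mult2 dvd_prodI)
    have "\<phi> T > 1" using dvd_imp_le[OF dvd[OF pq(1)] pos] prime_gt_1_nat[OF primes(1)] by simp
    moreover have "\<not> prime (\<phi> T)"
      using primes_dvd_imp_eq[OF primes(1) _ dvd[OF pq(1)]] primes_dvd_imp_eq[OF primes(2) _ dvd[OF pq(2)]] pq(3) by metis
    moreover have "real (\<phi> T) < x"
    proof -
      have "(\<Prod>p\<in>T. real p) \<le> (\<Prod>p\<in>T. Z)" by (rule prod_mono) (use P(2) T in \<open>auto simp: TT_def\<close>)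
      also have "\<dots> = Z ^ k" using T by (simp add: TT_def)
      finally have "real (\<phi> T) \<le> Z ^ k * real B"
        unfolding \<phi>_def using \<mu>(2)[OF T] by (simp add: mult_mono' prod_nonneg)
      thus ?thesis using x by simp
    qed
    ultimately show ?thesis using \<mu>(3)[OF T] by (simp add: S_def \<phi>_def)
  qed
  have fibre: "card {T \<in> TT. \<phi> T = n} \<le> B" if n: "n \<in> S" for n
  proof -
    have "inj_on \<mu> {T \<in> TT. \<phi> T = n}"
    proof (rule inj_onI)
      fix T U assume *: "T \<in> {T \<in> TT. \<phi> T = n}" "U \<in> {T \<in> TT. \<phi> T = n}" "\<mu> T = \<mu> U"
      hence "\<Prod>T * \<mu> T = \<Prod>U * \<mu> T" by (simp add: \<phi>_def)
      hence "\<Prod>T = \<Prod>U" using \<mu>(1)[of T] * by simp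
      moreover have "prime_factors (\<Prod>V) = V" if V: "V \<in> TT" for V
      proof (rule prime_factors_prod_primes[OF finT[OF V]])
        fix p assume "p \<in> V"
        hence "p \<in> P" using V by (auto simp: TT_def)
        thus "prime p" using P(2) by blast
      qed
      ultimately show "T = U" using *(1,2) by (metis (no_types, lifting) mem_Collect_eq)
    qed
    moreover have "\<mu> ` {T \<in> TT. \<phi> T = n} \<subseteq> {1..B}" using \<mu>(1,2) by (auto simp: Suc_le_eq)
    ultimately have "card {T \<in> TT. \<phi> T = n} \<le> card {1..B}" by (intro card_inj_on_le) auto
    thus ?thesis by simp
  qed
  have "real (card P choose k) * ((R - 1) / (2 * real d)) ^ k = (\<Sum>T\<in>TT. ((R - 1) / (2 * real d)) ^ k)"
    by (simp add: TT_def n_subsets[OF P(1)])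
  also have "\<dots> \<le> (\<Sum>T\<in>TT. real (frobenius_count d \<sigma> (\<phi> T)))"
  proof (rule sum_mono)
    fix T assume T: "T \<in> TT"
    have "((R - 1) / (2 * real d)) ^ k = (\<Prod>p\<in>T. (R - 1) / (2 * real d))" using T by (simp add: TT_def)
    also have "\<dots> \<le> (\<Prod>p\<in>T. (real p - 1) / (2 * real d))"
    proof (rule prod_mono)
      fix p assume "p \<in> T"
      hence "R \<le> real p" using P(2) T by (auto simp: TT_def)
      thus "0 \<le> (R - 1) / (2 * real d) \<and> (R - 1) / (2 * real d) \<le> (real p - 1) / (2 * real d)"
        using R by (auto intro!: divide_right_mono)
    qed
    also have "\<dots> \<le> real (frobenius_count d \<sigma> (\<phi> T))" unfolding \<phi>_def by (rule \<mu>(4)[OF T])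
    finally show "((R - 1) / (2 * real d)) ^ k \<le> real (frobenius_count d \<sigma> (\<phi> T))" .
  qed
  also have "\<dots> = (\<Sum>n\<in>S. \<Sum>T | T \<in> TT \<and> \<phi> T = n. real (frobenius_count d \<sigma> (\<phi> T)))"
    by (rule sum.group[symmetric, OF finTT finS]) (use \<phi>S in blast)
  also have "\<dots> \<le> (\<Sum>n\<in>S. real (frobenius_count d \<sigma> n) * real B)"
  proof (rule sum_mono)
    fix n assume n: "n \<in> S"
    have "(\<Sum>T | T \<in> TT \<and> \<phi> T = n. real (frobenius_count d \<sigma> (\<phi> T))) =
      real (card {T \<in> TT. \<phi> T = n}) * real (frobenius_count d \<sigma> n)" by simp
    also have "\<dots> \<le> real B * real (frobenius_count d \<sigma> n)"
      using fibre[OF n] by (intro mult_right_mono) auto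
    finally show "(\<Sum>T | T \<in> TT \<and> \<phi> T = n. real (frobenius_count d \<sigma> (\<phi> T))) \<le>
      real (frobenius_count d \<sigma> n) * real B" by (simp add: mult.commute)
  qed
  also have "\<dots> = real (\<Sum>n\<in>S. frobenius_count d \<sigma> n) * real B" by (simp add: sum_distrib_right)
  finally show ?thesis by (simp add: S_def)
qed

lemma exists_popular_class:
  assumes "finite P" "W > 0"
  shows "\<exists>c. card P \<le> W * card {p \<in> P. p mod W = (c::nat)}"
proof -
  have "\<exists>c\<in>{..<W}. card ((\<lambda>p. p mod W) -` {c} \<inter> P) * card {..<W} \<ge> card P"
    by (rule pigeonhole_card) (use assms in auto)
  then obtain c where "card P \<le> card ((\<lambda>p. p mod W) -` {c} \<inter> P) * W" by auto
  moreover have "(\<lambda>p. p mod W) -` {c} \<inter> P = {p \<in> P. p mod W = c}" by auto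
  ultimately show ?thesis by (metis mult.commute)
qed

lemma powr_o1_lower_bound:
  fixes S :: "real \<Rightarrow> real"
  assumes "\<And>\<delta>. \<delta> > 0 \<Longrightarrow> \<forall>\<^sub>F x in at_top. S x \<ge> x powr (a - \<delta>)"
  shows "\<exists>\<epsilon> :: real \<Rightarrow> real. (\<epsilon> \<longlongrightarrow> 0) at_top \<and> (\<forall>\<^sub>F x in at_top. S x \<ge> x powr (a - \<epsilon> x))"
proof (intro exI conjI)
  \<comment> \<open>The exact loss in the exponent of S x, cut off at 0 where S x exceeds x^a and
    the loss would be negative.\<close>
  define \<epsilon> where "\<epsilon> x = max 0 (a - ln (S x) / ln x)" for x
  have gt: "\<forall>\<^sub>F x in at_top. x > (1::real)" by (rule eventually_gt_at_top)
  show "(\<epsilon> \<longlongrightarrow> 0) at_top"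
  proof (rule tendstoI)
    fix e :: real assume "e > 0"
    hence "\<forall>\<^sub>F x in at_top. S x \<ge> x powr (a - e / 2)" by (intro assms) simp
    with gt show "\<forall>\<^sub>F x in at_top. dist (\<epsilon> x) 0 < e"
    proof eventually_elim
      case (elim x)
      have "(a - e / 2) * ln x = ln (x powr (a - e / 2))" using elim by simp
      also have "\<dots> \<le> ln (S x)" using elim by (subst ln_le_cancel_iff) (auto intro: less_le_trans[of _ "x powr (a - e / 2)"])
      finally have "a - e / 2 \<le> ln (S x) / ln x" using elim by (subst pos_le_divide_eq) auto
      thus ?case using \<open>e > 0\<close> by (simp add: \<epsilon>_def dist_real_def)
    qed
  qed
  have "\<forall>\<^sub>F x in at_top. S x \<ge> x powr (a - 1)" by (rule assms) simp
  with gt show "\<forall>\<^sub>F x in at_top. S x \<ge> x powr (a - \<epsilon> x)"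
  proof eventually_elim
    case (elim x)
    have S: "S x > 0" using elim by (auto intro: less_le_trans[of _ "x powr (a - 1)"])
    have "x powr (a - \<epsilon> x) \<le> x powr (ln (S x) / ln x)" using elim by (intro powr_mono) (auto simp: \<epsilon>_def)
    also have "\<dots> = S x" using elim S by (simp add: powr_def)
    finally show ?case .
  qed
qed

text \<open>All primes being in one class, the product is a power of that class, and Euler's theorem
  applies. A popular class and a suitable k thus replace any condition on individual
  products.\<close>

lemma prod_residue_class_cong_1:
  fixes T :: "nat set" and W c :: nat
  assumes T: "\<And>p. p \<in> T \<Longrightarrow> p mod W = c \<and> Rings.coprime p W" and W: "totient W dvd card T"
  shows "[\<Prod>T = 1] (mod W)"
proof (cases "T = {}")
  case False
  then obtain q where q: "q \<in> T" by blast
  have "[\<Prod>T = (\<Prod>p\<in>T. q)] (mod W)" by (rule cong_prod) (use T q in \<open>auto simp: cong_def\<close>)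
  also have "(\<Prod>p\<in>T. q) = q ^ card T" by simp
  also obtain j where "card T = totient W * j" using W by (elim dvdE)
  hence "q ^ card T = (q ^ totient W) ^ j" by (simp add: power_mult)
  also have "[(q ^ totient W) ^ j = 1 ^ j] (mod W)"
    using T q by (intro cong_pow euler_theorem) auto
  finally show ?thesis by simp
qed simp

lemma frobenius_sum_eventually_ge:
  fixes d l :: nat and \<sigma> :: "nat \<Rightarrow> nat" and \<alpha> \<delta> :: real
  assumes d: "d \<ge> 1" and \<sigma>: "\<sigma> permutes {1..d}" "cyclic_on \<sigma> {1..d}"
    and l: "prime l" and ld: "[l = 1] (mod d)"
    and P_set: "\<forall>\<^sub>F x in at_top. real (card (P_set \<alpha> l x)) \<ge> ln x powr (\<alpha> - \<delta>)"
    and \<delta>: "\<delta> > 0" "\<delta> \<le> 1 / 4" "5 * \<delta> \<le> \<alpha> - 1"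
  shows "\<forall>\<^sub>F x in at_top.
    real (\<Sum>n | odd n \<and> n > 1 \<and> \<not> prime n \<and> real n < x. frobenius_count d \<sigma> n)
      \<ge> x powr (2 - 1 / \<alpha> - 8 * \<delta>)"
proof -
  obtain C' :: nat where C': "\<And>M T. M > 0 \<Longrightarrow> l dvd M \<Longrightarrow> (\<And>p. prime p \<Longrightarrow> p \<le> C' \<Longrightarrow> p dvd M) \<Longrightarrow>
    finite T \<Longrightarrow> T \<noteq> {} \<Longrightarrow>
    (\<And>p. p \<in> T \<Longrightarrow> prime p \<and> [p = 1] (mod l) \<and> (p - 1) dvd M \<and> \<not> p dvd M) \<Longrightarrow>
    [\<Prod>T = 1] (mod fact (6 * l)) \<Longrightarrow>
    \<exists>m>0. m \<le> (C' * M) ^ C' \<and> odd (\<Prod>T * m) \<and>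
      (\<Prod>p\<in>T. (real p - 1) / (2 * real d)) \<le> real (frobenius_count d \<sigma> (\<Prod>T * m))"
    using exists_small_cofactor[OF l d ld \<sigma>] by metis
  define C where "C = Suc C'"
  define W :: nat where "W = fact (6 * l)"
  define w where "w = real (totient W)"
  have W: "W > 0" by (simp add: W_def)
  have w: "w > 0" using W by (simp add: w_def)
  have \<alpha>: "\<alpha> > 1" using \<delta> by simp
  have large: "\<forall>\<^sub>F x in at_top. ln x powr \<delta> \<ge> K" for K :: real using \<delta> by real_asymp
  have "\<forall>\<^sub>F x in at_top. \<delta> * (ln x / (\<alpha> * ln (ln x))) \<ge> w" using \<delta> \<alpha> by real_asymp
  moreover have "\<forall>\<^sub>F x in at_top. ln x / (\<alpha> * ln (ln x)) \<ge> 4" using \<alpha> by real_asymp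
  moreover have "\<forall>\<^sub>F x in at_top. ln x \<ge> real (W + 2)" by real_asymp
  moreover have "\<forall>\<^sub>F x in at_top. ln x / ln (ln x) \<ge> real (C + l)" by real_asymp
  moreover have "\<forall>\<^sub>F x in at_top. ln (ln x) \<ge> (1 :: real)" by real_asymp
  moreover have "\<forall>\<^sub>F x in at_top. x > (1 :: real)" by (rule eventually_gt_at_top)
  moreover have "\<forall>\<^sub>F x in at_top. real ((C * lcm_bound x) ^ C) \<le> x powr (\<delta> / 2)"
    using \<delta> by (intro eventually_lcm_bound_le) (auto simp: C_def)
  ultimately show ?thesis using large[of "real (W + 1)"] large[of "4 * real d"] P_set
  proof eventually_elim
    case (elim x)
    define L where "L = ln x"
    define u where "u = ln L"
    define M where "M = lcm_bound x"
    define B where "B = (C * M) ^ C"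
    \<comment> \<open>Primes up to R are dropped: they are few compared with
      \<open>L powr (\<alpha> - \<delta>)\<close>, and each remaining one contributes at least
      \<open>L powr (\<alpha> - 3 * \<delta>)\<close> polynomials. As R >= L, the remaining primes
      divide neither M nor W.\<close>
    define R where "R = L powr (\<alpha> - 2 * \<delta>)"
    define t where "t = L / (\<alpha> * u)"
    \<comment> \<open>A multiple of \<open>totient W\<close>, for Euler's theorem modulo W. The
      factor 1 - \<delta> leaves room below x for the cofactor.\<close>
    define k where "k = totient W * nat \<lfloor>(1 - \<delta>) * t / w\<rfloor>"
    have L: "L \<ge> real (W + 2)" "L > 1" "u \<ge> 1" using elim(3,5) by (simp_all add: L_def u_def)
    have t4: "t \<ge> 4" and tw: "\<delta> * t \<ge> w" using elim(1,2) by (simp_all add: t_def L_def u_def)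
    have uL: "exp (u * z) = L powr z" for z using L by (simp add: u_def powr_def mult.commute)
    have Lx: "exp (L * z) = x powr z" for z using elim(6) by (simp add: L_def powr_def mult.commute)
    have RL: "R \<ge> L" using powr_mono[of 1 "\<alpha> - 2 * \<delta>" L] L \<delta> by (simp add: R_def)
    have R_le: "(W + 1) * R \<le> L powr (\<alpha> - \<delta>)"
    proof -
      have "real (W + 1) * R \<le> L powr \<delta> * R"
        using elim(8) by (intro mult_right_mono) (simp_all add: L_def R_def)
      also have "\<dots> = L powr (\<alpha> - \<delta>)" by (simp add: R_def flip: powr_add)
      finally show ?thesis by simp
    qed
    have R_ge: "L powr (\<alpha> - 3 * \<delta>) \<le> (R - 1) / (2 * real d)"
    proof -
      have "4 * real d * L powr (\<alpha> - 3 * \<delta>) \<le> L powr \<delta> * L powr (\<alpha> - 3 * \<delta>)"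
        using elim(9) by (intro mult_right_mono) (simp_all add: L_def)
      also have "\<dots> = R" by (simp add: R_def flip: powr_add)
      also have "R \<le> 2 * (R - 1)" using RL L(1) by simp
      finally show ?thesis using d by (simp add: field_simps)
    qed
    have k: "k \<ge> 2" "(1 - 2 * \<delta>) * t \<le> real k" "real k \<le> (1 - \<delta>) * t"
    proof -
      define z where "z = (1 - \<delta>) * t / w"
      have "z \<ge> 0" using w t4 \<delta> by (simp add: z_def)
      hence kz: "real k = w * of_int \<lfloor>z\<rfloor>" by (simp add: k_def w_def z_def)
      have "w * z = (1 - \<delta>) * t" using w by (simp add: z_def)
      moreover have "w * of_int \<lfloor>z\<rfloor> \<le> w * z" using w by (intro mult_left_mono) auto
      moreover have "w * (z - 1) \<le> w * of_int \<lfloor>z\<rfloor>" using w by (intro mult_left_mono) linarith+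
      ultimately show "real k \<le> (1 - \<delta>) * t" and lower: "(1 - 2 * \<delta>) * t \<le> real k"
        using kz tw by (simp_all add: algebra_simps)
      have "(1 / 2) * 4 \<le> (1 - 2 * \<delta>) * t" using \<delta> t4 by (intro mult_mono) auto
      thus "k \<ge> 2" using lower by simp
    qed
    have t: "t * (\<alpha> * u) = L" using \<alpha> L by (simp add: t_def)
    have kL: "real k \<le> L"
    proof -
      have "real k \<le> t * 1" using k(3) \<delta> t4 by (intro order_trans[OF k(3)]) (simp add: mult_left_le_one_le)
      also have "\<dots> \<le> t * (\<alpha> * u)" using \<alpha> L t4 mult_mono[of 1 \<alpha> 1 u] by (intro mult_left_mono) auto
      finally show ?thesis by (simp add: t)
    qed
    have y: "L / u \<le> L" using L by (simp add: divide_le_eq)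
    have M_iff: "p dvd M \<longleftrightarrow> real p \<le> L / u" if "prime p" for p
    proof -
      have "p dvd M \<longleftrightarrow> p \<le> nat \<lfloor>L / u\<rfloor>"
        unfolding M_def lcm_bound_eq L_def u_def by (rule prime_dvd_Lcm_interval_iff[OF that])
      also have "\<dots> \<longleftrightarrow> real p \<le> L / u" using L by (simp add: le_nat_iff le_floor_iff)
      finally show ?thesis .
    qed
    have M0: "M > 0" unfolding M_def lcm_bound_eq by (rule Lcm_interval_pos)
    have Cl: "real (C + l) \<le> L / u" using elim(4) by (simp add: L_def u_def)
    have lM: "l dvd M" using M_iff[OF l] Cl by simp
    have CM: "p dvd M" if "prime p" "p \<le> C'" for p using M_iff[OF that(1)] Cl that(2) by (simp add: C_def)
    define Q where "Q = P_set \<alpha> l x"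
    have Q: "prime p" "real p \<le> L powr \<alpha>" "[p = 1] (mod l)" "(p - 1) dvd M" if "p \<in> Q" for p
      using that by (auto simp: Q_def P_set_def L_def M_def)
    have finQ: "finite Q" by (rule finite_subset[of _ "{..nat \<lfloor>L powr \<alpha>\<rfloor>}"]) (use Q(2) le_nat_floor in auto)
    define Q0 where "Q0 = {p \<in> Q. R < real p}"
    have finQ0: "finite Q0" using finQ by (simp add: Q0_def)
    have "Q - Q0 \<subseteq> {1..nat \<lfloor>R\<rfloor>}"
    proof
      fix p assume p: "p \<in> Q - Q0"
      hence "real p \<le> R" by (auto simp: Q0_def)
      thus "p \<in> {1..nat \<lfloor>R\<rfloor>}" using prime_ge_1_nat[OF Q(1)[of p]] p by (simp add: le_nat_floor)
    qed
    hence "card (Q - Q0) \<le> card {1..nat \<lfloor>R\<rfloor>}" by (intro card_mono) auto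
    hence "real (card (Q - Q0)) \<le> R" using RL L by simp linarith
    moreover have "card Q = card Q0 + card (Q - Q0)"
      using card_Un_disjoint[of Q0 "Q - Q0"] finQ finQ0 by (auto simp: Q0_def Un_Diff_cancel Un_absorb1)
    moreover have "real (card Q) \<ge> L powr (\<alpha> - \<delta>)" using elim(10) by (simp add: Q_def L_def)
    ultimately have Q0: "real W * R \<le> real (card Q0)" using R_le by (simp add: algebra_simps)
    from exists_popular_class[OF finQ0 W] obtain c where c: "card Q0 \<le> W * card {p \<in> Q0. p mod W = c}" ..
    define Q1 where "Q1 = {p \<in> Q0. p mod W = c}"
    have finQ1: "finite Q1" using finQ0 by (simp add: Q1_def)
    have Q1: "p \<in> Q" "R < real p" "p mod W = c" if "p \<in> Q1" for p using that by (auto simp: Q1_def Q0_def)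
    have "real W * R \<le> real (W * card Q1)" using Q0 of_nat_mono[OF c, where 'a = real] by (simp add: Q1_def)
    hence card_Q1: "R \<le> real (card Q1)" using W by simp
    have S: "real (card Q1 choose k) * ((R - 1) / (2 * real d)) ^ k \<le>
      real (\<Sum>n | odd n \<and> n > 1 \<and> \<not> prime n \<and> real n < x. frobenius_count d \<sigma> n) * real B"
    proof (rule sum_frobenius_count_ge[OF finQ1])
      show "prime p \<and> real p \<le> L powr \<alpha> \<and> R \<le> real p" if "p \<in> Q1" for p
        using Q1[OF that] Q[of p] by simp
      show "R \<ge> 1" "k \<ge> 2" using RL L k by simp_all
      fix T assume T: "T \<subseteq> Q1" "card T = k"
      have "[\<Prod>T = 1] (mod W)"
      proof (rule prod_residue_class_cong_1)
        show "totient W dvd card T" by (simp add: T(2) k_def)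
        fix p assume "p \<in> T"
        hence p: "p \<in> Q1" using T by blast
        have "\<not> p dvd W"
        proof
          assume "p dvd W"
          hence "real p \<le> real W" using W by (intro of_nat_mono dvd_imp_le)
          thus False using Q1(2)[OF p] RL L(1) by simp
        qed
        hence "Rings.coprime p W" using prime_imp_coprime[OF Q(1)[OF Q1(1)[OF p]]] by blast
        thus "p mod W = c \<and> Rings.coprime p W" using Q1(3)[OF p] by blast
      qed
      moreover have "prime p \<and> [p = 1] (mod l) \<and> (p - 1) dvd M \<and> \<not> p dvd M" if "p \<in> T" for p
      proof -
        have p: "p \<in> Q1" using that T by blast
        have "\<not> p dvd M" using M_iff[OF Q(1)[OF Q1(1)[OF p]]] Q1(2)[OF p] RL y by simp
        thus ?thesis using Q[OF Q1(1)[OF p]] by blast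
      qed
      moreover have "finite T" "T \<noteq> {}" using T finQ1 k(1) by (auto intro: finite_subset)
      ultimately have "\<exists>m>0. m \<le> (C' * M) ^ C' \<and> odd (\<Prod>T * m) \<and>
        (\<Prod>p\<in>T. (real p - 1) / (2 * real d)) \<le> real (frobenius_count d \<sigma> (\<Prod>T * m))"
        unfolding W_def by (intro C'[OF M0 lM CM])
      then obtain m where m: "m > 0" "m \<le> (C' * M) ^ C'" "odd (\<Prod>T * m)"
        "(\<Prod>p\<in>T. (real p - 1) / (2 * real d)) \<le> real (frobenius_count d \<sigma> (\<Prod>T * m))" by (elim exE conjE)
      have "(C' * M) ^ C' \<le> (C * M) ^ C'" by (intro power_mono mult_right_mono) (simp_all add: C_def)
      also have "\<dots> \<le> B" unfolding B_def using M0 by (intro power_increasing) (simp_all add: C_def)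
      finally have "m \<le> B" using m(2) by simp
      thus "\<exists>m>0. m \<le> B \<and> odd (\<Prod>T * m) \<and>
        (\<Prod>p\<in>T. (real p - 1) / (2 * real d)) \<le> real (frobenius_count d \<sigma> (\<Prod>T * m))"
        using m by (intro exI[of _ m] conjI)
    next
      have "(L powr \<alpha>) ^ k = exp (u * \<alpha> * real k)" by (simp add: mult.commute exp_of_nat_mult flip: uL)
      also have "\<dots> \<le> exp (u * \<alpha> * ((1 - \<delta>) * t))" using L \<alpha> k(3) by (simp add: mult_left_mono)
      also have "u * \<alpha> * ((1 - \<delta>) * t) = (t * (\<alpha> * u)) * (1 - \<delta>)" by (simp only: mult_ac)
      also have "exp \<dots> = x powr (1 - \<delta>)" by (simp only: t Lx)
      finally have "(L powr \<alpha>) ^ k * real B \<le> x powr (1 - \<delta>) * x powr (\<delta> / 2)"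
        using elim(7) by (intro mult_mono) (simp_all add: B_def M_def)
      also have "\<dots> = x powr (1 - \<delta> / 2)" by (simp flip: powr_add)
      also have "\<dots> < x powr 1" using elim(6) \<delta> by (intro powr_less_mono) auto
      also have "\<dots> = x" using elim(6) by simp
      finally show "(L powr \<alpha>) ^ k * real B < x" .
    qed
    \<comment> \<open>Each of the k primes accounts for the exponent \<alpha> - 1 - 2 * \<delta>
      through the binomial coefficient, at least (R / L)^k, and for \<alpha> - 3 * \<delta> through
      the polynomials; E is the sum.\<close>
    define E where "E = 2 * \<alpha> - 1 - 5 * \<delta>"
    have E: "E \<ge> 0" using \<delta> \<alpha> by (simp add: E_def)
    have kQ1: "k \<le> card Q1" using kL RL card_Q1 by simp
    have "x powr (2 - 1 / \<alpha> - 7 * \<delta>) \<le> x powr (E * (1 - 2 * \<delta>) / \<alpha>)"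
    proof (rule powr_mono)
      have "2 * \<alpha> - 1 - 7 * (\<alpha> * \<delta>) \<le> E * (1 - 2 * \<delta>)"
      proof -
        have "\<delta> \<le> \<alpha> * \<delta>" using \<alpha> \<delta>(1) by simp
        moreover have "0 \<le> \<delta> * \<delta>" by simp
        moreover have "E * (1 - 2 * \<delta>) = 2 * \<alpha> - 1 - 3 * \<delta> - 4 * (\<alpha> * \<delta>) + 10 * (\<delta> * \<delta>)"
          by (simp add: E_def algebra_simps)
        ultimately show ?thesis by linarith
      qed
      thus "2 - 1 / \<alpha> - 7 * \<delta> \<le> E * (1 - 2 * \<delta>) / \<alpha>" using \<alpha> by (simp add: field_simps)
    qed (use elim(6) in simp)
    also have "\<dots> = exp (u * E * ((1 - 2 * \<delta>) * t))"
    proof -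
      have "u * E * ((1 - 2 * \<delta>) * t) = L * (E * (1 - 2 * \<delta>) / \<alpha>)"
        using \<alpha> by (simp flip: t)
      thus ?thesis by (simp only: Lx)
    qed
    also have "\<dots> \<le> exp (u * E * real k)" using E L k(2) by (simp add: mult_left_mono)
    also have "\<dots> = (L powr E) ^ k" by (simp add: mult.commute exp_of_nat_mult flip: uL)
    also have "\<dots> = (L powr (\<alpha> - 1 - 2 * \<delta>)) ^ k * (L powr (\<alpha> - 3 * \<delta>)) ^ k"
    proof -
      have "E = (\<alpha> - 1 - 2 * \<delta>) + (\<alpha> - 3 * \<delta>)" by (simp add: E_def)
      hence "L powr E = L powr (\<alpha> - 1 - 2 * \<delta>) * L powr (\<alpha> - 3 * \<delta>)" by (simp only: powr_add)
      thus ?thesis by (simp only: power_mult_distrib)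
    qed
    also have "\<dots> \<le> real (card Q1 choose k) * ((R - 1) / (2 * real d)) ^ k"
    proof (rule mult_mono)
      have "L powr (\<alpha> - 1 - 2 * \<delta>) = R / L"
        using L by (simp add: R_def powr_diff divide_simps)
      also have "\<dots> \<le> real (card Q1) / real k" using card_Q1 kL k(1) L by (intro frac_le) auto
      finally have "(L powr (\<alpha> - 1 - 2 * \<delta>)) ^ k \<le> (real (card Q1) / real k) ^ k" by (intro power_mono) auto
      also have "\<dots> \<le> real (card Q1 choose k)" by (rule binomial_ge_n_over_k_pow_k[OF kQ1])
      finally show "(L powr (\<alpha> - 1 - 2 * \<delta>)) ^ k \<le> real (card Q1 choose k)" .
      show "(L powr (\<alpha> - 3 * \<delta>)) ^ k \<le> ((R - 1) / (2 * real d)) ^ k" using R_ge by (intro power_mono) auto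
    qed auto
    also note S
    also have "real (\<Sum>n | odd n \<and> n > 1 \<and> \<not> prime n \<and> real n < x. frobenius_count d \<sigma> n) * real B
      \<le> real (\<Sum>n | odd n \<and> n > 1 \<and> \<not> prime n \<and> real n < x. frobenius_count d \<sigma> n) * x powr \<delta>"
    proof (rule mult_left_mono)
      have "real B \<le> x powr (\<delta> / 2)" using elim(7) by (simp only: B_def M_def)
      also have "\<dots> \<le> x powr \<delta>" using elim(6) \<delta> by (intro powr_mono) auto
      finally show "real B \<le> x powr \<delta>" .
    qed (rule of_nat_0_le_iff)
    finally have "x powr (2 - 1 / \<alpha> - 7 * \<delta>) / x powr \<delta> \<le>
      real (\<Sum>n | odd n \<and> n > 1 \<and> \<not> prime n \<and> real n < x. frobenius_count d \<sigma> n)"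
      using elim(6) by (subst pos_divide_le_eq) simp_all
    moreover have "x powr (2 - 1 / \<alpha> - 7 * \<delta>) / x powr \<delta> = x powr (2 - 1 / \<alpha> - 8 * \<delta>)"
      by (simp flip: powr_diff)
    ultimately show ?case by (simp only:)
  qed
qed

theorem theorem4p16:
  fixes d l :: nat and \<sigma> :: "nat \<Rightarrow> nat" and \<alpha> :: real
  assumes "d \<ge> 1"
    and "\<sigma> permutes {1..d}" and "cyclic_on \<sigma> {1..d}"
    and "prime l" and "[l = 1] (mod d)"
    and "\<alpha> > 1"
    and "\<exists>\<epsilon> :: real \<Rightarrow> real. (\<epsilon> \<longlongrightarrow> 0) at_top \<and>
           (\<forall>\<^sub>F x in at_top. real (card (P_set \<alpha> l x)) \<ge> ln x powr (\<alpha> - \<epsilon> x))"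
  shows "\<exists>\<epsilon> :: real \<Rightarrow> real. (\<epsilon> \<longlongrightarrow> 0) at_top \<and>
           (\<forall>\<^sub>F x in at_top.
              real (\<Sum>n | odd n \<and> n > 1 \<and> \<not> prime n \<and> real n < x. frobenius_count d \<sigma> n)
                \<ge> x powr (2 - 1 / \<alpha> - \<epsilon> x))"
proof (rule powr_o1_lower_bound)
  fix e :: real assume e: "e > 0"
  \<comment> \<open>The total loss is 8 * \<delta>: 7 * \<delta> in the count and \<delta> for the
    division by the number of cofactors. The other two bounds keep k >= 2 and R >= L.\<close>
  define \<delta> where "\<delta> = min (e / 8) (min (1 / 4) ((\<alpha> - 1) / 5))"
  have "\<delta> \<le> (\<alpha> - 1) / 5" "\<delta> \<le> e / 8" unfolding \<delta>_def by linarith+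
  moreover have "\<delta> > 0" "\<delta> \<le> 1 / 4" using e assms(6) by (simp_all add: \<delta>_def)
  ultimately have \<delta>: "\<delta> > 0" "\<delta> \<le> 1 / 4" "5 * \<delta> \<le> \<alpha> - 1" "8 * \<delta> \<le> e" by simp_all
  obtain \<epsilon> :: "real \<Rightarrow> real" where \<epsilon>: "(\<epsilon> \<longlongrightarrow> 0) at_top"
    "\<forall>\<^sub>F x in at_top. real (card (P_set \<alpha> l x)) \<ge> ln x powr (\<alpha> - \<epsilon> x)"
    using assms(7) by (elim exE conjE)
  have "\<forall>\<^sub>F x in at_top. \<epsilon> x < \<delta>" using order_tendstoD(2)[OF \<epsilon>(1) \<delta>(1)] .
  moreover have "\<forall>\<^sub>F x in at_top. ln x \<ge> (1 :: real)" by real_asymp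
  ultimately have "\<forall>\<^sub>F x in at_top. real (card (P_set \<alpha> l x)) \<ge> ln x powr (\<alpha> - \<delta>)" using \<epsilon>(2)
  proof eventually_elim
    case (elim x)
    have "ln x powr (\<alpha> - \<delta>) \<le> ln x powr (\<alpha> - \<epsilon> x)" using elim by (intro powr_mono) auto
    thus ?case using elim(3) by simp
  qed
  from frobenius_sum_eventually_ge[OF assms(1-5) this \<delta>(1-3)] eventually_gt_at_top[of 1]
  show "\<forall>\<^sub>F x in at_top.
      real (\<Sum>n | odd n \<and> n > 1 \<and> \<not> prime n \<and> real n < x. frobenius_count d \<sigma> n)
        \<ge> x powr (2 - 1 / \<alpha> - e)"
  proof eventually_elim
    case (elim x)
    have "x powr (2 - 1 / \<alpha> - e) \<le> x powr (2 - 1 / \<alpha> - 8 * \<delta>)" using elim \<delta>(4) by (intro powr_mono) auto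
    thus ?case using elim(1) by linarith
  qed
qed

end
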